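(* Let $S$ be an inverse monoid and let $H$ be a full inverse subsemigroup of $S$ of finite index in $S$. Then $S$ is of type $FP_{\infty}$ if and only if $H$ is of type $FP_{\infty}$.
   Context: An inverse monoid is a monoid $S$ in which every element $x$ has a unique element $x^{-1}$ with $x=xx^{-1}x$ and $x^{-1}=x^{-1}xx^{-1}$. An inverse subsemigroup $H$ of $S$ (a subsemigroup closed under $x\mapsto x^{-1}$) is full if it contains all idempotents of $S$; in particular it contains the identity of $S$ and is itself an inverse monoid. For an inverse monoid $T$ with set of idempotents $E$, the congruence $\sigma$ is defined by: $a\,\sigma\,b$ iff there is $e\in E$ with $ae=be$ (equivalently, there is $f\in E$ with $fa=fb$). The quotient $T/\sigma$ is a group, called the maximum group image of $T$. If $H$ is a full inverse subsemigroup of $S$, the inclusion $H\subseteq S$ induces an injective homomorphism from the maximum group image of $H$ to the maximum group image of $S$, by which the former is regarded as a subgroup of the latter. $H$ is said to be of finite index in $S$ if the maximum group image of $H$ has finite index in the maximum group image of $S$. A monoid $T$ is of type $FP_{\infty}$ if the trivial left $\mathbb{Z}T$-module $\mathbb{Z}$ (each element of $T$ acts as the identity) admits a resolution $\cdots\to P_1\to P_0\to\mathbb{Z}\to 0$ by finitely generated free (equivalently, finitely generated projective) left $\mathbb{Z}T$-modules, where $\mathbb{Z}T$ is the integral monoid ring. *)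

theory Defs
  imports "HOL-Algebra.Algebra"
begin

section \<open>Inverse monoids and full inverse subsemigroups\<close>

locale inverse_monoid = monoid S for S (structure) +
  assumes ex1_inverse:
    "x \<in> carrier S \<Longrightarrow>
      \<exists>!y. y \<in> carrier S \<and> x = x \<otimes> y \<otimes> x \<and> y = y \<otimes> x \<otimes> y"

text \<open>The semigroup-theoretic inverse; \<^term>\<open>m_inv\<close> of HOL-Algebra is only meaningful on units.\<close>

definition sg_inv :: "('a, 'b) monoid_scheme \<Rightarrow> 'a \<Rightarrow> 'a" where
  "sg_inv S x = (THE y. y \<in> carrier S \<and> x = x \<otimes>\<^bsub>S\<^esub> y \<otimes>\<^bsub>S\<^esub> x \<and> y = y \<otimes>\<^bsub>S\<^esub> x \<otimes>\<^bsub>S\<^esub> y)"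

definition idempotents :: "('a, 'b) monoid_scheme \<Rightarrow> 'a set" where
  "idempotents S = {e \<in> carrier S. e \<otimes>\<^bsub>S\<^esub> e = e}"

definition inverse_subsemigroup :: "'a set \<Rightarrow> ('a, 'b) monoid_scheme \<Rightarrow> bool" where
  "inverse_subsemigroup H S \<longleftrightarrow>
     H \<subseteq> carrier S \<and>
     (\<forall>x\<in>H. \<forall>y\<in>H. x \<otimes>\<^bsub>S\<^esub> y \<in> H) \<and>
     (\<forall>x\<in>H. sg_inv S x \<in> H)"

definition full_inverse_subsemigroup :: "'a set \<Rightarrow> ('a, 'b) monoid_scheme \<Rightarrow> bool" where
  "full_inverse_subsemigroup H S \<longleftrightarrow> inverse_subsemigroup H S \<and> idempotents S \<subseteq> H"


section \<open>Maximum group image and finite index\<close>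

definition sigma :: "('a, 'b) monoid_scheme \<Rightarrow> ('a \<times> 'a) set" where
  "sigma T = {(a, b). a \<in> carrier T \<and> b \<in> carrier T \<and>
                (\<exists>e\<in>idempotents T. a \<otimes>\<^bsub>T\<^esub> e = b \<otimes>\<^bsub>T\<^esub> e)}"

definition max_group_image :: "('a, 'b) monoid_scheme \<Rightarrow> 'a set monoid" where
  "max_group_image T =
     \<lparr>carrier = carrier T // sigma T,
      monoid.mult = (\<lambda>A B. \<Union>a\<in>A. \<Union>b\<in>B. sigma T `` {a \<otimes>\<^bsub>T\<^esub> b}),
      one = sigma T `` {\<one>\<^bsub>T\<^esub>}\<rparr>"

text \<open>
  For a full inverse subsemigroup \<open>H\<close>, the homomorphism of maximum group images induced by the
  inclusion sends the class of \<open>h\<close> in \<open>H\<close> to the class of \<open>h\<close> in \<open>S\<close>. On a class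
  \<open>C\<close> this is the relational image of \<open>C\<close> under \<open>\<sigma>\<close> of \<open>S\<close>.
\<close>

definition induced_group_hom :: "('a, 'b) monoid_scheme \<Rightarrow> 'a set \<Rightarrow> 'a set" where
  "induced_group_hom S C = sigma S `` C"

definition finite_index :: "'a set \<Rightarrow> ('a, 'b) monoid_scheme \<Rightarrow> bool" where
  "finite_index H S \<longleftrightarrow>
     finite (rcosets\<^bsub>max_group_image S\<^esub>
       (induced_group_hom S ` carrier (max_group_image (S\<lparr>carrier := H\<rparr>))))"


section \<open>Left modules over a not necessarily commutative ring\<close>

text \<open>
  The locale \<^locale>\<open>module\<close> requires a commutative ring of scalars; the axioms below are the same
  with \<^locale>\<open>cring\<close> replaced by \<^locale>\<open>ring\<close>. As there, the fields \<^const>\<open>monoid.mult\<close> and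
  \<^const>\<open>one\<close> of the module record are not used.
\<close>

locale left_module = R?: ring R + M?: abelian_group M
  for R :: "('r, 'x) ring_scheme" (structure) and M :: "('r, 'm, 'c) module_scheme" (structure) +
  assumes lsmult_closed:
      "\<lbrakk>a \<in> carrier R; x \<in> carrier M\<rbrakk> \<Longrightarrow> a \<odot>\<^bsub>M\<^esub> x \<in> carrier M"
    and lsmult_l_distr:
      "\<lbrakk>a \<in> carrier R; b \<in> carrier R; x \<in> carrier M\<rbrakk> \<Longrightarrow>
         (a \<oplus>\<^bsub>R\<^esub> b) \<odot>\<^bsub>M\<^esub> x = a \<odot>\<^bsub>M\<^esub> x \<oplus>\<^bsub>M\<^esub> b \<odot>\<^bsub>M\<^esub> x"
    and lsmult_r_distr:
      "\<lbrakk>a \<in> carrier R; x \<in> carrier M; y \<in> carrier M\<rbrakk> \<Longrightarrow>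
         a \<odot>\<^bsub>M\<^esub> (x \<oplus>\<^bsub>M\<^esub> y) = a \<odot>\<^bsub>M\<^esub> x \<oplus>\<^bsub>M\<^esub> a \<odot>\<^bsub>M\<^esub> y"
    and lsmult_assoc:
      "\<lbrakk>a \<in> carrier R; b \<in> carrier R; x \<in> carrier M\<rbrakk> \<Longrightarrow>
         (a \<otimes>\<^bsub>R\<^esub> b) \<odot>\<^bsub>M\<^esub> x = a \<odot>\<^bsub>M\<^esub> (b \<odot>\<^bsub>M\<^esub> x)"
    and lsmult_one:
      "x \<in> carrier M \<Longrightarrow> \<one>\<^bsub>R\<^esub> \<odot>\<^bsub>M\<^esub> x = x"

definition left_module_hom ::
  "('r, 'x) ring_scheme \<Rightarrow> ('r, 'm, 'y) module_scheme \<Rightarrow> ('r, 'n, 'z) module_scheme \<Rightarrow> ('m \<Rightarrow> 'n) set"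
  where
  "left_module_hom R M N =
     {f \<in> carrier M \<rightarrow> carrier N.
        (\<forall>x\<in>carrier M. \<forall>y\<in>carrier M. f (x \<oplus>\<^bsub>M\<^esub> y) = f x \<oplus>\<^bsub>N\<^esub> f y) \<and>
        (\<forall>a\<in>carrier R. \<forall>x\<in>carrier M. f (a \<odot>\<^bsub>M\<^esub> x) = a \<odot>\<^bsub>N\<^esub> f x)}"

definition fg_free_left_module ::
  "('r, 'x) ring_scheme \<Rightarrow> ('r, 'm, 'y) module_scheme \<Rightarrow> bool" where
  "fg_free_left_module R M \<longleftrightarrow>
     left_module R M \<and>
     (\<exists>B. finite B \<and> B \<subseteq> carrier M \<and>
        (\<forall>m\<in>carrier M. \<exists>!c. c \<in> B \<rightarrow>\<^sub>E carrier R \<and> m = (\<Oplus>\<^bsub>M\<^esub>b\<in>B. c b \<odot>\<^bsub>M\<^esub> b)))"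


section \<open>The integral monoid ring and type FP-infinity\<close>

definition monoid_ring :: "('a, 'b) monoid_scheme \<Rightarrow> ('a \<Rightarrow> int) ring" where
  "monoid_ring T =
     \<lparr>carrier = {f. finite {x. f x \<noteq> 0} \<and> {x. f x \<noteq> 0} \<subseteq> carrier T},
      monoid.mult = (\<lambda>f g z. \<Sum>x | f x \<noteq> 0. \<Sum>y | g y \<noteq> 0. if x \<otimes>\<^bsub>T\<^esub> y = z then f x * g y else 0),
      one = (\<lambda>z. if z = \<one>\<^bsub>T\<^esub> then 1 else 0),
      ring.zero = (\<lambda>z. 0),
      ring.add = (\<lambda>f g z. f z + g z)\<rparr>"

text \<open>
  The integers with every element of the monoid acting as the identity: by additivity, a ring
  element acts as multiplication by the sum of its coefficients.
\<close>

definition trivial_module :: "('a \<Rightarrow> int, int) module" where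
  "trivial_module =
     \<lparr>carrier = UNIV, monoid.mult = (*), one = 1, ring.zero = 0, ring.add = (+),
      smult = (\<lambda>f k. (\<Sum>x | f x \<noteq> 0. f x) * k)\<rparr>"

text \<open>
  An existential quantifier over modules needs a fixed type for their elements. The type
  \<^typ>\<open>nat \<Rightarrow> 'a \<Rightarrow> int\<close> is no restriction: every finitely generated free left module over
  the monoid ring is isomorphic to a standard one of tuples of elements of the ring, which are
  represented in this type.
\<close>

definition type_FP_infinity :: "('a, 'b) monoid_scheme \<Rightarrow> bool" where
  "type_FP_infinity T \<longleftrightarrow>
     (\<exists>(P :: nat \<Rightarrow> ('a \<Rightarrow> int, nat \<Rightarrow> 'a \<Rightarrow> int) module) d \<epsilon>.
        (\<forall>n. fg_free_left_module (monoid_ring T) (P n)) \<and>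
        \<epsilon> \<in> left_module_hom (monoid_ring T) (P 0) trivial_module \<and>
        (\<forall>n. d n \<in> left_module_hom (monoid_ring T) (P (Suc n)) (P n)) \<and>
        \<epsilon> ` carrier (P 0) = carrier (trivial_module :: ('a \<Rightarrow> int, int) module) \<and>
        d 0 ` carrier (P 1) = a_kernel (P 0) (trivial_module :: ('a \<Rightarrow> int, int) module) \<epsilon> \<and>
        (\<forall>n. d (Suc n) ` carrier (P (Suc (Suc n))) = a_kernel (P (Suc n)) (P n) (d n)))"

end

theory Submission
  imports Defs
begin

text \<open>
  Modules over \<open>\<int>T\<close> are treated as groups of finitely supported integral functions on
  which \<open>T\<close> acts by moving the basis, and type \<open>FP\<^sub>n\<^sub>+\<^sub>1\<close> as finite generation with syzygies
  of type \<open>FP\<^sub>n\<close>. Let \<open>X\<close> be the finite \<open>S\<close>-set of cosets of the maximum group image of \<open>H\<close>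
  in that of \<open>S\<close>.

  Because \<open>H\<close> contains all idempotents, \<open>\<int>S\<close> is faithfully flat as a right \<open>\<int>H\<close>-module: if
  \<open>s y\<close> is supported on \<open>A H\<close> for a finite set \<open>A\<close>, then \<open>s\<close> can be cut down by finitely many
  factors \<open>1 - h h\<inverse>\<close> so as to kill \<open>y\<close>, and what is cut off lies in \<open>A \<int>H\<close>. Inducing the
  trivial module from \<open>\<int>H\<close> to \<open>\<int>S\<close> gives \<open>\<int>X\<close>; hence \<open>H\<close> is of type \<open>FP\<^sub>\<infinity>\<close> if and only if
  the \<open>\<int>S\<close>-module \<open>\<int>X\<close> is. This in turn is equivalent to \<open>S\<close> being of type \<open>FP\<^sub>\<infinity>\<close>: as \<open>S\<close>
  acts on \<open>X\<close> by permutations, tensoring with \<open>\<int>X\<close> preserves \<open>FP\<^sub>\<infinity>\<close>, and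
  \<open>\<cdots> \<rightarrow> \<int>X\<^sup>2 \<rightarrow> \<int>X \<rightarrow> \<int> \<rightarrow> 0\<close> is exact.
\<close>

section \<open>Finiteness properties of modules with a monoid action\<close>

text \<open>For groups, \<int>S is free over \<int>H on coset representatives. In an inverse monoid
  the sets s H may overlap partially and s need not act injectively, so the cutting argument takes
  the place of such a basis: it makes induction exact and lets finite generation descend. No tensor
  product over \<int>H is built. For a submodule L of a free \<int>H-module, the induced module is
  the additive group spanned by the translates s l inside the free \<int>S-module, and flatness says
  that syzygies over S are induced from those over H. Since \<int> is not given inside a free
  module, induction is applied to the augmentation ideal, its first syzygy module; the induced
  module is then the kernel of \<int>S \<rightarrow> \<int>X. FP_n refers to some choice of
  generators. Schanuel's lemma frees it from that choice, which serves both the descent to H and the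
  passage from FP_n for each n to one resolution. The complex of tuples is infinite to the left. A
  quotient is of type FP_{n+1} once the middle term is and the kernel is of type FP_n, so an
  induction on n that treats all degrees at once closes.\<close>

abbreviation keys :: "('b \<Rightarrow>\<^sub>0 int) \<Rightarrow> 'b set" where
  "keys \<equiv> Poly_Mapping.keys"

abbreviation lookup :: "('b \<Rightarrow>\<^sub>0 int) \<Rightarrow> 'b \<Rightarrow> int" where
  "lookup \<equiv> Poly_Mapping.lookup"

definition frag_map :: "('b \<Rightarrow> 'c) \<Rightarrow> ('b \<Rightarrow>\<^sub>0 int) \<Rightarrow> 'c \<Rightarrow>\<^sub>0 int" where
  "frag_map f = frag_extend (\<lambda>b. frag_of (f b))"

lemma frag_map_of [simp]: "frag_map f (frag_of b) = frag_of (f b)"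
  and frag_map_0 [simp]: "frag_map f 0 = 0"
  and frag_map_diff: "frag_map f (u - v) = frag_map f u - frag_map f v"
  and frag_map_add: "frag_map f (u + v) = frag_map f u + frag_map f v"
  by (simp_all add: frag_map_def frag_extend_diff frag_extend_add)

lemma keys_frag_map: "keys (frag_map f u) \<subseteq> f ` keys u"
  unfolding frag_map_def using keys_frag_extend[of "\<lambda>b. frag_of (f b)" u] by auto

lemma frag_extend_frag_map: "frag_extend g (frag_map f u) = frag_extend (\<lambda>b. g (f b)) u"
  unfolding frag_map_def using frag_extend_compose[of g f u] by (simp add: o_def)

lemma frag_map_frag_map: "frag_map g (frag_map f u) = frag_map (\<lambda>b. g (f b)) u"
  unfolding frag_map_def[of g] frag_extend_frag_map by (simp add: frag_map_def)

lemma frag_map_cong: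
  "(\<And>b. b \<in> keys u \<Longrightarrow> f b = g b) \<Longrightarrow> frag_map f u = frag_map g u"
  unfolding frag_map_def by (rule frag_extend_eq) simp

lemma frag_map_ident:
  assumes "\<And>b. b \<in> keys u \<Longrightarrow> f b = b"
  shows "frag_map f u = u"
proof -
  have "frag_map f u = frag_extend frag_of u"
    unfolding frag_map_def using assms by (intro frag_extend_eq) simp
  then show ?thesis using frag_expansion[of u] by simp
qed

lemma additive_on_zero:
  fixes \<phi> :: "'m::group_add \<Rightarrow> 'n::group_add"
  assumes "\<And>x y. x \<in> M \<Longrightarrow> y \<in> M \<Longrightarrow> \<phi> (x - y) = \<phi> x - \<phi> y" and "x \<in> M"
  shows "\<phi> 0 = 0"
  using assms(1)[OF assms(2) assms(2)] by simp

text \<open>The laws are required of the additive maps on \<open>M\<close> alone, so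
  \<open>act\<close> need not be an action on the whole basis type. Closure under differences,
  together with \<open>0\<close>, is the subgroup condition in one clause.\<close>

definition gmodule ::
  "('a, 'z) monoid_scheme \<Rightarrow> ('a \<Rightarrow> 'b \<Rightarrow> 'b) \<Rightarrow> ('b \<Rightarrow>\<^sub>0 int) set \<Rightarrow> bool" where
  "gmodule T act M \<longleftrightarrow>
     0 \<in> M \<and> (\<forall>x\<in>M. \<forall>y\<in>M. x - y \<in> M) \<and>
     (\<forall>t\<in>carrier T. \<forall>x\<in>M. frag_map (act t) x \<in> M) \<and>
     (\<forall>x\<in>M. frag_map (act \<one>\<^bsub>T\<^esub>) x = x) \<and>
     (\<forall>s\<in>carrier T. \<forall>t\<in>carrier T. \<forall>x\<in>M.
        frag_map (act (s \<otimes>\<^bsub>T\<^esub> t)) x = frag_map (act s) (frag_map (act t) x))"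

lemma gmoduleD:
  assumes "gmodule T act M"
  shows "0 \<in> M"
    and "x \<in> M \<Longrightarrow> y \<in> M \<Longrightarrow> x - y \<in> M"
    and "t \<in> carrier T \<Longrightarrow> x \<in> M \<Longrightarrow> frag_map (act t) x \<in> M"
    and "x \<in> M \<Longrightarrow> frag_map (act \<one>\<^bsub>T\<^esub>) x = x"
    and "s \<in> carrier T \<Longrightarrow> t \<in> carrier T \<Longrightarrow> x \<in> M \<Longrightarrow>
           frag_map (act (s \<otimes>\<^bsub>T\<^esub> t)) x = frag_map (act s) (frag_map (act t) x)"
  using assms unfolding gmodule_def by blast+

lemma gmodule_add:
  assumes "gmodule T act M" "x \<in> M" "y \<in> M"
  shows "x + y \<in> M"
proof -
  have "x - (0 - y) \<in> M" by (intro gmoduleD(2)[OF assms(1)] gmoduleD(1)[OF assms(1)] assms)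
  then show ?thesis by simp
qed

lemma gmodule_uminus:
  assumes "gmodule T act M" "x \<in> M"
  shows "- x \<in> M"
  using gmoduleD(2)[OF assms(1) gmoduleD(1)[OF assms(1)] assms(2)] by simp

definition ghom ::
  "('a, 'z) monoid_scheme \<Rightarrow> ('a \<Rightarrow> 'b \<Rightarrow> 'b) \<Rightarrow> ('a \<Rightarrow> 'c \<Rightarrow> 'c) \<Rightarrow>
    ('b \<Rightarrow>\<^sub>0 int) set \<Rightarrow> (('b \<Rightarrow>\<^sub>0 int) \<Rightarrow> 'c \<Rightarrow>\<^sub>0 int) \<Rightarrow> bool" where
  "ghom T act act' M \<phi> \<longleftrightarrow>
     (\<forall>x\<in>M. \<forall>y\<in>M. \<phi> (x - y) = \<phi> x - \<phi> y) \<and>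
     (\<forall>t\<in>carrier T. \<forall>x\<in>M. \<phi> (frag_map (act t) x) = frag_map (act' t) (\<phi> x))"

lemma ghomD:
  assumes "ghom T act act' M \<phi>"
  shows "x \<in> M \<Longrightarrow> y \<in> M \<Longrightarrow> \<phi> (x - y) = \<phi> x - \<phi> y"
    and "t \<in> carrier T \<Longrightarrow> x \<in> M \<Longrightarrow> \<phi> (frag_map (act t) x) = frag_map (act' t) (\<phi> x)"
  using assms unfolding ghom_def by blast+

lemma ghom_zero: "ghom T act act' M \<phi> \<Longrightarrow> gmodule T act M \<Longrightarrow> \<phi> 0 = 0"
  using additive_on_zero[of M \<phi> 0] ghomD(1) gmoduleD(1) by metis

lemma ghom_add:
  assumes "ghom T act act' M \<phi>" "gmodule T act M" "x \<in> M" "y \<in> M"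
  shows "\<phi> (x + y) = \<phi> x + \<phi> y"
proof -
  have y: "- y \<in> M" using gmodule_uminus assms by blast
  have "\<phi> (0 - y) = 0 - \<phi> y"
    using ghomD(1)[OF assms(1) gmoduleD(1)[OF assms(2)] assms(4)] ghom_zero[OF assms(1,2)] by simp
  with ghomD(1)[OF assms(1,3) y] show ?thesis by simp
qed

lemma ghom_subset: "ghom T act act' M \<phi> \<Longrightarrow> N \<subseteq> M \<Longrightarrow> ghom T act act' N \<phi>"
  unfolding ghom_def by blast

lemma gmodule_ker:
  assumes "gmodule T act M" "ghom T act act' M \<phi>"
  shows "gmodule T act {x \<in> M. \<phi> x = 0}"
  using assms(1) ghomD[OF assms(2)] ghom_zero[OF assms(2,1)]
  unfolding gmodule_def by auto

lemma gmodule_image: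
  assumes "monoid T" "gmodule T act M" "ghom T act act' M \<phi>"
  shows "gmodule T act' (\<phi> ` M)"
proof -
  interpret monoid T by fact
  note M = gmoduleD[OF assms(2)] and h = ghomD[OF assms(3)]
  show ?thesis
    unfolding gmodule_def
  proof (intro conjI ballI)
    show "0 \<in> \<phi> ` M" using ghom_zero[OF assms(3,2)] M(1) by (metis imageI)
    fix x assume "x \<in> \<phi> ` M"
    then obtain x' where x': "x' \<in> M" "x = \<phi> x'" by blast
    show "frag_map (act' \<one>\<^bsub>T\<^esub>) x = x" using h(2)[OF one_closed x'(1)] M(4) x' by simp
    { fix y assume "y \<in> \<phi> ` M"
      then obtain y' where y': "y' \<in> M" "y = \<phi> y'" by blast
      show "x - y \<in> \<phi> ` M" using h(1)[OF x'(1) y'(1)] M(2)[OF x'(1) y'(1)] x' y' by (metis imageI) }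
    fix t assume t: "t \<in> carrier T"
    show "frag_map (act' t) x \<in> \<phi> ` M" using h(2)[OF t x'(1)] M(3)[OF t x'(1)] x' by (metis imageI)
  next
    fix s t x assume st: "s \<in> carrier T" "t \<in> carrier T" and "x \<in> \<phi> ` M"
    then obtain x' where x': "x' \<in> M" "x = \<phi> x'" by blast
    show "frag_map (act' (s \<otimes>\<^bsub>T\<^esub> t)) x = frag_map (act' s) (frag_map (act' t) x)"
      using h(2)[OF m_closed[OF st] x'(1)] h(2)[OF st(1) M(3)[OF st(2) x'(1)]] h(2)[OF st(2) x'(1)]
        M(5)[OF st x'(1)] x' by simp
  qed
qed

section \<open>Free modules, syzygies and the finiteness conditions\<close>

definition free_module :: "('a, 'z) monoid_scheme \<Rightarrow> 'i set \<Rightarrow> ('i \<times> 'a \<Rightarrow>\<^sub>0 int) set" where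
  "free_module T I = {u. keys u \<subseteq> I \<times> carrier T}"

definition free_act :: "('a, 'z) monoid_scheme \<Rightarrow> 'a \<Rightarrow> 'i \<times> 'a \<Rightarrow> 'i \<times> 'a" where
  "free_act T s = (\<lambda>(i, t). (i, s \<otimes>\<^bsub>T\<^esub> t))"

abbreviation smul :: "('a, 'z) monoid_scheme \<Rightarrow> 'a \<Rightarrow> ('i \<times> 'a \<Rightarrow>\<^sub>0 int) \<Rightarrow> 'i \<times> 'a \<Rightarrow>\<^sub>0 int" where
  "smul T s \<equiv> frag_map (free_act T s)"

text \<open>A basis pair \<open>(i, t)\<close> stands for t times the i-th free generator, so
  \<open>lin\<close> is the homomorphism that sends this generator to \<open>m i\<close>.\<close>

definition lin ::
  "('a \<Rightarrow> 'b \<Rightarrow> 'b) \<Rightarrow> ('i \<Rightarrow> 'b \<Rightarrow>\<^sub>0 int) \<Rightarrow> ('i \<times> 'a \<Rightarrow>\<^sub>0 int) \<Rightarrow> 'b \<Rightarrow>\<^sub>0 int" where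
  "lin act m = frag_extend (\<lambda>(i, t). frag_map (act t) (m i))"

definition syzygies ::
  "('a, 'z) monoid_scheme \<Rightarrow> ('a \<Rightarrow> 'b \<Rightarrow> 'b) \<Rightarrow> 'i set \<Rightarrow> ('i \<Rightarrow> 'b \<Rightarrow>\<^sub>0 int) \<Rightarrow>
    ('i \<times> 'a \<Rightarrow>\<^sub>0 int) set" where
  "syzygies T act I m = {u \<in> free_module T I. lin act m u = 0}"

definition generates ::
  "('a, 'z) monoid_scheme \<Rightarrow> ('a \<Rightarrow> 'b \<Rightarrow> 'b) \<Rightarrow> ('b \<Rightarrow>\<^sub>0 int) set \<Rightarrow> 'i set \<Rightarrow>
    ('i \<Rightarrow> 'b \<Rightarrow>\<^sub>0 int) \<Rightarrow> bool" where
  "generates T act M I m \<longleftrightarrow> m \<in> I \<rightarrow> M \<and> M \<subseteq> lin act m ` free_module T I"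

text \<open>Taking syzygies changes the basis type, which a recursion on \<open>n\<close> cannot
  follow. Syzygies of a family indexed by natural numbers always live over
  \<open>nat \<times> 'a\<close>, so the recursion stays at this type, and \<open>FP\<close> adds
  one initial step from an arbitrary basis type.\<close>

primrec FP_free :: "('a, 'z) monoid_scheme \<Rightarrow> nat \<Rightarrow> (nat \<times> 'a \<Rightarrow>\<^sub>0 int) set \<Rightarrow> bool" where
  "FP_free T 0 K \<longleftrightarrow> (\<exists>k m. generates T (free_act T) K {..<k::nat} m)"
| "FP_free T (Suc n) K \<longleftrightarrow>
     (\<exists>k m. generates T (free_act T) K {..<k::nat} m \<and> FP_free T n (syzygies T (free_act T) {..<k}
         m))"

definition FP ::
  "('a, 'z) monoid_scheme \<Rightarrow> ('a \<Rightarrow> 'b \<Rightarrow> 'b) \<Rightarrow> nat \<Rightarrow> ('b \<Rightarrow>\<^sub>0 int) set \<Rightarrow> bool" where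
  "FP T act n M \<longleftrightarrow>
     (\<exists>k m. generates T act M {..<k::nat} m \<and>
        (\<forall>n'. n = Suc n' \<longrightarrow> FP_free T n' (syzygies T act {..<k} m)))"

lemma FP_free_iff: "FP_free T n K \<longleftrightarrow> FP T (free_act T) n K"
  by (cases n) (simp_all add: FP_def)

lemma FP_0: "FP T act 0 M \<longleftrightarrow> (\<exists>k m. generates T act M {..<k::nat} m)"
  by (simp add: FP_def)

lemma FP_Suc:
  "FP T act (Suc n) M \<longleftrightarrow>
     (\<exists>k m. generates T act M {..<k::nat} m \<and> FP T (free_act T) n (syzygies T act {..<k} m))"
  unfolding FP_free_iff[symmetric] by (simp add: FP_def)

lemma generatesD:
  assumes "generates T act M I m"
  shows "i \<in> I \<Longrightarrow> m i \<in> M" and "x \<in> M \<Longrightarrow> \<exists>u\<in>free_module T I. x = lin act m u"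
  using assms unfolding generates_def by auto

lemma lin_0 [simp]: "lin act m 0 = 0"
  and lin_diff: "lin act m (u - v) = lin act m u - lin act m v"
  and lin_add: "lin act m (u + v) = lin act m u + lin act m v"
  and lin_of [simp]: "lin act m (frag_of (i, t)) = frag_map (act t) (m i)"
  by (simp_all add: lin_def frag_extend_diff frag_extend_add)

lemma free_act_apply [simp]: "free_act T s (i, t) = (i, s \<otimes>\<^bsub>T\<^esub> t)"
  by (simp add: free_act_def)

lemma lin_cong:
  "u \<in> free_module T I \<Longrightarrow> (\<And>i. i \<in> I \<Longrightarrow> m i = m' i) \<Longrightarrow> lin act m u = lin act m' u"
  unfolding lin_def free_module_def by (rule frag_extend_eq) auto

lemma free_module_mono: "I \<subseteq> J \<Longrightarrow> free_module T I \<subseteq> free_module T J"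
  unfolding free_module_def by auto

lemma frag_of_in_free [simp]: "frag_of (i, t) \<in> free_module T I \<longleftrightarrow> i \<in> I \<and> t \<in> carrier T"
  by (simp add: free_module_def)

lemma zero_in_free [simp]: "0 \<in> free_module T I"
  by (simp add: free_module_def)

lemma free_module_induct [consumes 1, case_names zero one diff]:
  assumes "u \<in> free_module T I"
    and "P 0"
    and "\<And>i t. i \<in> I \<Longrightarrow> t \<in> carrier T \<Longrightarrow> P (frag_of (i, t))"
    and "\<And>u v. u \<in> free_module T I \<Longrightarrow> v \<in> free_module T I \<Longrightarrow> P u \<Longrightarrow> P v \<Longrightarrow> P (u - v)"
  shows "P u"
proof -
  have sub: "keys u \<subseteq> I \<times> carrier T" using assms(1) by (simp add: free_module_def)
  have "u \<in> free_module T I \<and> P u"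
    using sub
  proof (induction u rule: frag_induction)
    case (diff a b)
    then show ?case using assms(4) keys_diff[of a b] by (auto simp: free_module_def)
  qed (use assms in auto)
  then show ?thesis ..
qed

context monoid
begin

abbreviation Free :: "nat \<Rightarrow> (nat \<times> 'a \<Rightarrow>\<^sub>0 int) set" where
  "Free k \<equiv> free_module G {..<k}"

lemma gmodule_free: "gmodule G (free_act G) (free_module G I)"
  unfolding gmodule_def
proof (intro conjI ballI)
  fix x y :: "('c \<times> 'a) \<Rightarrow>\<^sub>0 int"
  assume x: "x \<in> free_module G I"
  then have kx: "keys x \<subseteq> I \<times> carrier G" by (simp add: free_module_def)
  show "smul G \<one> x = x" using kx by (intro frag_map_ident) auto
  { assume "y \<in> free_module G I"
    then show "x - y \<in> free_module G I"
      using x keys_diff[of x y] by (auto simp: free_module_def) }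
  fix t assume t: "t \<in> carrier G"
  show "smul G t x \<in> free_module G I"
    using keys_frag_map[of "free_act G t" x] kx t by (fastforce simp: free_module_def)
  fix s assume s: "s \<in> carrier G"
  show "smul G (s \<otimes> t) x = smul G s (smul G t x)"
    unfolding frag_map_frag_map using kx s t by (intro frag_map_cong) (auto simp: m_assoc)
qed simp

lemma lin_closed:
  assumes "gmodule G act M" "m \<in> I \<rightarrow> M" "u \<in> free_module G I"
  shows "lin act m u \<in> M"
  using assms(3) by (induction u rule: free_module_induct)
    (use gmoduleD(1-3)[OF assms(1)] assms(2) in \<open>auto simp: lin_diff Pi_iff\<close>)

lemma ghom_lin:
  assumes "gmodule G act M" "m \<in> I \<rightarrow> M"
  shows "ghom G (free_act G) act (free_module G I) (lin act m)"
  unfolding ghom_def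
proof (intro conjI ballI)
  fix t u assume t: "t \<in> carrier G" and u: "u \<in> free_module G I"
  show "lin act m (smul G t u) = frag_map (act t) (lin act m u)"
    using u by (induction u rule: free_module_induct)
      (use assms t gmoduleD(5)[OF assms(1)] in \<open>auto simp: lin_diff frag_map_diff\<close>)
qed (simp add: lin_diff)

lemma ghom_lin_comp:
  assumes "gmodule G act M" "m \<in> I \<rightarrow> M" "ghom G act act' M \<phi>" "u \<in> free_module G I"
  shows "\<phi> (lin act m u) = lin act' (\<lambda>i. \<phi> (m i)) u"
  using assms(4)
proof (induction u rule: free_module_induct)
  case zero
  then show ?case using ghom_zero[OF assms(3,1)] by simp
next
  case (one i t)
  then show ?case using ghomD(2)[OF assms(3)] assms(2) by auto
next
  case (diff u v)
  then show ?case using ghomD(1)[OF assms(3)] lin_closed[OF assms(1,2)] by (auto simp: lin_diff)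
qed

lemma gmodule_syzygies:
  assumes "gmodule G act M" "m \<in> I \<rightarrow> M"
  shows "gmodule G (free_act G) (syzygies G act I m)"
  unfolding syzygies_def using gmodule_ker[OF gmodule_free ghom_lin[OF assms]] .

lemma generates_image:
  assumes "gmodule G act M" "ghom G act act' M \<phi>" "generates G act M I m"
  shows "generates G act' (\<phi> ` M) I (\<lambda>i. \<phi> (m i))"
proof -
  have m: "m \<in> I \<rightarrow> M" using generatesD(1)[OF assms(3)] by blast
  have "\<phi> x \<in> lin act' (\<lambda>i. \<phi> (m i)) ` free_module G I" if "x \<in> M" for x
    using generatesD(2)[OF assms(3) that] ghom_lin_comp[OF assms(1) m assms(2)] by auto
  then show ?thesis unfolding generates_def using m by auto
qed

text \<open>An injective homomorphism leaves the set of syzygies literally unchanged. Only the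
  generators move, so no induction on \<open>n\<close> is required.\<close>

lemma FP_iso:
  assumes "gmodule G act M" "ghom G act act' M \<phi>" "inj_on \<phi> M" "FP G act n M"
  shows "FP G act' n (\<phi> ` M)"
proof -
  obtain k m where km: "generates G act M {..<k::nat} m"
    "\<forall>n'. n = Suc n' \<longrightarrow> FP_free G n' (syzygies G act {..<k} m)"
    using assms(4) unfolding FP_def by blast
  have m: "m \<in> {..<k} \<rightarrow> M" using generatesD(1)[OF km(1)] by blast
  have "lin act' (\<lambda>i. \<phi> (m i)) u = 0 \<longleftrightarrow> lin act m u = 0" if "u \<in> Free k" for u
    using ghom_lin_comp[OF assms(1) m assms(2) that] lin_closed[OF assms(1) m that]
      ghom_zero[OF assms(2,1)] gmoduleD(1)[OF assms(1)] assms(3) by (metis inj_onD)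
  then have "syzygies G act' {..<k} (\<lambda>i. \<phi> (m i)) = syzygies G act {..<k} m"
    unfolding syzygies_def by auto
  with generates_image[OF assms(1,2) km(1)] km(2) show ?thesis unfolding FP_def by metis
qed

end

section \<open>Extensions and quotients\<close>

lemma generates_surj: "generates T act M I m \<Longrightarrow> x \<in> M \<Longrightarrow> \<exists>u. u \<in> free_module T I \<and> lin act m u = x"
  using generatesD(2) by metis

lemma generatesI:
  assumes "\<And>i. i \<in> I \<Longrightarrow> m i \<in> M" "\<And>x. x \<in> M \<Longrightarrow> \<exists>u\<in>free_module T I. x = lin act m u"
  shows "generates T act M I m"
  using assms unfolding generates_def by auto

lemma FP_iff:
  "FP T act n M \<longleftrightarrow>
     (\<exists>k m. generates T act M {..<k::nat} m \<and>
        (\<forall>n'. n = Suc n' \<longrightarrow> FP T (free_act T) n' (syzygies T act {..<k} m)))"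
  unfolding FP_free_iff[symmetric] by (simp add: FP_def)

text \<open>The direct sum of \<open>Free k\<close> and \<open>Free l\<close> is
  \<open>Free (k + l)\<close>. The first summand is literally contained in it;
  \<open>shift k\<close> embeds the second one and \<open>upper_part k\<close> projects onto
  it.\<close>

definition shift :: "nat \<Rightarrow> (nat \<times> 'a \<Rightarrow>\<^sub>0 int) \<Rightarrow> nat \<times> 'a \<Rightarrow>\<^sub>0 int" where
  "shift k = frag_map (\<lambda>(j, t). (j + k, t))"

definition upper_part :: "nat \<Rightarrow> (nat \<times> 'a \<Rightarrow>\<^sub>0 int) \<Rightarrow> nat \<times> 'a \<Rightarrow>\<^sub>0 int" where
  "upper_part k = frag_extend (\<lambda>(j, t). if j < k then 0 else frag_of (j - k, t))"

definition append_fun :: "nat \<Rightarrow> (nat \<Rightarrow> 'm) \<Rightarrow> (nat \<Rightarrow> 'm) \<Rightarrow> nat \<Rightarrow> 'm" where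
  "append_fun k a b i = (if i < k then a i else b (i - k))"

lemma shift_of [simp]: "shift k (frag_of (j, t)) = frag_of (j + k, t)"
  and shift_0 [simp]: "shift k 0 = 0"
  and shift_diff: "shift k (u - v) = shift k u - shift k v"
  by (simp_all add: shift_def frag_map_diff)

lemma upper_of [simp]: "upper_part k (frag_of (j, t)) = (if j < k then 0 else frag_of (j - k, t))"
  and upper_0 [simp]: "upper_part k 0 = 0"
  and upper_diff: "upper_part k (u - v) = upper_part k u - upper_part k v"
  and upper_add: "upper_part k (u + v) = upper_part k u + upper_part k v"
  by (simp_all add: upper_part_def frag_extend_diff frag_extend_add)

lemma upper_shift [simp]: "upper_part k (shift k u) = u"
proof -
  have "upper_part k (shift k u) = frag_extend frag_of u"
    unfolding upper_part_def shift_def frag_extend_frag_map by (rule frag_extend_eq) auto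
  then show ?thesis using frag_expansion[of u] by simp
qed

lemma upper_lower: "u \<in> free_module T {..<k} \<Longrightarrow> upper_part k u = 0"
  unfolding upper_part_def free_module_def by (rule frag_extend_eq_0) auto

lemma append_fun_in:
  "a \<in> {..<k} \<rightarrow> M \<Longrightarrow> b \<in> {..<l} \<rightarrow> M \<Longrightarrow> append_fun k a b \<in> {..<k + l} \<rightarrow> M"
  unfolding append_fun_def by (auto simp: Pi_iff)

lemma lin_append_lower:
  "u \<in> free_module T {..<k} \<Longrightarrow> lin act (append_fun k a b) u = lin act a u"
  by (rule lin_cong) (auto simp: append_fun_def)

lemma lin_append_shift: "lin act (append_fun k a b) (shift k u) = lin act b u"
  unfolding lin_def shift_def frag_extend_frag_map
  by (rule frag_extend_eq) (auto simp: append_fun_def)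

context monoid
begin

lemma free_moduleD:
  shows "u \<in> free_module G I \<Longrightarrow> v \<in> free_module G I \<Longrightarrow> u - v \<in> free_module G I"
    and "u \<in> free_module G I \<Longrightarrow> v \<in> free_module G I \<Longrightarrow> u + v \<in> free_module G I"
    and "t \<in> carrier G \<Longrightarrow> u \<in> free_module G I \<Longrightarrow> smul G t u \<in> free_module G I"
  using gmoduleD(2,3)[OF gmodule_free] gmodule_add[OF gmodule_free] by blast+

lemma shift_in_free:
  "u \<in> Free l \<Longrightarrow> shift k u \<in> Free (k + l)"
  by (induction u rule: free_module_induct) (auto simp: shift_diff intro: free_moduleD)

lemma upper_in_free:
  "u \<in> Free (k + l) \<Longrightarrow> upper_part k u \<in> Free l"
  by (induction u rule: free_module_induct) (auto simp: upper_diff intro: free_moduleD)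

lemma lower_in_free:
  assumes "u \<in> Free (k + l)"
  shows "u - shift k (upper_part k u) \<in> Free k"
  using assms
proof (induction u rule: free_module_induct)
  case (diff u v)
  have "u - v - shift k (upper_part k (u - v)) = (u - shift k (upper_part k u)) - (v - shift k
      (upper_part k v))"
    by (simp add: upper_diff shift_diff)
  with free_moduleD(1)[OF diff(3,4)] show ?case by (simp only:)
qed (auto)

lemma ghom_upper: "ghom G (free_act G) (free_act G) (free_module G I) (upper_part k)"
  unfolding ghom_def
proof (intro conjI ballI)
  fix t and u :: "nat \<times> 'a \<Rightarrow>\<^sub>0 int" assume t: "t \<in> carrier G" and u: "u \<in> free_module G I"
  show "upper_part k (smul G t u) = smul G t (upper_part k u)"
    using u by (induction u rule: free_module_induct) (auto simp: upper_diff frag_map_diff)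
qed (simp add: upper_diff)

lemma ghom_shift: "ghom G (free_act G) (free_act G) M (shift k)"
  unfolding ghom_def shift_def frag_map_frag_map
  by (auto simp: frag_map_diff intro!: frag_map_cong)

lemma lin_append:
  assumes "u \<in> Free (k + l)"
  shows "lin act (append_fun k a b) u = lin act a (u - shift k (upper_part k u)) + lin act b
      (upper_part k u)"
proof -
  have "lin act (append_fun k a b) u =
      lin act (append_fun k a b) ((u - shift k (upper_part k u)) + shift k (upper_part k u))" by
          simp
  also have "\<dots> = lin act a (u - shift k (upper_part k u)) + lin act b (upper_part k u)"
    unfolding lin_add lin_append_shift lin_append_lower[OF lower_in_free[OF assms]] ..
  finally show ?thesis .
qed

lemma syzygies_append_lower:
  "{x \<in> syzygies G act {..<k + l} (append_fun k a b). upper_part k x = 0} = syzygies G act {..<k} a"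
proof (intro equalityI subsetI)
  fix u assume "u \<in> {x \<in> syzygies G act {..<k + l} (append_fun k a b). upper_part k x = 0}"
  then have u: "u \<in> Free (k + l)" "lin act (append_fun k a b) u = 0" "upper_part k u = 0"
    by (auto simp: syzygies_def)
  then show "u \<in> syzygies G act {..<k} a"
    using lower_in_free[OF u(1)] lin_append[OF u(1), of act a b] by (simp add: syzygies_def)
next
  fix u assume "u \<in> syzygies G act {..<k} a"
  then have u: "u \<in> Free k" "lin act a u = 0" by (auto simp: syzygies_def)
  then show "u \<in> {x \<in> syzygies G act {..<k + l} (append_fun k a b). upper_part k x = 0}"
    using free_module_mono[of "{..<k}" "{..<k+l}" G] upper_lower[OF u(1)]
      lin_append_lower[OF u(1), of act a b] by (auto simp: syzygies_def)
qed

text \<open>The horseshoe construction: generators of the kernel together with lifts of generators of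
  the image.\<close>

lemma FP_extension_step:
  fixes N :: "('m \<Rightarrow>\<^sub>0 int) set" and \<phi> :: "('m \<Rightarrow>\<^sub>0 int) \<Rightarrow> 'n \<Rightarrow>\<^sub>0 int"
  assumes N: "gmodule G act N" and \<phi>: "ghom G act act' N \<phi>"
    and A: "FP G act n {x \<in> N. \<phi> x = 0}" and C: "FP G act' n (\<phi> ` N)"
    and IH: "\<And>n' K \<psi>. n = Suc n' \<Longrightarrow> gmodule G (free_act G) K \<Longrightarrow>
        ghom G (free_act G) (free_act G) K \<psi> \<Longrightarrow>
        FP G (free_act G) n' {x \<in> K. \<psi> x = 0} \<Longrightarrow>
        FP G (free_act G) n' (\<psi> ` K :: (nat \<times> 'a \<Rightarrow>\<^sub>0 int) set) \<Longrightarrow>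
        FP G (free_act G) n' (K :: (nat \<times> 'a \<Rightarrow>\<^sub>0 int) set)"
  shows "FP G act n N"
proof -
  obtain k a where ka: "generates G act {x \<in> N. \<phi> x = 0} {..<k::nat} a"
    "\<And>n'. n = Suc n' \<Longrightarrow> FP G (free_act G) n' (syzygies G act {..<k} a)"
    using FP_iff[THEN iffD1, OF A] by blast
  obtain l c where lc: "generates G act' (\<phi> ` N) {..<l::nat} c"
    "\<And>n'. n = Suc n' \<Longrightarrow> FP G (free_act G) n' (syzygies G act' {..<l} c)"
    using FP_iff[THEN iffD1, OF C] by blast
  have "\<forall>j\<in>{..<l}. \<exists>y. y \<in> N \<and> \<phi> y = c j" using generatesD(1)[OF lc(1)] by fastforce
  then obtain b where b: "\<And>j. j < l \<Longrightarrow> b j \<in> N" "\<And>j. j < l \<Longrightarrow> \<phi> (b j) = c j"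
    by (metis lessThan_iff)
  have aN: "a \<in> {..<k} \<rightarrow> N" using generatesD(1)[OF ka(1)] by auto
  have bN: "b \<in> {..<l} \<rightarrow> N" using b by auto
  have \<phi>b: "\<phi> (lin act b u) = lin act' c u" if "u \<in> Free l" for u
    unfolding ghom_lin_comp[OF N bN \<phi> that] by (rule lin_cong[OF that]) (simp add: b(2))
  have \<phi>a: "\<phi> (lin act a u) = 0" if "u \<in> Free k" for u
    using lin_closed[OF gmodule_ker[OF N \<phi>] _ that] generatesD(1)[OF ka(1)] by fastforce
  define m where "m = append_fun k a b"
  have mN: "m \<in> {..<k + l} \<rightarrow> N" unfolding m_def by (rule append_fun_in[OF aN bN])
  have gen: "generates G act N {..<k + l} m"
  proof (rule generatesI)
    fix x assume x: "x \<in> N"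
    then obtain v where v: "v \<in> Free l" "lin act' c v = \<phi> x"
      using generates_surj[OF lc(1)] by blast
    have bv: "lin act b v \<in> N" by (rule lin_closed[OF N bN v(1)])
    have "x - lin act b v \<in> {x \<in> N. \<phi> x = 0}"
      using gmoduleD(2)[OF N x bv] ghomD(1)[OF \<phi> x bv] \<phi>b v by simp
    then obtain w where w: "w \<in> Free k" "lin act a w = x - lin act b v"
      using generates_surj[OF ka(1)] by blast
    have "lin act m (w + shift k v) = x"
      unfolding m_def lin_add lin_append_shift lin_append_lower[OF w(1)] w by simp
    moreover have "w + shift k v \<in> Free (k + l)"
      using w(1) free_module_mono[of "{..<k}" "{..<k+l}" G] shift_in_free[OF v(1)]
      by (intro free_moduleD(2)) auto
    ultimately show "\<exists>u\<in>Free (k + l). x = lin act m u" by metis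
  qed (use mN in auto)
  have syz: "FP G (free_act G) n' (syzygies G act {..<k + l} m)" if n: "n = Suc n'" for n'
  proof (rule IH[OF n])
    show "gmodule G (free_act G) (syzygies G act {..<k + l} m)"
      by (rule gmodule_syzygies[OF N mN])
    show "ghom G (free_act G) (free_act G) (syzygies G act {..<k + l} m) (upper_part k)"
      by (rule ghom_subset[OF ghom_upper]) (auto simp: syzygies_def)
    show "FP G (free_act G) n' {x \<in> syzygies G act {..<k + l} m. upper_part k x = 0}"
      unfolding m_def syzygies_append_lower by (rule ka(2)[OF n])
    have "upper_part k ` syzygies G act {..<k + l} m = syzygies G act' {..<l} c"
    proof (intro equalityI subsetI)
      fix v assume "v \<in> upper_part k ` syzygies G act {..<k + l} m"
      then obtain u where u: "u \<in> Free (k + l)" "lin act m u = 0" "v = upper_part k u"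
        by (auto simp: syzygies_def)
      have eq: "lin act b v = - lin act a (u - shift k v)"
        using u lin_append[OF u(1), of act a b]
        by (simp add: m_def add.commute add_eq_0_iff)
      have "- (u - shift k v) \<in> Free k"
        unfolding u(3) by (rule gmodule_uminus[OF gmodule_free lower_in_free[OF u(1)]])
      from \<phi>a[OF this] have "\<phi> (lin act b v) = 0"
        unfolding eq using lin_diff[of act a 0 "u - shift k v"] by simp
      then show "v \<in> syzygies G act' {..<l} c"
        using \<phi>b upper_in_free[OF u(1)] u(3) by (simp add: syzygies_def)
    next
      fix v assume "v \<in> syzygies G act' {..<l} c"
      then have v: "v \<in> Free l" "lin act' c v = 0" by (auto simp: syzygies_def)
      \<comment> \<open>A syzygy \<open>v\<close> of the images makes \<open>lin act b v\<close>
        vanish only after \<open>\<phi>\<close>; the generators \<open>a\<close> of the kernel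
        supply the correction \<open>w\<close>.\<close>
      have "lin act b v \<in> {x \<in> N. \<phi> x = 0}" using lin_closed[OF N bN v(1)] \<phi>b v by simp
      then obtain w where w: "w \<in> Free k" "lin act a w = lin act b v"
        using generates_surj[OF ka(1)] by blast
      have "shift k v - w \<in> syzygies G act {..<k + l} m"
        using w(1) free_module_mono[of "{..<k}" "{..<k+l}" G] shift_in_free[OF v(1)]
          lin_append_lower[OF w(1), of act a b] lin_append_shift[of act k a b v] w(2)
        by (auto simp: syzygies_def m_def lin_diff intro!: free_moduleD)
      moreover have "upper_part k (shift k v - w) = v" by (simp add: upper_diff upper_lower[OF
          w(1)])
      ultimately show "v \<in> upper_part k ` syzygies G act {..<k + l} m" by (metis imageI)
    qed
    then show "FP G (free_act G) n' (upper_part k ` syzygies G act {..<k + l} m)"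
      using lc(2)[OF n] by simp
  qed
  show ?thesis using gen syz by (intro FP_iff[THEN iffD2]) blast
qed

text \<open>The extension step takes its induction hypothesis as a premise because it starts from
  any basis type, whereas the induction runs over \<open>nat \<times> 'a\<close>. After this
  induction, \<open>FP_extension\<close> is one more application of the step.\<close>

lemma FP_free_extension:
  fixes K :: "(nat \<times> 'a \<Rightarrow>\<^sub>0 int) set"
    and \<psi> :: "(nat \<times> 'a \<Rightarrow>\<^sub>0 int) \<Rightarrow> nat \<times> 'a \<Rightarrow>\<^sub>0 int"
  assumes "gmodule G (free_act G) K" "ghom G (free_act G) (free_act G) K \<psi>"
    "FP G (free_act G) n {x \<in> K. \<psi> x = 0}" "FP G (free_act G) n (\<psi> ` K)"
  shows "FP G (free_act G) n K"
  using assms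
proof (induction n arbitrary: K \<psi>)
  case 0
  show ?case by (rule FP_extension_step[OF 0]) simp
next
  case (Suc n)
  show ?case by (rule FP_extension_step[OF Suc.prems]) (use Suc.IH in blast)
qed

lemma FP_extension:
  assumes "gmodule G act N" "ghom G act act' N \<phi>"
    and "FP G act n {x \<in> N. \<phi> x = 0}" "FP G act' n (\<phi> ` N)"
  shows "FP G act n N"
  by (rule FP_extension_step[OF assms]) (rule FP_free_extension)

text \<open>Use the images of generators of \<open>N\<close> as generators of the quotient. Their
  syzygies \<open>L\<close> are mapped by \<open>lin act m\<close> onto the kernel of
  \<open>\<phi>\<close>, with the syzygies of \<open>m\<close> as kernel, so \<open>L\<close> is an
  extension of two modules of type FP_n.\<close>

lemma FP_quotient:
  assumes N: "gmodule G act N" and \<phi>: "ghom G act act' N \<phi>"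
    and "FP G act n {x \<in> N. \<phi> x = 0}" "FP G act (Suc n) N"
  shows "FP G act' (Suc n) (\<phi> ` N)"
proof -
  obtain k m where km: "generates G act N {..<k::nat} m"
    "FP G (free_act G) n (syzygies G act {..<k} m)"
    using assms(4) unfolding FP_Suc by blast
  have m: "m \<in> {..<k} \<rightarrow> N" using generatesD(1)[OF km(1)] by blast
  define L where "L = syzygies G act' {..<k} (\<lambda>i. \<phi> (m i))"
  have L: "L = {u \<in> Free k. \<phi> (lin act m u) = 0}"
    unfolding L_def syzygies_def using ghom_lin_comp[OF N m \<phi>] by auto
  have hl: "ghom G (free_act G) act L (lin act m)"
    by (rule ghom_subset[OF ghom_lin[OF N m]]) (auto simp: L)
  have "FP G (free_act G) n L"
  proof (rule FP_extension[OF _ hl])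
    show "gmodule G (free_act G) L"
      unfolding L_def using m ghomD(2)[OF \<phi>]
      by (intro gmodule_syzygies[OF gmodule_image[OF monoid_axioms N \<phi>]]) auto
    have "{x \<in> L. lin act m x = 0} = syzygies G act {..<k} m"
      using ghom_zero[OF \<phi> N] by (auto simp: L syzygies_def)
    then show "FP G (free_act G) n {x \<in> L. lin act m x = 0}" using km(2) by simp
    have "lin act m ` L = {x \<in> N. \<phi> x = 0}"
      using lin_closed[OF N m] generates_surj[OF km(1)] by (fastforce simp: L)
    then show "FP G act n (lin act m ` L)" using assms(3) by simp
  qed
  then show ?thesis
    unfolding FP_Suc L_def using generates_image[OF N \<phi> km(1)] by blast
qed

lemma FP_0_image:
  assumes "gmodule G act N" "ghom G act act' N \<phi>" "FP G act 0 N"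
  shows "FP G act' 0 (\<phi> ` N)"
  using assms generates_image[OF assms(1,2)] unfolding FP_0 by blast

text \<open>The standard basis has only the zero syzygy, and the zero module is
  \<open>Free 0\<close>, so the induction must range over all ranks \<open>k\<close>.\<close>

lemma FP_free_module: "FP G (free_act G) n (Free (k::nat))"
proof -
  define e :: "nat \<Rightarrow> nat \<times> 'a \<Rightarrow>\<^sub>0 int" where "e = (\<lambda>i. frag_of (i, \<one>))"
  have lin_e: "lin (free_act G) e u = u" if "u \<in> Free k" for u and k :: nat
    using that by (induction u rule: free_module_induct) (auto simp: lin_diff e_def)
  have gen: "generates G (free_act G) (Free k) {..<k} e" for k
    by (rule generatesI) (auto simp: e_def lin_e[unfolded e_def])
  have syz: "syzygies G (free_act G) {..<k} e = Free 0" for k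
    using lin_e by (auto simp: syzygies_def free_module_def)
  show ?thesis
  proof (induction n arbitrary: k)
    case 0
    then show ?case unfolding FP_0 using gen by blast
  next
    case (Suc n)
    then show ?case unfolding FP_Suc using gen syz by metis
  qed
qed

end

section \<open>Schanuel's lemma and tensor products with finite permutation modules\<close>

definition slice :: "'x \<Rightarrow> ('m \<times> 'x \<Rightarrow>\<^sub>0 int) \<Rightarrow> 'm \<Rightarrow>\<^sub>0 int" where
  "slice x = frag_extend (\<lambda>(b, y). if y = x then frag_of b else 0)"

text \<open>As the second factor is free abelian on \<open>Y\<close>, its tensor product over \<int>
  with \<open>M\<close> is the direct sum of copies of \<open>M\<close> indexed by \<open>Y\<close>,
  and the slices are the components.\<close>

definition tensor :: "('m \<Rightarrow>\<^sub>0 int) set \<Rightarrow> 'x set \<Rightarrow> ('m \<times> 'x \<Rightarrow>\<^sub>0 int) set" where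
  "tensor M Y = {w. keys w \<subseteq> UNIV \<times> Y \<and> (\<forall>x\<in>Y. slice x w \<in> M)}"

definition diag_act :: "('a \<Rightarrow> 'm \<Rightarrow> 'm) \<Rightarrow> ('a \<Rightarrow> 'x \<Rightarrow> 'x) \<Rightarrow> 'a \<Rightarrow> 'm \<times> 'x \<Rightarrow> 'm \<times> 'x" where
  "diag_act act \<pi> t = (\<lambda>(b, x). (act t b, \<pi> t x))"

lemma diag_act_apply [simp]: "diag_act act \<pi> t (b, x) = (act t b, \<pi> t x)"
  by (simp add: diag_act_def)

lemma slice_of [simp]: "slice x (frag_of (b, y)) = (if y = x then frag_of b else 0)"
  and slice_0 [simp]: "slice x 0 = 0"
  and slice_diff: "slice x (u - v) = slice x u - slice x v"
  by (simp_all add: slice_def frag_extend_diff)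

lemma lookup_slice: "lookup (slice x w) b = lookup w (b, x)"
proof -
  have "keys w \<subseteq> UNIV" by simp
  then show ?thesis
    by (induction w rule: frag_induction) (auto simp: slice_diff lookup_minus)
qed

lemma slice_eqI:
  assumes "keys w \<subseteq> UNIV \<times> Y" "keys w' \<subseteq> UNIV \<times> Y"
    and "\<And>x. x \<in> Y \<Longrightarrow> slice x w = slice x w'"
  shows "w = w'"
proof (rule poly_mapping_eqI)
  fix p :: "'a \<times> 'b"
  obtain b x where p: "p = (b, x)" by (cases p)
  show "lookup w p = lookup w' p"
  proof (cases "x \<in> Y")
    case True
    then show ?thesis using assms(3) lookup_slice p by metis
  next
    case False
    then have "p \<notin> keys w" "p \<notin> keys w'" using assms(1,2) p by auto
    then show ?thesis by (simp add: in_keys_iff)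
  qed
qed

lemma slice_frag_map_Pair: "slice x (frag_map (\<lambda>b. (f b, y)) u) = (if y = x then frag_map f u else
    0)"
proof -
  have "slice x (frag_map (\<lambda>b. (f b, y)) u) = frag_extend (\<lambda>b. if y = x then frag_of (f b) else 0)
      u"
    unfolding slice_def frag_extend_frag_map by simp
  also have "\<dots> = (if y = x then frag_map f u else 0)"
    by (auto simp: frag_map_def intro: frag_extend_eq_0)
  finally show ?thesis .
qed

lemma ex_tensor_slices:
  assumes "finite Y" "\<And>x. x \<in> Y \<Longrightarrow> v x \<in> N"
  shows "\<exists>w\<in>tensor N Y. \<forall>x\<in>Y. slice x w = v x"
proof -
  define w where "w = (\<Sum>x\<in>Y. frag_map (\<lambda>b. (b, x)) (v x))"
  have k: "keys (frag_map (\<lambda>b. (b, x)) (v x)) \<subseteq> UNIV \<times> Y" if "x \<in> Y" for x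
    using keys_frag_map[of "\<lambda>b. (b, x)" "v x"] that by auto
  have "keys w \<subseteq> UNIV \<times> Y"
    unfolding w_def using keys_sum[of "\<lambda>x. frag_map (\<lambda>b. (b, x)) (v x)" Y] k by blast
  moreover have "slice y w = v y" if y: "y \<in> Y" for y
  proof -
    have "slice y w = (\<Sum>x\<in>Y. slice y (frag_map (\<lambda>b. (b, x)) (v x)))"
      unfolding w_def slice_def by (simp add: frag_extend_sum[OF assms(1)] o_def)
    also have "\<dots> = (\<Sum>x\<in>Y. if x = y then v x else 0)"
      by (intro sum.cong) (simp_all add: slice_frag_map_Pair frag_map_ident)
    also have "\<dots> = v y" using assms(1) y by (simp add: sum.delta')
    finally show ?thesis .
  qed
  ultimately show ?thesis using assms(2) unfolding tensor_def by (intro bexI[of _ w]) auto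
qed

context monoid
begin

lemma lin_unit:
  "u \<in> free_module G I \<Longrightarrow> lin (free_act G) (\<lambda>i. frag_of (i, \<one>)) u = u"
  by (induction u rule: free_module_induct) (auto simp: lin_diff)

text \<open>Schanuel's lemma: both syzygy modules are compared with that of the concatenated generators.\<close>

lemma FP_syzygies:
  fixes M :: "('m \<Rightarrow>\<^sub>0 int) set"
  assumes M: "gmodule G act M" and "FP G act (Suc n) M" and g: "generates G act M {..<l::nat} g"
  shows "FP G (free_act G) n (syzygies G act {..<l} g)"
proof -
  obtain k f where kf: "generates G act M {..<k::nat} f"
    "FP G (free_act G) n (syzygies G act {..<k} f)"
    using assms(2) unfolding FP_Suc by blast
  have fM: "f \<in> {..<k} \<rightarrow> M" and gM: "g \<in> {..<l} \<rightarrow> M"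
    using generatesD(1)[OF kf(1)] generatesD(1)[OF g] by blast+
  define h where "h = append_fun k f g"
  have hM: "h \<in> {..<k + l} \<rightarrow> M" unfolding h_def by (rule append_fun_in[OF fM gM])
  define K where "K = syzygies G act {..<k + l} h"
  have K: "gmodule G (free_act G) K" unfolding K_def by (rule gmodule_syzygies[OF M hM])
  have Ksub: "K \<subseteq> Free (k + l)" by (auto simp: K_def syzygies_def)
  \<comment> \<open>The family \<open>f\<close> alone generates \<open>M\<close>, so every
    \<open>v\<close> extends to a syzygy of the concatenated family. Thus \<open>K\<close> is an
    extension of \<open>Free l\<close> by the syzygies of \<open>f\<close>.\<close>
  have "upper_part k ` K = Free l"
  proof (intro equalityI subsetI)
    fix v assume v: "v \<in> Free l"
    obtain w where w: "w \<in> Free k" "lin act f w = lin act g v"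
      using generates_surj[OF kf(1) lin_closed[OF M gM v]] by blast
    have "shift k v - w \<in> K"
      using w(1) free_module_mono[of "{..<k}" "{..<k+l}" G] shift_in_free[OF v]
        lin_append_lower[OF w(1), of act f g] lin_append_shift[of act k f g v] w(2)
      by (auto simp: K_def h_def syzygies_def lin_diff intro!: free_moduleD)
    moreover have "upper_part k (shift k v - w) = v" by (simp add: upper_diff upper_lower[OF w(1)])
    ultimately show "v \<in> upper_part k ` K" by (metis imageI)
  qed (use Ksub upper_in_free in blast)
  then have "FP G (free_act G) n K"
    using kf(2) syzygies_append_lower[of act k l f g] FP_free_module[of n l]
    by (intro FP_extension[OF K ghom_subset[OF ghom_upper[of _ k] Ksub]]) (simp_all add: K_def
        h_def)
  have "\<forall>i\<in>{..<k}. \<exists>s. s \<in> Free l \<and> lin act g s = f i"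
    using generates_surj[OF g] fM by blast
  then obtain s where s: "\<And>i. i < k \<Longrightarrow> s i \<in> Free l" "\<And>i. i < k \<Longrightarrow> lin act g (s i) = f i"
    by (metis lessThan_iff)
  have sF: "s \<in> {..<k} \<rightarrow> Free l" using s(1) by auto
  have gs: "lin act g (lin (free_act G) s u) = lin act f u" if "u \<in> Free k" for u
    unfolding ghom_lin_comp[OF gmodule_free sF ghom_lin[OF M gM] that]
    by (rule lin_cong[OF that]) (simp add: s)
  have sF': "lin (free_act G) s u \<in> Free l" if "u \<in> Free k" for u
    by (rule lin_closed[OF gmodule_free sF that])
  \<comment> \<open>With \<open>s i\<close> expressing \<open>f i\<close> through \<open>g\<close>,
    the map \<open>\<chi>\<close> rewrites combinations of \<open>f\<close> and \<open>g\<close> as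
    combinations of \<open>g\<close> with the same value in \<open>M\<close>. Hence it carries
    \<open>K\<close> onto the syzygies of \<open>g\<close>.\<close>
  define \<chi> where "\<chi> = lin (free_act G) (append_fun k s (\<lambda>i. frag_of (i, \<one>)))"
  have e: "(\<lambda>i. frag_of (i, \<one>)) \<in> {..<l} \<rightarrow> Free l" by auto
  have \<chi>: "\<chi> u = lin (free_act G) s (u - shift k (upper_part k u)) + upper_part k u"
    if "u \<in> Free (k + l)" for u
    unfolding \<chi>_def lin_append[OF that] lin_unit[OF upper_in_free[OF that]] ..
  have h\<chi>: "ghom G (free_act G) (free_act G) K \<chi>"
    unfolding \<chi>_def by (rule ghom_subset[OF ghom_lin[OF gmodule_free append_fun_in[OF sF e]] Ksub])
  have im: "\<chi> ` K = syzygies G act {..<l} g"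
  proof (intro equalityI subsetI)
    fix v assume "v \<in> \<chi> ` K"
    then obtain u where u: "u \<in> Free (k + l)" "lin act h u = 0" "v = \<chi> u"
      by (auto simp: K_def syzygies_def)
    note low = lower_in_free[OF u(1)] and up = upper_in_free[OF u(1)]
    have "lin act g v = lin act h u"
      unfolding u(3) \<chi>[OF u(1)] lin_add gs[OF low] h_def lin_append[OF u(1)] ..
    then show "v \<in> syzygies G act {..<l} g"
      using u free_moduleD(2)[OF sF'[OF low] up] \<chi>[OF u(1)] by (simp add: syzygies_def)
  next
    fix v assume "v \<in> syzygies G act {..<l} g"
    then have v: "v \<in> Free l" "lin act g v = 0" by (auto simp: syzygies_def)
    have "shift k v \<in> K"
      using shift_in_free[OF v(1)] lin_append_shift[of act k f g v] v(2)
      by (simp add: K_def h_def syzygies_def)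
    moreover have "\<chi> (shift k v) = v" using \<chi>[OF shift_in_free[OF v(1)]] by simp
    ultimately show "v \<in> \<chi> ` K" by (metis imageI)
  qed
  have ker: "FP G (free_act G) n' {x \<in> K. \<chi> x = 0}" for n'
  proof -
    \<comment> \<open>The graph embedding of \<open>u\<close> as the pair of \<open>u\<close> and
      \<open>- s u\<close>. It identifies \<open>Free k\<close> with the kernel of
      \<open>\<chi>\<close>, which is therefore of type FP_n for every n.\<close>
    define \<zeta> where "\<zeta> = (\<lambda>u. u - shift k (lin (free_act G) s u))"
    have "lin (free_act G) s (smul G t u) = smul G t (lin (free_act G) s u)"
      if "t \<in> carrier G" "u \<in> Free k" for t u
      using ghomD(2)[OF ghom_lin[OF gmodule_free sF] that] .
    moreover have "shift k (smul G t u) = smul G t (shift k u)"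
      if "t \<in> carrier G" for t and u :: "nat \<times> 'a \<Rightarrow>\<^sub>0 int"
      using ghomD(2)[OF ghom_shift[of UNIV k] that UNIV_I] .
    ultimately have h\<zeta>: "ghom G (free_act G) (free_act G) (Free k) \<zeta>"
      unfolding ghom_def \<zeta>_def by (auto simp: frag_map_diff shift_diff lin_diff)
    have up\<zeta>: "upper_part k (\<zeta> u) = - lin (free_act G) s u" if "u \<in> Free k" for u
      unfolding \<zeta>_def upper_diff upper_lower[OF that] by simp
    have shm: "shift k (- u) = - shift k u" for u :: "nat \<times> 'a \<Rightarrow>\<^sub>0 int"
      using shift_diff[of k 0 u] by simp
    have low\<zeta>: "\<zeta> u - shift k (upper_part k (\<zeta> u)) = u" if "u \<in> Free k" for u
      unfolding up\<zeta>[OF that] shm by (simp add: \<zeta>_def)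
    have \<zeta>F: "\<zeta> u \<in> Free (k + l)" if "u \<in> Free k" for u
      unfolding \<zeta>_def using that free_module_mono[of "{..<k}" "{..<k+l}" G]
        shift_in_free[OF sF'[OF that]] by (intro free_moduleD(1)) auto
    have "\<zeta> ` Free k = {x \<in> K. \<chi> x = 0}"
    proof (intro equalityI subsetI)
      fix x assume "x \<in> \<zeta> ` Free k"
      then obtain u where u: "u \<in> Free k" "x = \<zeta> u" by blast
      have "\<chi> x = 0" unfolding u(2) \<chi>[OF \<zeta>F[OF u(1)]] low\<zeta>[OF u(1)]
        unfolding up\<zeta>[OF u(1)] by simp
      moreover have "lin act h x = 0"
        unfolding u(2) h_def lin_append[OF \<zeta>F[OF u(1)]] low\<zeta>[OF u(1)]
        unfolding up\<zeta>[OF u(1)] using gs[OF u(1)] lin_diff[of act g 0] by simp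
      ultimately show "x \<in> {x \<in> K. \<chi> x = 0}" using \<zeta>F[OF u(1)] u(2) by (simp add: K_def
          syzygies_def)
    next
      fix x assume "x \<in> {x \<in> K. \<chi> x = 0}"
      then have x: "x \<in> Free (k + l)" "\<chi> x = 0" using Ksub by auto
      define u where "u = x - shift k (upper_part k x)"
      have "lin (free_act G) s u = - upper_part k x"
        unfolding eq_neg_iff_add_eq_0 using \<chi>[OF x(1)] x(2) unfolding u_def by metis
      then have "\<zeta> u = u + shift k (upper_part k x)" by (simp add: \<zeta>_def shm)
      then have "x = \<zeta> u" by (simp add: u_def)
      then show "x \<in> \<zeta> ` Free k"
        by (rule image_eqI) (unfold u_def, rule lower_in_free[OF x(1)])
    qed
    moreover have "inj_on \<zeta> (Free k)"
      using low\<zeta> by (metis inj_onI)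
    ultimately show ?thesis
      using FP_iso[OF gmodule_free h\<zeta> _ FP_free_module] by metis
  qed
  show ?thesis
  proof (cases n)
    case 0
    then show ?thesis using FP_0_image[OF K h\<chi>] \<open>FP G (free_act G) n K\<close> im by simp
  next
    case (Suc n')
    then show ?thesis using FP_quotient[OF K h\<chi> ker] \<open>FP G (free_act G) n K\<close> im by simp
  qed
qed

lemma FP_reindex:
  fixes I :: "'i set"
  assumes "finite I"
  obtains k :: nat and \<beta> :: "nat \<Rightarrow> 'i" and \<gamma> :: "'i \<Rightarrow> nat"
  where "\<And>i. i \<in> I \<Longrightarrow> \<gamma> i < k" "\<And>i. i \<in> I \<Longrightarrow> \<beta> (\<gamma> i) = i"
    "\<And>j. j < k \<Longrightarrow> \<beta> j \<in> I" "\<And>j. j < k \<Longrightarrow> \<gamma> (\<beta> j) = j"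
proof -
  obtain \<beta> where \<beta>: "bij_betw \<beta> {0..<card I} I" using ex_bij_betw_nat_finite[OF assms] by blast
  then have inj: "inj_on \<beta> {0..<card I}" and img: "\<beta> ` {0..<card I} = I" by (auto simp:
      bij_betw_def)
  show ?thesis
  proof (rule that[of "inv_into {0..<card I} \<beta>" "card I" \<beta>])
    fix i assume "i \<in> I"
    then have i: "i \<in> \<beta> ` {0..<card I}" using img by simp
    show "inv_into {0..<card I} \<beta> i < card I" using inv_into_into[OF i] by simp
    show "\<beta> (inv_into {0..<card I} \<beta> i) = i" by (rule f_inv_into_f[OF i])
  next
    fix j assume j: "j < card I"
    show "\<beta> j \<in> I" using img j by auto
    show "inv_into {0..<card I} \<beta> (\<beta> j) = j" using inv_into_f_f[OF inj] j by simp
  qed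
qed

text \<open>Allows generators indexed by any finite set: pairs of an index and a point for tensor
  products, and module elements indexing themselves for descent.\<close>

lemma FP_finite_generators:
  fixes I :: "'i set"
  assumes I: "finite I" and M: "gmodule G act M" and gen: "generates G act M I m"
    and syz: "\<And>n'. n = Suc n' \<Longrightarrow> FP G (free_act G) n' (syzygies G act I m)"
  shows "FP G act n M"
proof -
  obtain k :: nat and \<beta> \<gamma> where k: "\<And>i. i \<in> I \<Longrightarrow> \<gamma> i < k" "\<And>i. i \<in> I \<Longrightarrow> \<beta> (\<gamma> i) = i"
    "\<And>j. j < k \<Longrightarrow> \<beta> j \<in> I" "\<And>j. j < k \<Longrightarrow> \<gamma> (\<beta> j) = j"
    using FP_reindex[OF I] by metis
  define f where "f = frag_map (\<lambda>(i, t :: 'a). (\<gamma> i, t))"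
  define b where "b = frag_map (\<lambda>(i, t :: 'a). (\<beta> i, t))"
  have mM: "m \<in> I \<rightarrow> M" using generatesD(1)[OF gen] by blast
  have fF: "f u \<in> Free k" if "u \<in> free_module G I" for u
    using that by (induction u rule: free_module_induct)
      (auto simp: f_def frag_map_diff k intro: free_moduleD)
  have bF: "b u \<in> free_module G I" if "u \<in> Free k" for u
    using that by (induction u rule: free_module_induct)
      (auto simp: b_def frag_map_diff k intro: free_moduleD)
  have bf: "b (f u) = u" if "u \<in> free_module G I" for u
    using that by (induction u rule: free_module_induct) (auto simp: b_def f_def frag_map_diff k)
  have fb: "f (b u) = u" if "u \<in> Free k" for u
    using that by (induction u rule: free_module_induct) (auto simp: b_def f_def frag_map_diff k)
  have lf: "lin act (\<lambda>j. m (\<beta> j)) (f u) = lin act m u" if "u \<in> free_module G I" for u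
    using that by (induction u rule: free_module_induct) (auto simp: f_def frag_map_diff lin_diff k)
  have gen': "generates G act M {..<k} (\<lambda>j. m (\<beta> j))"
  proof (rule generatesI)
    fix x assume "x \<in> M"
    then obtain u where u: "u \<in> free_module G I" "lin act m u = x"
      using generates_surj[OF gen] by blast
    then show "\<exists>u\<in>Free k. x = lin act (\<lambda>j. m (\<beta> j)) u"
      using fF lf by metis
  qed (use mM k in auto)
  have hf: "ghom G (free_act G) (free_act G) (syzygies G act I m) f"
    unfolding ghom_def f_def frag_map_frag_map
    by (auto simp: frag_map_diff intro!: frag_map_cong)
  have "f ` syzygies G act I m = syzygies G act {..<k} (\<lambda>j. m (\<beta> j))"
  proof (intro equalityI subsetI)
    fix v assume "v \<in> syzygies G act {..<k} (\<lambda>j. m (\<beta> j))"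
    then have "v = f (b v)" "b v \<in> syzygies G act I m"
      using fb bF lf by (auto simp: syzygies_def) metis
    then show "v \<in> f ` syzygies G act I m" by blast
  qed (use fF lf in \<open>auto simp: syzygies_def\<close>)
  moreover have "inj_on f (syzygies G act I m)"
    using bf by (intro inj_on_inverseI[of _ b]) (auto simp: syzygies_def)
  ultimately have "FP G (free_act G) n' (syzygies G act {..<k} (\<lambda>j. m (\<beta> j)))" if "n = Suc n'" for
      n'
    using FP_iso[OF gmodule_syzygies[OF M mM] hf _ syz[OF that]] by metis
  with gen' show ?thesis by (intro FP_iff[THEN iffD2]) blast
qed


lemma FP_imp_finitely_generated: "FP G act n M \<Longrightarrow> FP G act 0 M"
  unfolding FP_iff[of _ _ n] FP_0 by blast

end

text \<open>The elements of the monoid need not be units, so injectivity of each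
  \<open>\<pi> t\<close> is an axiom; finiteness of \<open>Y\<close> then turns it into a
  permutation.\<close>

locale finite_permutation_action = monoid +
  fixes Y :: "'x set" and \<pi> :: "'a \<Rightarrow> 'x \<Rightarrow> 'x"
  assumes finite_Y: "finite Y"
    and perm_closed: "t \<in> carrier G \<Longrightarrow> x \<in> Y \<Longrightarrow> \<pi> t x \<in> Y"
    and perm_inj: "t \<in> carrier G \<Longrightarrow> x \<in> Y \<Longrightarrow> y \<in> Y \<Longrightarrow> \<pi> t x = \<pi> t y \<Longrightarrow> x = y"
    and perm_one: "x \<in> Y \<Longrightarrow> \<pi> \<one> x = x"
    and perm_mult: "s \<in> carrier G \<Longrightarrow> t \<in> carrier G \<Longrightarrow> x \<in> Y \<Longrightarrow> \<pi> (s \<otimes> t) x = \<pi> s (\<pi> t x)"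
begin

lemma perm_inj_on: "t \<in> carrier G \<Longrightarrow> inj_on (\<pi> t) Y"
  using perm_inj by (intro inj_onI)

lemma perm_image: "t \<in> carrier G \<Longrightarrow> \<pi> t ` Y = Y"
  using endo_inj_surj[OF finite_Y _ perm_inj_on] perm_closed by blast

definition unperm :: "'a \<Rightarrow> 'x \<Rightarrow> 'x" where
  "unperm t = inv_into Y (\<pi> t)"

lemma unperm:
  assumes "t \<in> carrier G" "x \<in> Y"
  shows "unperm t x \<in> Y" "\<pi> t (unperm t x) = x" "unperm t (\<pi> t x) = x"
  using assms perm_image[OF assms(1)] inv_into_into[of x "\<pi> t" Y] f_inv_into_f[of x "\<pi> t" Y]
    inv_into_f_f[OF perm_inj_on[OF assms(1)] assms(2)] unfolding unperm_def by auto

text \<open>This is the equivariance of untwisting: in the coordinates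
  \<open>(i, unperm t x)\<close> and \<open>t\<close>, the diagonal action moves only
  \<open>t\<close>.\<close>

lemma unperm_mult:
  assumes "s \<in> carrier G" "t \<in> carrier G" "x \<in> Y"
  shows "unperm (s \<otimes> t) (\<pi> s x) = unperm t x"
proof -
  have "\<pi> (s \<otimes> t) (unperm t x) = \<pi> s x"
    using perm_mult[OF assms(1,2) unperm(1)] unperm(2) assms by simp
  then show ?thesis using unperm(3)[OF m_closed[OF assms(1,2)] unperm(1)[OF assms(2,3)]] by simp
qed

lemma slice_diag_act:
  assumes "keys w \<subseteq> UNIV \<times> Y" "t \<in> carrier G" "x \<in> Y"
  shows "slice (\<pi> t x) (frag_map (diag_act act \<pi> t) w) = frag_map (act t) (slice x w)"
  using assms(1)
proof (induction w rule: frag_induction)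
  case (one p)
  then show ?case using perm_inj[OF assms(2)] assms(3) by (cases p) auto
qed (auto simp: slice_diff frag_map_diff)

lemma keys_diag_act:
  assumes "keys w \<subseteq> UNIV \<times> Y" "t \<in> carrier G"
  shows "keys (frag_map (diag_act act \<pi> t) w) \<subseteq> UNIV \<times> Y"
  using keys_frag_map[of "diag_act act \<pi> t" w] assms perm_closed by fastforce

lemma gmodule_tensor:
  assumes "gmodule G act M"
  shows "gmodule G (diag_act act \<pi>) (tensor M Y)"
proof -
  note M = gmoduleD[OF assms]
  have act: "frag_map (diag_act act \<pi> t) w \<in> tensor M Y"
    if t: "t \<in> carrier G" and w: "w \<in> tensor M Y" for t w
  proof -
    have k: "keys w \<subseteq> UNIV \<times> Y" using w by (simp add: tensor_def)
    have "slice x (frag_map (diag_act act \<pi> t) w) \<in> M" if x: "x \<in> Y" for x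
      using slice_diag_act[OF k t unperm(1)[OF t x], of act] unperm(1,2)[OF t x] M(3)[OF t] w
      by (simp add: tensor_def)
    then show ?thesis using keys_diag_act[OF k t] by (simp add: tensor_def)
  qed
  show ?thesis
    unfolding gmodule_def
  proof (intro conjI ballI)
    show "0 \<in> tensor M Y" using M(1) by (simp add: tensor_def)
    fix w assume w: "w \<in> tensor M Y"
    then have k: "keys w \<subseteq> UNIV \<times> Y" by (simp add: tensor_def)
    show "frag_map (diag_act act \<pi> \<one>) w = w"
    proof (rule slice_eqI[OF keys_diag_act[OF k one_closed] k])
      fix x assume x: "x \<in> Y"
      then show "slice x (frag_map (diag_act act \<pi> \<one>) w) = slice x w"
        using slice_diag_act[OF k one_closed x, of act] perm_one M(4) w by (simp add: tensor_def)
    qed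
    { fix v assume "v \<in> tensor M Y"
      then show "w - v \<in> tensor M Y"
        using w M(2) keys_diff[of w v] by (auto simp: tensor_def slice_diff) }
    fix t assume t: "t \<in> carrier G"
    show "frag_map (diag_act act \<pi> t) w \<in> tensor M Y" by (rule act[OF t w])
    fix s assume s: "s \<in> carrier G"
    have kt: "keys (frag_map (diag_act act \<pi> t) w) \<subseteq> UNIV \<times> Y"
      by (rule keys_diag_act[OF k t])
    show "frag_map (diag_act act \<pi> (s \<otimes> t)) w
        = frag_map (diag_act act \<pi> s) (frag_map (diag_act act \<pi> t) w)"
    proof (rule slice_eqI[OF keys_diag_act[OF k m_closed[OF s t]] keys_diag_act[OF kt s]])
      fix x assume x: "x \<in> Y"
      define y where "y = unperm (s \<otimes> t) x"
      have st: "s \<otimes> t \<in> carrier G" using s t by simp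
      have y: "y \<in> Y" "x = \<pi> (s \<otimes> t) y" "x = \<pi> s (\<pi> t y)"
        unfolding y_def using unperm[OF st x] perm_mult[OF s t] by auto
      show "slice x (frag_map (diag_act act \<pi> (s \<otimes> t)) w)
          = slice x (frag_map (diag_act act \<pi> s) (frag_map (diag_act act \<pi> t) w))"
        using slice_diag_act[OF k st y(1), of act] slice_diag_act[OF k t y(1), of act]
          slice_diag_act[OF kt s perm_closed[OF t y(1)], of act] M(5)[OF s t] w y
        by (simp add: tensor_def)
    qed
  qed
qed

text \<open>With the diagonal action, a free module tensored with the permutation module is again free:
  the permutation is undone by \<open>((i, x), t) \<mapsto> ((i, t), \<pi> t x)\<close>.\<close>

lemma FP_tensor_step:
  fixes M :: "('m \<Rightarrow>\<^sub>0 int) set"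
  assumes M: "gmodule G act M" and "FP G act n M"
    and IH: "\<And>n' K. n = Suc n' \<Longrightarrow> gmodule G (free_act G) K \<Longrightarrow>
        FP G (free_act G) n' (K :: (nat \<times> 'a \<Rightarrow>\<^sub>0 int) set) \<Longrightarrow>
        FP G (diag_act (free_act G) \<pi>) n' (tensor K Y)"
  shows "FP G (diag_act act \<pi>) n (tensor M Y)"
proof -
  obtain k m where gen: "generates G act M {..<k::nat} m"
    and syz: "\<And>n'. n = Suc n' \<Longrightarrow> FP G (free_act G) n' (syzygies G act {..<k} m)"
    using FP_iff[THEN iffD1, OF assms(2)] by blast
  have mM: "m \<in> {..<k} \<rightarrow> M" using generatesD(1)[OF gen] by blast
  define I where "I = {..<k} \<times> Y"
  define m' where "m' = (\<lambda>(i, x). frag_map (\<lambda>b. (b, x :: 'x)) (m i))"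
  define f where "f = frag_map (\<lambda>((i :: nat, x), t). ((i, t), \<pi> t x))"
  define b where "b = frag_map (\<lambda>((i :: nat, t), x). ((i, unperm t x), t))"
  define F where "F = tensor (Free k) Y"
  have keysF: "keys w \<subseteq> ({..<k} \<times> carrier G) \<times> Y" if w: "w \<in> F" for w
  proof
    fix p assume p: "p \<in> keys w"
    obtain q x where q: "p = (q, x)" by (cases p)
    have x: "x \<in> Y" using w p q by (auto simp: F_def tensor_def)
    have "q \<in> keys (slice x w)" using p q by (simp add: in_keys_iff lookup_slice)
    then show "p \<in> ({..<k} \<times> carrier G) \<times> Y" using w x q by (auto simp: F_def tensor_def
        free_module_def)
  qed
  have fF: "f u \<in> F" if "u \<in> free_module G I" for u
    using that
  proof (induction u rule: free_module_induct)
    case (diff u v)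
    then show ?case
      using gmoduleD(2)[OF gmodule_tensor[OF gmodule_free]] unfolding F_def f_def frag_map_diff by
          blast
  qed (auto simp: F_def f_def tensor_def I_def perm_closed)
  have bF: "b w \<in> free_module G I" if "w \<in> F" for w
  proof -
    have "(\<lambda>((i :: nat, t), x). ((i, unperm t x), t)) ` (({..<k} \<times> carrier G) \<times> Y)
        \<subseteq> I \<times> carrier G"
      using unperm(1) by (auto simp: I_def)
    then have "keys (b w) \<subseteq> I \<times> carrier G"
      unfolding b_def by (rule subset_trans[OF subset_trans[OF keys_frag_map image_mono[OF
          keysF[OF that]]]])
    then show ?thesis by (simp add: free_module_def)
  qed
  have bf: "b (f u) = u" if "u \<in> free_module G I" for u
    unfolding b_def f_def frag_map_frag_map using that
    by (intro frag_map_ident) (auto simp: free_module_def I_def unperm)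
  have fb: "f (b w) = w" if "w \<in> F" for w
    unfolding b_def f_def frag_map_frag_map using keysF[OF that]
    by (intro frag_map_ident) (auto simp: unperm)
  have m'M: "m' \<in> I \<rightarrow> tensor M Y"
  proof
    fix p assume "p \<in> I"
    then obtain i x where p: "p = (i, x)" "i < k" "x \<in> Y" by (auto simp: I_def)
    have "keys (m' p) \<subseteq> UNIV \<times> Y"
      unfolding m'_def using keys_frag_map[of "\<lambda>b. (b, x)" "m i"] p by auto
    then show "m' p \<in> tensor M Y"
      using p mM gmoduleD(1)[OF M] by (auto simp: tensor_def m'_def slice_frag_map_Pair
          frag_map_ident)
  qed
  have M': "gmodule G (diag_act act \<pi>) (tensor M Y)" by (rule gmodule_tensor[OF M])
  have slice_lin: "slice x (lin (diag_act act \<pi>) m' u) = lin act m (slice x (f u))"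
    if "u \<in> free_module G I" "x \<in> Y" for u x
    using that(1) by (induction u rule: free_module_induct)
      (auto simp: f_def m'_def slice_diff lin_diff frag_map_diff frag_map_frag_map
          slice_frag_map_Pair)
  have gen': "generates G (diag_act act \<pi>) (tensor M Y) I m'"
  proof (rule generatesI)
    fix w assume w: "w \<in> tensor M Y"
    then have "\<forall>x\<in>Y. \<exists>v. v \<in> Free k \<and> lin act m v = slice x w"
      using generates_surj[OF gen] by (auto simp: tensor_def)
    then obtain v where v: "\<And>x. x \<in> Y \<Longrightarrow> v x \<in> Free k"
      "\<And>x. x \<in> Y \<Longrightarrow> lin act m (v x) = slice x w" by metis
    obtain w' where w': "w' \<in> F" "\<And>x. x \<in> Y \<Longrightarrow> slice x w' = v x"
      using ex_tensor_slices[of Y v "Free k", OF finite_Y v(1)] unfolding F_def by metis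
    have "w = lin (diag_act act \<pi>) m' (b w')"
    proof (rule slice_eqI)
      show "keys w \<subseteq> UNIV \<times> Y" using w by (simp add: tensor_def)
      show "keys (lin (diag_act act \<pi>) m' (b w')) \<subseteq> UNIV \<times> Y"
        using lin_closed[OF M' m'M bF[OF w'(1)]] by (simp add: tensor_def)
      fix x assume x: "x \<in> Y"
      show "slice x w = slice x (lin (diag_act act \<pi>) m' (b w'))"
        using slice_lin[OF bF[OF w'(1)] x] fb[OF w'(1)] w'(2)[OF x] v(2)[OF x] by simp
    qed
    then show "\<exists>u\<in>free_module G I. w = lin (diag_act act \<pi>) m' u" using bF[OF w'(1)] by blast
  qed (use m'M in auto)
  \<comment> \<open>Exactness of tensoring with a free abelian group, slice by slice: after
    twisting, a syzygy of \<open>m'\<close> is precisely a family of syzygies of \<open>m\<close>,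
    one for each point of \<open>Y\<close>.\<close>
  have lin0: "lin (diag_act act \<pi>) m' u = 0 \<longleftrightarrow> (\<forall>x\<in>Y. lin act m (slice x (f u)) = 0)"
    if u: "u \<in> free_module G I" for u
  proof
    assume "\<forall>x\<in>Y. lin act m (slice x (f u)) = 0"
    then show "lin (diag_act act \<pi>) m' u = 0"
      using lin_closed[OF M' m'M u] slice_lin[OF u] by (intro slice_eqI[of _ Y]) (auto simp:
          tensor_def)
  next
    assume "lin (diag_act act \<pi>) m' u = 0"
    then show "\<forall>x\<in>Y. lin act m (slice x (f u)) = 0" using slice_lin[OF u] by simp
  qed
  define K where "K = tensor (syzygies G act {..<k} m) Y"
  have KF: "K \<subseteq> F" unfolding K_def F_def tensor_def syzygies_def by auto
  have "b ` K = syzygies G (diag_act act \<pi>) I m'"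
  proof (intro equalityI subsetI)
    fix u assume "u \<in> b ` K"
    then obtain w where w: "w \<in> K" "u = b w" by blast
    have "w \<in> F" using w KF by blast
    then show "u \<in> syzygies G (diag_act act \<pi>) I m'"
      using w lin0[OF bF] bF fb by (auto simp: syzygies_def K_def tensor_def)
  next
    fix u assume "u \<in> syzygies G (diag_act act \<pi>) I m'"
    then have u: "u \<in> free_module G I" "lin (diag_act act \<pi>) m' u = 0" by (auto simp: syzygies_def)
    then have "f u \<in> K" using lin0 fF[OF u(1)] by (auto simp: F_def K_def tensor_def syzygies_def)
    then show "u \<in> b ` K" using bf[OF u(1)] by (metis imageI)
  qed
  moreover have "ghom G (diag_act (free_act G) \<pi>) (free_act G) K b"
    unfolding ghom_def
  proof (intro conjI ballI)
    fix t w assume t: "t \<in> carrier G" and w: "w \<in> K"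
    have "keys w \<subseteq> ({..<k} \<times> carrier G) \<times> Y" using w KF keysF by blast
    then show "b (frag_map (diag_act (free_act G) \<pi> t) w) = smul G t (b w)"
      unfolding b_def frag_map_frag_map using t
      by (intro frag_map_cong) (auto simp: unperm_mult)
  qed (simp add: b_def frag_map_diff)
  moreover have "inj_on b K" using fb KF by (intro inj_on_inverseI[of _ f]) auto
  moreover have "gmodule G (diag_act (free_act G) \<pi>) K"
    unfolding K_def by (rule gmodule_tensor[OF gmodule_syzygies[OF M mM]])
  ultimately have "FP G (free_act G) n' (syzygies G (diag_act act \<pi>) I m')" if "n = Suc n'" for n'
    using FP_iso IH[OF that gmodule_syzygies[OF M mM] syz[OF that]] unfolding K_def by metis
  then show ?thesis
    by (intro FP_finite_generators[OF _ M' gen']) (auto simp: I_def finite_Y)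
qed

lemma FP_tensor_free:
  fixes K :: "(nat \<times> 'a \<Rightarrow>\<^sub>0 int) set"
  assumes "gmodule G (free_act G) K" "FP G (free_act G) n K"
  shows "FP G (diag_act (free_act G) \<pi>) n (tensor K Y)"
  using assms
proof (induction n arbitrary: K)
  case 0
  show ?case by (rule FP_tensor_step[OF 0]) simp
next
  case (Suc n)
  show ?case by (rule FP_tensor_step[OF Suc.prems]) (use Suc.IH in blast)
qed

lemma FP_tensor:
  assumes "gmodule G act M" "FP G act n M"
  shows "FP G (diag_act act \<pi>) n (tensor M Y)"
  by (rule FP_tensor_step[OF assms]) (rule FP_tensor_free)

end

section \<open>The complex of tuples\<close>

definition frags_on :: "'m set \<Rightarrow> ('m \<Rightarrow>\<^sub>0 int) set" where
  "frags_on Z = {w. keys w \<subseteq> Z}"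

lemma frags_on_induct [consumes 1, case_names zero one diff]:
  assumes "w \<in> frags_on Z"
    and "P 0" "\<And>z. z \<in> Z \<Longrightarrow> P (frag_of z)"
    and "\<And>u v. u \<in> frags_on Z \<Longrightarrow> v \<in> frags_on Z \<Longrightarrow> P u \<Longrightarrow> P v \<Longrightarrow> P (u - v)"
  shows "P w"
proof -
  have "keys w \<subseteq> Z" using assms(1) by (simp add: frags_on_def)
  then have "w \<in> frags_on Z \<and> P w"
  proof (induction w rule: frag_induction)
    case (diff a b)
    then show ?case using assms(4) keys_diff[of a b] by (auto simp: frags_on_def)
  qed (use assms in \<open>auto simp: frags_on_def\<close>)
  then show ?thesis ..
qed

lemma frags_on_diff: "u \<in> frags_on Z \<Longrightarrow> v \<in> frags_on Z \<Longrightarrow> u - v \<in> frags_on Z"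
  using keys_diff[of u v] by (auto simp: frags_on_def)

lemma zero_in_frags_on [simp]: "0 \<in> frags_on Z"
  and frag_of_in_frags_on [simp]: "frag_of z \<in> frags_on Z \<longleftrightarrow> z \<in> Z"
  by (simp_all add: frags_on_def)

lemma frag_map_in_frags_on: "w \<in> frags_on Z \<Longrightarrow> f ` Z \<subseteq> Z' \<Longrightarrow> frag_map f w \<in> frags_on Z'"
  using keys_frag_map[of f w] unfolding frags_on_def by blast

lemma frag_map_image_frags_on: "frag_map f ` frags_on Z = frags_on (f ` Z)"
proof (intro equalityI subsetI)
  fix w assume "w \<in> frags_on (f ` Z)"
  then have "w = frag_map f (frag_map (inv_into Z f) w)"
    unfolding frag_map_frag_map
    by (intro frag_map_ident[symmetric]) (auto simp: frags_on_def f_inv_into_f subset_iff)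
  moreover have "frag_map (inv_into Z f) w \<in> frags_on Z"
    using \<open>w \<in> frags_on (f ` Z)\<close> by (rule frag_map_in_frags_on) (auto intro: inv_into_into)
  ultimately show "w \<in> frag_map f ` frags_on Z" by blast
qed (auto intro: frag_map_in_frags_on)

lemma inj_on_frag_map:
  assumes "inj_on f Z"
  shows "inj_on (frag_map f) (frags_on Z)"
proof (rule inj_on_inverseI)
  fix w assume "w \<in> frags_on Z"
  then show "frag_map (inv_into Z f) (frag_map f w) = w"
    unfolding frag_map_frag_map using assms
    by (intro frag_map_ident) (auto simp: frags_on_def)
qed

lemma tensor_frags_on: "tensor (frags_on Z) Y = frags_on (Z \<times> Y)"
proof -
  have 1: "keys w \<subseteq> Z \<times> Y"
    if "keys w \<subseteq> UNIV \<times> Y" "\<And>x. x \<in> Y \<Longrightarrow> keys (slice x w) \<subseteq> Z"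
    for w :: "'a \<times> 'b \<Rightarrow>\<^sub>0 int"
  proof
    fix p assume p: "p \<in> keys w"
    obtain z x where zx: "p = (z, x)" by (cases p)
    have "z \<in> keys (slice x w)" using p zx by (simp add: in_keys_iff lookup_slice)
    moreover have "x \<in> Y" using p zx that(1) by auto
    ultimately show "p \<in> Z \<times> Y" using that(2) zx by auto
  qed
  have 2: "keys (slice x w) \<subseteq> Z" if "keys w \<subseteq> Z \<times> Y"
    for w :: "'a \<times> 'b \<Rightarrow>\<^sub>0 int" and x
    using that by (auto simp: in_keys_iff lookup_slice subset_iff)
  show ?thesis
  proof (intro equalityI subsetI)
    fix w assume "w \<in> tensor (frags_on Z) Y"
    then show "w \<in> frags_on (Z \<times> Y)" using 1[of w] by (simp add: tensor_def frags_on_def)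
  next
    fix w assume "w \<in> frags_on (Z \<times> Y)"
    then have w: "keys w \<subseteq> Z \<times> Y" by (simp add: frags_on_def)
    moreover have "Z \<times> Y \<subseteq> UNIV \<times> Y" by auto
    ultimately show "w \<in> tensor (frags_on Z) Y" using 2[OF w] by (simp add: tensor_def
        frags_on_def subset_trans)
  qed
qed

lemma (in monoid) gmodule_frags_on:
  assumes "\<And>t z. t \<in> carrier G \<Longrightarrow> z \<in> Z \<Longrightarrow> act t z \<in> Z"
    and "\<And>z. z \<in> Z \<Longrightarrow> act \<one> z = z"
    and "\<And>s t z. s \<in> carrier G \<Longrightarrow> t \<in> carrier G \<Longrightarrow> z \<in> Z \<Longrightarrow> act (s \<otimes> t) z = act s (act t z)"
  shows "gmodule G act (frags_on Z)"
  unfolding gmodule_def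
proof (intro conjI ballI)
  fix w assume w: "w \<in> frags_on Z"
  then have k: "\<And>z. z \<in> keys w \<Longrightarrow> z \<in> Z" by (auto simp: frags_on_def)
  show "frag_map (act \<one>) w = w" using k assms(2) by (intro frag_map_ident) auto
  fix t assume t: "t \<in> carrier G"
  show "frag_map (act t) w \<in> frags_on Z"
    using assms(1)[OF t] by (intro frag_map_in_frags_on[OF w]) auto
  fix s assume s: "s \<in> carrier G"
  show "frag_map (act (s \<otimes> t)) w = frag_map (act s) (frag_map (act t) w)"
    unfolding frag_map_frag_map using k assms(3)[OF s t] by (intro frag_map_cong) auto
qed (auto intro: frags_on_diff)

lemma (in monoid) FP_frags_on_iso:
  assumes "gmodule G act (frags_on Z)" "inj_on f Z"
    and "\<And>t z. t \<in> carrier G \<Longrightarrow> z \<in> Z \<Longrightarrow> f (act t z) = act' t (f z)"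
    and "FP G act n (frags_on Z)"
  shows "FP G act' n (frags_on (f ` Z))"
proof -
  have "ghom G act act' (frags_on Z) (frag_map f)"
    unfolding ghom_def frag_map_frag_map using assms(3)
    by (auto simp: frag_map_diff frags_on_def intro!: frag_map_cong)
  from FP_iso[OF assms(1) this inj_on_frag_map[OF assms(2)] assms(4)]
  show ?thesis by (simp add: frag_map_image_frags_on)
qed

abbreviation trivial_act :: "'a \<Rightarrow> unit \<Rightarrow> unit" where
  "trivial_act \<equiv> \<lambda>_ x. x"

text \<open>The alternating sum of the tuples obtained by deleting one entry, in recursive form. A
  tuple of length one is sent to the empty tuple, so the augmentation is part of the
  complex.\<close>

fun bd :: "'x list \<Rightarrow> 'x list \<Rightarrow>\<^sub>0 int" where
  "bd [] = 0"
| "bd (x # xs) = frag_of xs - frag_map ((#) x) (bd xs)"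

text \<open>The cone identity: prepending \<open>x\<close> is a contracting homotopy. It yields both
  that the boundary squares to zero and that the complex is exact.\<close>

lemma bd_Cons: "frag_extend bd (frag_map ((#) x) w) = w - frag_map ((#) x) (frag_extend bd w)"
proof -
  have "w \<in> frags_on UNIV" by (simp add: frags_on_def)
  then show ?thesis
    by (induction w rule: frags_on_induct) (auto simp: frag_extend_diff frag_map_diff)
qed

lemma bd_bd: "frag_extend bd (frag_extend bd w) = 0"
proof -
  have bd: "frag_extend bd (bd xs) = 0" for xs :: "'a list"
    by (induction xs) (auto simp: frag_extend_diff bd_Cons)
  have "w \<in> frags_on UNIV" by (simp add: frags_on_def)
  then show ?thesis
    by (induction w rule: frags_on_induct) (auto simp: frag_extend_diff bd)
qed

lemma bd_map: "bd (map f xs) = frag_map (map f) (bd xs)"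
  by (induction xs) (auto simp: frag_map_diff frag_map_frag_map)

context finite_permutation_action
begin

definition tuples :: "nat \<Rightarrow> 'x list set" where
  "tuples k = {xs. length xs = k \<and> set xs \<subseteq> Y}"

lemma bd_in_frags_on: "xs \<in> tuples (Suc k) \<Longrightarrow> bd xs \<in> frags_on (tuples k)"
proof (induction k arbitrary: xs)
  case (Suc k)
  then obtain x ys where xs: "xs = x # ys" "x \<in> Y" "ys \<in> tuples (Suc k)"
    by (cases xs) (auto simp: tuples_def)
  show ?case
    unfolding xs(1) bd.simps using xs Suc.IH[OF xs(3)]
    by (intro frags_on_diff frag_map_in_frags_on[of _ "tuples k"]) (auto simp: tuples_def)
qed (auto simp: tuples_def length_Suc_conv)

lemma gmodule_tuples: "gmodule G (\<lambda>t. map (\<pi> t)) (frags_on (tuples k))"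
proof (rule gmodule_frags_on)
  fix t xs assume "t \<in> carrier G" "xs \<in> tuples k"
  then show "map (\<pi> t) xs \<in> tuples k" using perm_closed by (auto simp: tuples_def)
next
  fix xs assume "xs \<in> tuples k"
  then show "map (\<pi> \<one>) xs = xs" using perm_one by (auto simp: tuples_def intro!: map_idI)
next
  fix s t xs assume "s \<in> carrier G" "t \<in> carrier G" "xs \<in> tuples k"
  then show "map (\<pi> (s \<otimes> t)) xs = map (\<pi> s) (map (\<pi> t) xs)"
    using perm_mult by (auto simp: tuples_def)
qed

lemma gmodule_points: "gmodule G \<pi> (frags_on Y)"
  by (rule gmodule_frags_on) (auto simp: perm_closed perm_one perm_mult)

lemma ghom_bd: "ghom G (\<lambda>t. map (\<pi> t)) (\<lambda>t. map (\<pi> t)) M (frag_extend bd)"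
proof -
  have "frag_extend bd (frag_map (map (\<pi> t)) w) = frag_map (map (\<pi> t)) (frag_extend bd w)" for t w
  proof -
    have "w \<in> frags_on UNIV" by (simp add: frags_on_def)
    then show ?thesis
      by (induction w rule: frags_on_induct) (auto simp: frag_extend_diff frag_map_diff bd_map)
  qed
  then show ?thesis by (simp add: ghom_def frag_extend_diff)
qed

text \<open>A cycle is the boundary of the chain obtained by prepending a fixed point of
  \<open>Y\<close>. This contraction is not equivariant in general, but exactness concerns the
  underlying abelian groups only.\<close>

lemma bd_exact:
  assumes "Y \<noteq> {}"
  shows "frag_extend bd ` frags_on (tuples (Suc k)) = {w \<in> frags_on (tuples k). frag_extend bd w =
      0}"
proof (intro equalityI subsetI)
  fix w assume "w \<in> frag_extend bd ` frags_on (tuples (Suc k))"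
  then obtain u where u: "u \<in> frags_on (tuples (Suc k))" "w = frag_extend bd u" by blast
  from u(1) have "frag_extend bd u \<in> frags_on (tuples k)"
    by (induction u rule: frags_on_induct) (auto simp: frag_extend_diff bd_in_frags_on intro:
        frags_on_diff)
  then show "w \<in> {w \<in> frags_on (tuples k). frag_extend bd w = 0}" using u(2) bd_bd by simp
next
  fix w assume w: "w \<in> {w \<in> frags_on (tuples k). frag_extend bd w = 0}"
  obtain x where x: "x \<in> Y" using assms by blast
  have "w = frag_extend bd (frag_map ((#) x) w)" using w by (simp add: bd_Cons)
  moreover have "frag_map ((#) x) w \<in> frags_on (tuples (Suc k))"
    using w x by (intro frag_map_in_frags_on[of w "tuples k"]) (auto simp: tuples_def)
  ultimately show "w \<in> frag_extend bd ` frags_on (tuples (Suc k))" by blast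
qed

text \<open>Lengthening the tuples by one entry is tensoring with \<int>Y; the new point is put in
  front.\<close>

lemma FP_tuples:
  assumes "FP G \<pi> n (frags_on Y)"
  shows "FP G (\<lambda>t. map (\<pi> t)) n (frags_on (tuples (Suc k)))"
proof (induction k)
  case 0
  have "tuples (Suc 0) = (\<lambda>x. [x]) ` Y" by (auto simp: tuples_def length_Suc_conv)
  then show ?case
    using FP_frags_on_iso[OF gmodule_points _ _ assms, of "\<lambda>x. [x]" "\<lambda>t. map (\<pi> t)"]
    by (simp add: inj_on_def)
next
  case (Suc k)
  have T: "gmodule G (diag_act (\<lambda>t. map (\<pi> t)) \<pi>) (frags_on (tuples (Suc k) \<times> Y))"
    using gmodule_tensor[OF gmodule_tuples] by (simp add: tensor_frags_on)
  have "FP G (diag_act (\<lambda>t. map (\<pi> t)) \<pi>) n (frags_on (tuples (Suc k) \<times> Y))"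
    using FP_tensor[OF gmodule_tuples Suc] by (simp add: tensor_frags_on)
  from FP_frags_on_iso[OF T _ _ this, of "\<lambda>(xs, x). x # xs" "\<lambda>t. map (\<pi> t)"]
  have "FP G (\<lambda>t. map (\<pi> t)) n (frags_on ((\<lambda>(xs, x). x # xs) ` (tuples (Suc k) \<times> Y)))"
    by (auto simp: inj_on_def)
  moreover have "tuples (Suc (Suc k)) = (\<lambda>(xs, x). x # xs) ` (tuples (Suc k) \<times> Y)"
    by (force simp: tuples_def length_Suc_conv)
  ultimately show ?case by simp
qed

text \<open>The cycles of the augmented complex of tuples are all of type \<open>FP\<^sub>n\<close>, by induction on \<open>n\<close>:
  the cycles of one degree are the quotient of a tuple module by the cycles of the next degree.\<close>

lemma FP_cycles:
  assumes "Y \<noteq> {}" "\<And>n. FP G \<pi> n (frags_on Y)"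
  shows "FP G (\<lambda>t. map (\<pi> t)) n {w \<in> frags_on (tuples k). frag_extend bd w = 0}"
proof (induction n arbitrary: k)
  case 0
  show ?case
    using FP_0_image[OF gmodule_tuples ghom_bd FP_tuples[OF assms(2)]] bd_exact[OF assms(1)] by simp
next
  case (Suc n)
  show ?case
    using FP_quotient[OF gmodule_tuples ghom_bd Suc FP_tuples[OF assms(2)]] bd_exact[OF assms(1)]
        by simp
qed

text \<open>In length zero every chain is a cycle, and the chains on the empty tuple form the
  trivial module, so one direction is a case of \<open>FP_cycles\<close>. For the other, tensoring
  the trivial module with \<int>Y gives \<int>Y.\<close>

lemma FP_trivial_iff_FP_permutation:
  assumes "Y \<noteq> {}"
  shows "(\<forall>n. FP G trivial_act n UNIV) \<longleftrightarrow> (\<forall>n. FP G \<pi> n (frags_on Y))"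
proof (intro iffI allI)
  fix n assume "\<forall>n. FP G \<pi> n (frags_on Y)"
  then have cycles: "FP G (\<lambda>t. map (\<pi> t)) n {w \<in> frags_on (tuples 0). frag_extend bd w = 0}"
    using FP_cycles[OF assms] by blast
  have t0: "tuples 0 = {[]}" by (auto simp: tuples_def)
  have "frag_extend bd w = 0" if "w \<in> frags_on (tuples 0)" for w
    using that unfolding t0 frags_on_def by (intro frag_extend_eq_0) auto
  then have "{w \<in> frags_on (tuples 0). frag_extend bd w = 0} = frags_on (tuples 0)" by auto
  with cycles have "FP G (\<lambda>t. map (\<pi> t)) n (frags_on (tuples 0))" by simp
  from FP_frags_on_iso[OF gmodule_tuples _ _ this, of "\<lambda>_. ()" trivial_act]
  have "FP G trivial_act n (frags_on ((\<lambda>_. ()) ` tuples 0))" by (simp add: t0)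
  then show "FP G trivial_act n UNIV" by (simp add: t0 frags_on_def UNIV_unit[symmetric])
next
  fix n assume "\<forall>n. FP G trivial_act n UNIV"
  then have triv: "FP G trivial_act n (frags_on UNIV)" by (simp add: frags_on_def)
  have M: "gmodule G trivial_act (frags_on UNIV)" by (rule gmodule_frags_on) auto
  have T: "gmodule G (diag_act trivial_act \<pi>) (frags_on (UNIV \<times> Y))"
    using gmodule_tensor[OF M] by (simp add: tensor_frags_on)
  have "FP G (diag_act trivial_act \<pi>) n (frags_on (UNIV \<times> Y))"
    using FP_tensor[OF M triv] by (simp add: tensor_frags_on)
  from FP_frags_on_iso[OF T _ _ this, of snd \<pi>]
  have "FP G \<pi> n (frags_on (snd ` (UNIV \<times> Y)))" by (auto simp: inj_on_def)
  then show "FP G \<pi> n (frags_on Y)" by simp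
qed

end

section \<open>Inverse monoids and faithful flatness\<close>

context inverse_monoid
begin

lemma sg_inv:
  assumes "x \<in> carrier S"
  shows "sg_inv S x \<in> carrier S" "x \<otimes> sg_inv S x \<otimes> x = x" "sg_inv S x \<otimes> x \<otimes> sg_inv S x = sg_inv S x"
  using theI'[OF ex1_inverse[OF assms], folded sg_inv_def] by auto

lemma sg_inv_eqI:
  assumes "x \<in> carrier S" "y \<in> carrier S" "x \<otimes> y \<otimes> x = x" "y \<otimes> x \<otimes> y = y"
  shows "sg_inv S x = y"
  using ex1_inverse[OF assms(1)] sg_inv[OF assms(1)] assms by metis

lemma idempotentsD: "e \<in> idempotents S \<Longrightarrow> e \<in> carrier S" "e \<in> idempotents S \<Longrightarrow> e \<otimes> e = e"
  by (auto simp: idempotents_def)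

lemma sg_inv_idem: "e \<in> idempotents S \<Longrightarrow> sg_inv S e = e"
  by (intro sg_inv_eqI) (auto simp: idempotents_def)

lemma idem_mult_absorb:
  assumes "e \<in> idempotents S" "x \<in> carrier S"
  shows "e \<otimes> (e \<otimes> x) = e \<otimes> x"
  using assms by (simp add: idempotents_def m_assoc[symmetric])

text \<open>For the inverse \<open>x\<close> of \<open>e f\<close>, the element \<open>f x e\<close>
  is an inverse of \<open>e f\<close> too. Uniqueness gives \<open>x = f x e\<close>, whence
  \<open>x\<close> is idempotent; it is then its own inverse, and that inverse is
  \<open>e f\<close>.\<close>

lemma idem_prod:
  assumes "e \<in> idempotents S" "f \<in> idempotents S"
  shows "e \<otimes> f \<in> idempotents S"
proof -
  note c = idempotentsD(1)[OF assms(1)] idempotentsD(1)[OF assms(2)]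
  have ef: "e \<otimes> f \<in> carrier S" using c by simp
  define x where "x = sg_inv S (e \<otimes> f)"
  note X = sg_inv[OF ef, folded x_def]
  have x1: "e \<otimes> (f \<otimes> (x \<otimes> (e \<otimes> f))) = e \<otimes> f" using X c by (simp add: m_assoc)
  have x2: "x \<otimes> (e \<otimes> (f \<otimes> x)) = x" using X c by (simp add: m_assoc)
  have "sg_inv S (e \<otimes> f) = f \<otimes> x \<otimes> e"
  proof (rule sg_inv_eqI[OF ef])
    show "f \<otimes> x \<otimes> e \<in> carrier S" using X c by simp
    show "e \<otimes> f \<otimes> (f \<otimes> x \<otimes> e) \<otimes> (e \<otimes> f) = e \<otimes> f"
      using X c x1 by (simp add: m_assoc idem_mult_absorb assms)
    have "f \<otimes> x \<otimes> e \<otimes> (e \<otimes> f) \<otimes> (f \<otimes> x \<otimes> e) = f \<otimes> ((x \<otimes> (e \<otimes> (f \<otimes> x))) \<otimes> e)"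
      using X(1) c by (simp add: m_assoc idem_mult_absorb assms)
    also have "\<dots> = f \<otimes> x \<otimes> e" unfolding x2 using X(1) c by (simp add: m_assoc)
    finally show "f \<otimes> x \<otimes> e \<otimes> (e \<otimes> f) \<otimes> (f \<otimes> x \<otimes> e) = f \<otimes> x \<otimes> e" .
  qed
  then have xe: "x = f \<otimes> x \<otimes> e" by (simp add: x_def)
  have "x \<otimes> x = (f \<otimes> x \<otimes> e) \<otimes> (f \<otimes> x \<otimes> e)" using xe by simp
  also have "\<dots> = f \<otimes> ((x \<otimes> (e \<otimes> (f \<otimes> x))) \<otimes> e)" using X(1) c by (simp add: m_assoc)
  also have "\<dots> = x" unfolding x2 using xe[symmetric] X(1) c by (simp add: m_assoc)
  finally have "x \<in> idempotents S" using X by (simp add: idempotents_def)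
  moreover have "e \<otimes> f = sg_inv S x"
    by (rule sg_inv_eqI[symmetric]) (use X ef in auto)
  ultimately show ?thesis using sg_inv_idem by simp
qed

text \<open>Both \<open>f e\<close> and the idempotent \<open>e f\<close> itself are inverses of
  \<open>e f\<close>.\<close>

lemma idem_commute:
  assumes "e \<in> idempotents S" "f \<in> idempotents S"
  shows "e \<otimes> f = f \<otimes> e"
proof -
  note c = idempotentsD(1)[OF assms(1)] idempotentsD(1)[OF assms(2)]
  have 1: "e \<otimes> (f \<otimes> (e \<otimes> f)) = e \<otimes> f" "f \<otimes> (e \<otimes> (f \<otimes> e)) = f \<otimes> e"
    using idempotentsD(2)[OF idem_prod[OF assms]] idempotentsD(2)[OF idem_prod[OF assms(2,1)]] c
    by (simp_all add: m_assoc)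
  have "sg_inv S (e \<otimes> f) = f \<otimes> e"
    by (rule sg_inv_eqI) (use c 1 in \<open>simp_all add: m_assoc idem_mult_absorb assms\<close>)
  then show ?thesis using sg_inv_idem[OF idem_prod[OF assms]] by simp
qed

lemma idem_sg_inv:
  assumes "x \<in> carrier S"
  shows "x \<otimes> sg_inv S x \<in> idempotents S" "sg_inv S x \<otimes> x \<in> idempotents S"
  using sg_inv[OF assms] assms by (auto simp: idempotents_def m_assoc[symmetric])

lemma one_idem: "\<one> \<in> idempotents S"
  by (simp add: idempotents_def)

text \<open>Moves an idempotent from the right of \<open>s\<close> to its left, as
  \<open>s e s^{-1}\<close>. Together with \<open>idem_mult\<close>, which moves it the other way,
  this stands in for cancellation in a group.\<close>

lemma mult_idem:
  assumes "s \<in> carrier S" "e \<in> idempotents S"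
  shows "s \<otimes> e = s \<otimes> e \<otimes> sg_inv S s \<otimes> s"
proof -
  note c = assms(1) idempotentsD(1)[OF assms(2)] sg_inv[OF assms(1)]
  have "s \<otimes> e \<otimes> sg_inv S s \<otimes> s = s \<otimes> (e \<otimes> (sg_inv S s \<otimes> s))" using c by (simp add: m_assoc)
  also have "\<dots> = s \<otimes> sg_inv S s \<otimes> s \<otimes> e"
    unfolding idem_commute[OF assms(2) idem_sg_inv(2)[OF assms(1)]] using c(1-3) by (simp add:
        m_assoc)
  finally show ?thesis using c by simp
qed

lemma idem_mult:
  assumes "s \<in> carrier S" "e \<in> idempotents S"
  shows "e \<otimes> s = s \<otimes> (sg_inv S s \<otimes> e \<otimes> s)"
proof -
  note c = assms(1) idempotentsD(1)[OF assms(2)] sg_inv[OF assms(1)]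
  have "s \<otimes> (sg_inv S s \<otimes> e \<otimes> s) = (s \<otimes> sg_inv S s) \<otimes> e \<otimes> s" using c by (simp add: m_assoc)
  also have "\<dots> = e \<otimes> (s \<otimes> sg_inv S s \<otimes> s)"
    unfolding idem_commute[OF idem_sg_inv(1)[OF assms(1)] assms(2)] using c(1-3) by (simp add:
        m_assoc)
  finally show ?thesis using c by simp
qed

lemma idem_conj:
  assumes "s \<in> carrier S" "e \<in> idempotents S"
  shows "s \<otimes> e \<otimes> sg_inv S s \<in> idempotents S" "sg_inv S s \<otimes> e \<otimes> s \<in> idempotents S"
proof -
  note c = assms(1) idempotentsD[OF assms(2)] sg_inv[OF assms(1)]
  have "s \<otimes> e \<otimes> sg_inv S s \<otimes> (s \<otimes> e \<otimes> sg_inv S s) = s \<otimes> e \<otimes> sg_inv S s \<otimes> s \<otimes> (e \<otimes> sg_inv S s)"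
    using c by (simp add: m_assoc)
  also have "\<dots> = s \<otimes> e \<otimes> (e \<otimes> sg_inv S s)" using mult_idem[OF assms] by simp
  finally show "s \<otimes> e \<otimes> sg_inv S s \<in> idempotents S"
    using c assms(2) by (simp add: idempotents_def m_assoc idem_mult_absorb)
  have "sg_inv S s \<otimes> e \<otimes> s \<otimes> (sg_inv S s \<otimes> e \<otimes> s)
      = sg_inv S s \<otimes> (e \<otimes> (s \<otimes> (sg_inv S s \<otimes> e \<otimes> s)))" using c by (simp add: m_assoc)
  also have "\<dots> = sg_inv S s \<otimes> e \<otimes> s"
    unfolding idem_mult[OF assms, symmetric] using c assms(2) by (simp add: m_assoc
        idem_mult_absorb)
  finally show "sg_inv S s \<otimes> e \<otimes> s \<in> idempotents S" using c by (simp add: idempotents_def)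
qed

lemma sg_inv_mult:
  assumes "s \<in> carrier S" "t \<in> carrier S"
  shows "sg_inv S (s \<otimes> t) = sg_inv S t \<otimes> sg_inv S s"
proof -
  note c = assms sg_inv[OF assms(1)] sg_inv[OF assms(2)]
  have comm: "t \<otimes> sg_inv S t \<otimes> (sg_inv S s \<otimes> s) = sg_inv S s \<otimes> s \<otimes> (t \<otimes> sg_inv S t)"
    by (rule idem_commute) (simp_all add: idem_sg_inv assms)
  show ?thesis
  proof (rule sg_inv_eqI)
    have "s \<otimes> t \<otimes> (sg_inv S t \<otimes> sg_inv S s) \<otimes> (s \<otimes> t)
        = s \<otimes> (t \<otimes> sg_inv S t \<otimes> (sg_inv S s \<otimes> s)) \<otimes> t" using c by (simp add: m_assoc)
    also have "\<dots> = (s \<otimes> sg_inv S s \<otimes> s) \<otimes> (t \<otimes> sg_inv S t \<otimes> t)"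
      unfolding comm using c(1,2,3,6) by (simp add: m_assoc)
    finally show "s \<otimes> t \<otimes> (sg_inv S t \<otimes> sg_inv S s) \<otimes> (s \<otimes> t) = s \<otimes> t" using c by simp
    have "sg_inv S t \<otimes> sg_inv S s \<otimes> (s \<otimes> t) \<otimes> (sg_inv S t \<otimes> sg_inv S s)
        = sg_inv S t \<otimes> (sg_inv S s \<otimes> s \<otimes> (t \<otimes> sg_inv S t)) \<otimes> sg_inv S s" using c by (simp add:
            m_assoc)
    also have "\<dots> = (sg_inv S t \<otimes> t \<otimes> sg_inv S t) \<otimes> (sg_inv S s \<otimes> s \<otimes> sg_inv S s)"
      unfolding comm[symmetric] using c(1,2,3,6) by (simp add: m_assoc)
    finally show "sg_inv S t \<otimes> sg_inv S s \<otimes> (s \<otimes> t) \<otimes> (sg_inv S t \<otimes> sg_inv S s)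
        = sg_inv S t \<otimes> sg_inv S s" using c by simp
  qed (use c in auto)
qed

lemma sg_inv_sg_inv: "s \<in> carrier S \<Longrightarrow> sg_inv S (sg_inv S s) = s"
  using sg_inv[of s] by (intro sg_inv_eqI) auto

end

text \<open>For \<open>A = carrier G\<close> and a submodule \<open>L\<close> over a submonoid this
  is the image of the tensor product in the free module. General sets \<open>A\<close> are allowed
  so that elements can be treated by induction on a finite set of translating elements.\<close>

inductive_set induced ::
  "('a, 'z) monoid_scheme \<Rightarrow> 'a set \<Rightarrow> ('i \<times> 'a \<Rightarrow>\<^sub>0 int) set \<Rightarrow> ('i \<times> 'a \<Rightarrow>\<^sub>0 int) set"
  for G A L where
  zero: "0 \<in> induced G A L"
| gen: "s \<in> A \<Longrightarrow> l \<in> L \<Longrightarrow> smul G s l \<in> induced G A L"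
| diff: "x \<in> induced G A L \<Longrightarrow> y \<in> induced G A L \<Longrightarrow> x - y \<in> induced G A L"

lemma induced_mono: "A \<subseteq> B \<Longrightarrow> L \<subseteq> L' \<Longrightarrow> induced G A L \<subseteq> induced G B L'"
proof
  fix x assume "x \<in> induced G A L" "A \<subseteq> B" "L \<subseteq> L'"
  then show "x \<in> induced G B L'" by induction (auto intro: induced.intros)
qed

lemma induced_add: "x \<in> induced G A L \<Longrightarrow> y \<in> induced G A L \<Longrightarrow> x + y \<in> induced G A L"
  using induced.diff[OF _ induced.diff[OF induced.zero]] by fastforce

lemma induced_finite_support:
  assumes "x \<in> induced G A L"
  shows "\<exists>B. finite B \<and> B \<subseteq> A \<and> x \<in> induced G B L"
  using assms
proof induction
  case zero
  then show ?case by (intro exI[of _ "{}"]) (auto intro: induced.zero)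
next
  case (gen s l)
  then show ?case by (intro exI[of _ "{s}"]) (auto intro: induced.gen)
next
  case (diff x y)
  then obtain B C where "finite B" "B \<subseteq> A" "x \<in> induced G B L" "finite C" "C \<subseteq> A" "y \<in> induced G C
      L"
    by blast
  then show ?case
    using induced_mono[of B "B \<union> C" L L G] induced_mono[of C "B \<union> C" L L G]
    by (intro exI[of _ "B \<union> C"]) (auto intro: induced.diff)
qed

text \<open>All terms translated by \<open>s\<close> merge into a single one because
  \<open>L\<close> is closed under differences.\<close>

lemma induced_insert:
  assumes "x \<in> induced G (insert s A) L" and L0: "0 \<in> L" and Ld: "\<And>u v. u \<in> L \<Longrightarrow> v \<in> L \<Longrightarrow> u - v \<in> L"
  shows "\<exists>l\<in>L. \<exists>y\<in>induced G A L. x = smul G s l + y"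
  using assms(1)
proof induction
  case zero
  show ?case by (rule bexI[OF _ L0], rule bexI[OF _ induced.zero]) simp
next
  case (gen t l)
  show ?case
  proof (cases "t = s")
    case True
    then show ?thesis using gen by (intro bexI[OF _ gen(2)] bexI[OF _ induced.zero]) simp
  next
    case False
    then have "t \<in> A" using gen by simp
    then show ?thesis by (intro bexI[OF _ L0] bexI[OF _ induced.gen[OF _ gen(2)]]) auto
  qed
next
  case (diff x y)
  then obtain l x' k y' where "l \<in> L" "x' \<in> induced G A L" "x = smul G s l + x'"
    "k \<in> L" "y' \<in> induced G A L" "y = smul G s k + y'" by blast
  then show ?case
    by (intro bexI[OF _ Ld[of l k]] bexI[OF _ induced.diff[of x' _ _ _ y']]) (auto simp:
        frag_map_diff)
qed

text \<open>Left multiplication by the product of the ring elements \<open>1 - f\<close>. In the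
  application the \<open>f\<close> are idempotents, so the factors commute.\<close>

fun annihilate :: "('a, 'z) monoid_scheme \<Rightarrow> 'a list \<Rightarrow> ('i \<times> 'a \<Rightarrow>\<^sub>0 int) \<Rightarrow> 'i \<times> 'a \<Rightarrow>\<^sub>0 int" where
  "annihilate G [] u = u"
| "annihilate G (f # fs) u = annihilate G fs u - smul G f (annihilate G fs u)"

lemma annihilate_diff: "annihilate G fs (u - v) = annihilate G fs u - annihilate G fs v"
  by (induction fs) (auto simp: frag_map_diff)

lemma annihilate_0: "annihilate G fs 0 = 0"
  by (induction fs) auto

context monoid
begin

lemma free_act_closed:
  "s \<in> carrier G \<Longrightarrow> u \<in> free_module G I \<Longrightarrow> smul G s u \<in> free_module G I"
  by (rule gmoduleD(3)[OF gmodule_free])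

lemma free_act_mult:
  "s \<in> carrier G \<Longrightarrow> t \<in> carrier G \<Longrightarrow> u \<in> free_module G I \<Longrightarrow>
    smul G (s \<otimes> t) u = smul G s (smul G t u)"
  by (rule gmoduleD(5)[OF gmodule_free])

lemma annihilate_closed:
  assumes "gmodule G (free_act G) L" "set fs \<subseteq> carrier G" "u \<in> L"
  shows "annihilate G fs u \<in> L"
  using assms by (induction fs) (auto intro: gmoduleD)

lemma induced_in_free:
  assumes "L \<subseteq> free_module G I" "A \<subseteq> carrier G"
  shows "induced G A L \<subseteq> free_module G I"
proof
  fix x assume "x \<in> induced G A L"
  then show "x \<in> free_module G I"
    by induction (use assms in \<open>auto intro!: free_moduleD(1) free_act_closed\<close>)
qed

lemma gmodule_induced:
  assumes "L \<subseteq> free_module G I"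
  shows "gmodule G (free_act G) (induced G (carrier G) L)"
proof -
  have sub: "induced G (carrier G) L \<subseteq> free_module G I" by (rule induced_in_free[OF assms]) simp
  have "smul G t x \<in> induced G (carrier G) L"
    if t: "t \<in> carrier G" and "x \<in> induced G (carrier G) L" for t x
    using that(2)
  proof induction
    case (gen s l)
    then have "smul G t (smul G s l) = smul G (t \<otimes> s) l"
      using free_act_mult[OF t gen(1) subsetD[OF assms gen(2)]] by simp
    then show ?case using induced.gen[of "t \<otimes> s" "carrier G" l L G] gen t by simp
  qed (auto simp: frag_map_diff intro: induced.intros)
  then show ?thesis
    unfolding gmodule_def using subsetD[OF sub] gmoduleD(4,5)[OF gmodule_free[of I]]
    by (intro conjI ballI) (auto intro: induced.zero induced.diff)
qed

end

context inverse_monoid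
begin

lemma annihilate_commute:
  assumes "set fs \<subseteq> idempotents S" "e \<in> idempotents S" "u \<in> free_module S I"
  shows "smul S e (annihilate S fs u) = annihilate S fs (smul S e u)"
  using assms(1)
proof (induction fs)
  case (Cons f fs)
  have E: "f \<in> idempotents S" "e \<in> carrier S" "f \<in> carrier S" "set fs \<subseteq> carrier S"
    using Cons.prems assms(2) by (auto simp: idempotents_def)
  have a: "annihilate S fs u \<in> free_module S I" by (rule annihilate_closed[OF gmodule_free E(4)
      assms(3)])
  have "smul S e (smul S f (annihilate S fs u))
      = smul S f (smul S e (annihilate S fs u))"
    using free_act_mult[OF E(2,3) a] free_act_mult[OF E(3,2) a] idem_commute[OF E(1) assms(2)] by
        simp
  then show ?case using Cons by (simp add: frag_map_diff)
qed simp

text \<open>The factor \<open>1 - f\<close> kills \<open>u\<close>, and commutation of idempotents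
  allows it to be applied first.\<close>

lemma annihilate_fixed:
  assumes "set fs \<subseteq> idempotents S" "f \<in> set fs" "u \<in> free_module S I" "smul S f u = u"
  shows "annihilate S fs u = 0"
  using assms(1,2)
proof (induction fs)
  case (Cons g fs)
  show ?case
  proof (cases "f \<in> set fs")
    case True
    then show ?thesis using Cons by simp
  next
    case False
    then have "f = g" using Cons.prems by simp
    then show ?thesis using annihilate_commute[of fs f u I] assms Cons.prems by simp
  qed
qed simp

text \<open>As \<open>s f = (s f s^{-1}) s\<close>, whatever \<open>s\<close> kills is also killed
  by \<open>s (1 - f)\<close>.\<close>

lemma annihilate_killed:
  assumes "set fs \<subseteq> idempotents S" "s \<in> carrier S" "u \<in> free_module S I" "smul S s u = 0"
  shows "smul S s (annihilate S fs u) = 0"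
  using assms(1)
proof (induction fs)
  case Nil
  then show ?case using assms(4) by simp
next
  case (Cons f fs)
  have E: "f \<in> idempotents S" "f \<in> carrier S" "set fs \<subseteq> carrier S" "set fs \<subseteq> idempotents S"
    using Cons.prems by (auto simp: idempotents_def)
  have a: "annihilate S fs u \<in> free_module S I" by (rule annihilate_closed[OF gmodule_free E(3)
      assms(3)])
  have z: "smul S s (annihilate S fs u) = 0" by (rule Cons.IH[OF E(4)])
  have c: "s \<otimes> f \<otimes> sg_inv S s \<in> carrier S" using assms(2) E(2) sg_inv(1) by simp
  have "smul S s (smul S f (annihilate S fs u))
      = smul S (s \<otimes> f \<otimes> sg_inv S s \<otimes> s) (annihilate S fs u)"
    using free_act_mult[OF assms(2) E(2) a] mult_idem[OF assms(2) E(1)] by simp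
  also have "\<dots> = 0" unfolding free_act_mult[OF c assms(2) a] z by simp
  finally show ?case using z by (simp add: frag_map_diff)
qed

end

section \<open>Flatness and faithfulness of induction from a full inverse submonoid\<close>

locale full_inverse_submonoid = inverse_monoid +
  fixes H
  assumes full: "full_inverse_subsemigroup H S"
begin

abbreviation HM where "HM \<equiv> S\<lparr>carrier := H\<rparr>"

lemma H_carrier: "h \<in> H \<Longrightarrow> h \<in> carrier S"
  and H_mult: "h \<in> H \<Longrightarrow> k \<in> H \<Longrightarrow> h \<otimes> k \<in> H"
  and H_inv: "h \<in> H \<Longrightarrow> sg_inv S h \<in> H"
  and H_idem: "e \<in> idempotents S \<Longrightarrow> e \<in> H"
  using full unfolding full_inverse_subsemigroup_def inverse_subsemigroup_def by auto

lemma H_one: "\<one> \<in> H"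
  by (rule H_idem[OF one_idem])

sublocale sub: monoid HM
  by unfold_locales (auto simp: H_mult H_one H_carrier m_assoc)

lemma free_act_HM [simp]: "free_act HM = free_act S"
  by (simp add: free_act_def fun_eq_iff)

lemma annihilate_HM: "annihilate HM = annihilate S"
proof (intro ext)
  fix fs and u :: "'i \<times> 'a \<Rightarrow>\<^sub>0 int"
  show "annihilate HM fs u = annihilate S fs u" by (induction fs) auto
qed

lemma free_HM_subset: "free_module HM I \<subseteq> free_module S I"
  using H_carrier by (auto simp: free_module_def)

abbreviation translates :: "'a set \<Rightarrow> 'a set" where
  "translates A \<equiv> {a \<otimes> h | a h. a \<in> A \<and> h \<in> H}"

text \<open>Split \<open>y\<close> into the terms that \<open>s\<close> carries into
  \<open>A H\<close> and the rest. For a term \<open>h\<close> of the first kind,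
  \<open>h h^{-1}\<close> fixes \<open>h\<close>, and \<open>s h h^{-1}\<close> again lies in
  \<open>A H\<close>; these are the required idempotents. The other terms must cancel under
  \<open>s\<close>, for their image is supported both outside and inside \<open>A H\<close>.\<close>

lemma ex_annihilating_idempotents:
  assumes s: "s \<in> carrier S" and A: "A \<subseteq> carrier S" and y: "y \<in> free_module HM I"
    and supp: "keys (smul S s y) \<subseteq> UNIV \<times> translates A"
  shows "\<exists>fs. set fs \<subseteq> idempotents S \<and> (\<forall>f\<in>set fs. \<exists>a\<in>A. \<exists>k\<in>H. s \<otimes> f = a \<otimes> k) \<and>
    smul S s (annihilate S fs y) = 0"
proof -
  define T where "T = {p \<in> keys y. s \<otimes> snd p \<in> translates A}"
  have kH: "snd p \<in> H" if "p \<in> keys y" for p using y that by (auto simp: free_module_def)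
  have "finite ((\<lambda>p. snd p \<otimes> sg_inv S (snd p)) ` T)" by (simp add: T_def)
  then obtain fs where fs: "set fs = (\<lambda>p. snd p \<otimes> sg_inv S (snd p)) ` T" using finite_list by blast
  have E: "set fs \<subseteq> idempotents S"
    using idem_sg_inv(1) kH H_carrier by (auto simp: fs T_def)
  have ak: "\<exists>a\<in>A. \<exists>k\<in>H. s \<otimes> f = a \<otimes> k" if f: "f \<in> set fs" for f
  proof -
    obtain p where p: "p \<in> T" "f = snd p \<otimes> sg_inv S (snd p)" using f unfolding fs by blast
    then obtain a h where ah: "a \<in> A" "h \<in> H" "s \<otimes> snd p = a \<otimes> h" by (auto simp: T_def)
    have pH: "snd p \<in> H" "sg_inv S (snd p) \<in> H" using p kH H_inv by (auto simp: T_def)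
    have "s \<otimes> f = a \<otimes> (h \<otimes> sg_inv S (snd p))"
      unfolding p(2) m_assoc[OF s H_carrier[OF pH(1)] H_carrier[OF pH(2)], symmetric] ah(3)
      by (rule m_assoc) (use ah A pH H_carrier in auto)
    then show ?thesis using ah H_mult pH by blast
  qed
  define y1 where "y1 = frag_extend (\<lambda>p. if p \<in> T then 0 else frag_of p) y"
  define y2 where "y2 = frag_extend (\<lambda>p. if p \<in> T then frag_of p else 0) y"
  have "y = frag_extend frag_of y" by (rule frag_expansion)
  also have "\<dots> = y1 + y2"
  proof -
    have "w \<in> frags_on UNIV \<Longrightarrow> frag_extend frag_of w = frag_extend (\<lambda>p. if p \<in> T then 0 else
        frag_of p) w
      + frag_extend (\<lambda>p. if p \<in> T then frag_of p else 0) w" for w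
      by (induction w rule: frags_on_induct) (auto simp: frag_extend_diff)
    then show ?thesis by (simp add: y1_def y2_def frags_on_def)
  qed
  finally have y12: "y = y1 + y2" .
  have k1: "keys y1 \<subseteq> keys y - T"
    unfolding y1_def using keys_frag_extend[of "\<lambda>p. if p \<in> T then 0 else frag_of p" y]
    by (auto split: if_splits)
  have k2: "keys y2 \<subseteq> T"
    unfolding y2_def using keys_frag_extend[of "\<lambda>p. if p \<in> T then frag_of p else 0" y]
    by (auto split: if_splits)
  have free: "y1 \<in> free_module S I" "y2 \<in> free_module S I"
    using y k1 k2 H_carrier by (auto simp: free_module_def T_def)
  have "smul S s y1 = 0"
  proof -
    have 1: "keys (smul S s y1) \<subseteq> UNIV \<times> - translates A"
      using keys_frag_map[of "free_act S s" y1] k1 by (fastforce simp: T_def)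
    have 2: "keys (smul S s y2) \<subseteq> UNIV \<times> translates A"
      using keys_frag_map[of "free_act S s" y2] k2 by (fastforce simp: T_def)
    \<comment> \<open>Termwise the image of \<open>y1\<close> avoids \<open>A H\<close>; as a
      difference it is supported on \<open>A H\<close>. Hence it vanishes, although
      \<open>y1\<close> need not.\<close>
    have "smul S s y1 = smul S s y - smul S s y2"
      by (simp add: y12 frag_map_add)
    then have "keys (smul S s y1) \<subseteq> UNIV \<times> translates A"
      using keys_diff[of "smul S s y" "smul S s y2"] 2 supp
      by auto
    with 1 have "keys (smul S s y1) = {}" by blast
    then show ?thesis by simp
  qed
  then have s1: "smul S s (annihilate S fs y1) = 0"
    by (rule annihilate_killed[OF E s free(1)])
  have "annihilate S fs y2 = 0"
  proof -
    have "y2 \<in> frags_on T" using k2 by (simp add: frags_on_def)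
    then show ?thesis
    proof (induction y2 rule: frags_on_induct)
      case (one p)
      obtain j h where p: "p = (j, h)" by (cases p)
      have h: "h \<in> H" "h \<in> carrier S" using one kH[of p] H_carrier by (auto simp: p T_def)
      have "h \<otimes> sg_inv S h \<in> set fs" using one by (force simp: fs p)
      then show ?case using one y sg_inv(2)[OF h(2)] h
        by (intro annihilate_fixed[OF E, of "h \<otimes> sg_inv S h" _ UNIV]) (auto simp: p)
    qed (auto simp: annihilate_0 annihilate_diff)
  qed
  then have "annihilate S fs y = annihilate S fs y1"
    using annihilate_diff[of S fs y y2] y12 by simp
  then show ?thesis using s1 E ak by (intro exI[of _ fs]) simp
qed

text \<open>Each factor \<open>1 - f\<close> subtracts a term \<open>s f v\<close>. Writing
  \<open>s f = a k\<close> with \<open>k\<close> in \<open>H\<close> turns it into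
  \<open>a (k v)\<close>, and \<open>k v\<close> stays in \<open>L\<close>.\<close>

lemma annihilate_remainder:
  assumes L: "gmodule HM (free_act S) L" "L \<subseteq> free_module S I" and s: "s \<in> carrier S" and A: "A \<subseteq>
      carrier S"
    and fs: "set fs \<subseteq> idempotents S" "\<forall>f\<in>set fs. \<exists>a\<in>A. \<exists>k\<in>H. s \<otimes> f = a \<otimes> k" and u: "u \<in> L"
  shows "smul S s u - smul S s (annihilate S fs u) \<in> induced S A L"
  using fs
proof (induction fs)
  case Nil
  then show ?case by (simp add: induced.zero)
next
  case (Cons f fs)
  define v where "v = annihilate S fs u"
  have "set fs \<subseteq> H" using Cons.prems H_idem by auto
  then have v: "v \<in> L" unfolding v_def using sub.annihilate_closed[of L fs u] L(1) u by (simp add: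
      annihilate_HM)
  have IH: "smul S s u - smul S s v \<in> induced S A L"
    using Cons unfolding v_def by simp
  obtain a k where ak: "a \<in> A" "k \<in> H" "s \<otimes> f = a \<otimes> k" using Cons.prems by auto
  have f: "f \<in> carrier S" using Cons.prems by (auto simp: idempotents_def)
  have "smul S s (smul S f v) = smul S a (smul S k v)"
    using free_act_mult[OF s f, of v I] free_act_mult[of a k v I] ak A v L(2) H_carrier by auto
  also have "\<dots> \<in> induced S A L"
    using gmoduleD(3)[OF L(1), of k v] ak v by (intro induced.gen) auto
  finally have "(smul S s u - smul S s v)
      + smul S s (smul S f v) \<in> induced S A L"
    by (rule induced_add[OF IH])
  then show ?case
    unfolding annihilate.simps v_def[symmetric] frag_map_diff by (simp only: diff_diff_eq2
        diff_add_eq)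
qed

lemma induced_support:
  assumes "x \<in> induced S A L" "L \<subseteq> free_module HM I"
  shows "keys x \<subseteq> UNIV \<times> translates A"
  using assms(1)
proof induction
  case (gen s l)
  then show ?case using keys_frag_map[of "free_act S s" l] assms(2) by (fastforce simp:
      free_module_def)
next
  case (diff x y)
  then show ?case using keys_diff[of x y] by blast
qed simp

text \<open>Cut \<open>s\<close> until it kills \<open>l\<close>: then \<open>s l\<close> consists
  of what has been cut off.\<close>

lemma induced_eliminate:
  assumes L: "gmodule HM (free_act S) L" "L \<subseteq> free_module HM I" and "s \<in> carrier S" "A \<subseteq> carrier
      S" "l \<in> L"
    and "keys (smul S s l) \<subseteq> UNIV \<times> translates A"
  shows "smul S s l \<in> induced S A L"
proof -
  obtain fs where fs: "set fs \<subseteq> idempotents S" "\<forall>f\<in>set fs. \<exists>a\<in>A. \<exists>k\<in>H. s \<otimes> f = a \<otimes> k"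
    "smul S s (annihilate S fs l) = 0"
    using ex_annihilating_idempotents[OF assms(3,4) _ assms(6)] assms(5) L(2) by blast
  show ?thesis
    using annihilate_remainder[OF L(1) _ assms(3,4) fs(1,2) assms(5)] L(2) free_HM_subset fs(3) by
        force
qed

text \<open>An element supported on \<open>H\<close> is supported on the translate of
  \<open>H\<close> by the identity. Write it as a sum of translates and remove those by
  \<open>s \<noteq> 1\<close> one at a time: \<open>s l\<close> is supported on the remaining
  translates of \<open>H\<close>, so it is already a combination of translates of \<open>L\<close>
  by the remaining elements. At the end only the identity is left.\<close>

lemma induced_faithful:
  assumes L: "gmodule HM (free_act S) L" "L \<subseteq> free_module HM I"
    and v: "v \<in> free_module HM I" "v \<in> induced S (carrier S) L"
  shows "v \<in> L"
proof -
  obtain B where B: "finite B" "B \<subseteq> carrier S" "v \<in> induced S B L"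
    using induced_finite_support[OF v(2)] by blast
  have "v \<in> induced S (insert \<one> B) L" using induced_mono[of B "insert \<one> B" L L S] B(3) by blast
  with B(1,2) have "v \<in> induced S {\<one>} L"
  proof (induction B rule: finite_induct)
    case (insert s A)
    have A: "insert \<one> A \<subseteq> carrier S" using insert.prems by auto
    have "v \<in> induced S (insert s (insert \<one> A)) L"
      using insert.prems(2) by (simp add: insert_commute)
    then obtain l y where ly: "l \<in> L" "y \<in> induced S (insert \<one> A) L" "v = smul S s l + y"
      using induced_insert[OF _ gmoduleD(1,2)[OF L(1)]] by metis
    have eq: "smul S s l = v - y" using ly(3) by simp
    have "keys v \<subseteq> UNIV \<times> translates (insert \<one> A)"
    proof
      fix p assume "p \<in> keys v"
      then have "snd p \<in> H" using v(1) by (auto simp: free_module_def)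
      moreover from this have "snd p = \<one> \<otimes> snd p" using H_carrier by simp
      ultimately have "snd p \<in> translates (insert \<one> A)" by blast
      then show "p \<in> UNIV \<times> translates (insert \<one> A)"
        by (simp only: mem_Times_iff UNIV_I)
    qed
    then have "keys (smul S s l) \<subseteq> UNIV \<times> translates (insert \<one> A)"
      unfolding eq using keys_diff[of v y] induced_support[OF ly(2) L(2)] by blast
    then have "smul S s l \<in> induced S (insert \<one> A) L"
      using insert.prems by (intro induced_eliminate[OF L _ A ly(1)]) auto
    then have "v \<in> induced S (insert \<one> A) L" using induced_add ly(2,3) by blast
    then show ?case using insert by simp
  qed auto
  then show ?thesis
  proof induction
    case (gen s l)
    then show ?case using gmoduleD(4)[OF L(1)] by simp
  qed (use gmoduleD(1,2)[OF L(1)] in auto)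
qed

text \<open>Induction on the finite set of elements \<open>s\<close> that occur. In a syzygy
  \<open>s w + y\<close>, the image of \<open>s w\<close> cancels that of \<open>y\<close> and is
  thus supported on the other translates. Cutting \<open>s\<close> replaces \<open>w\<close> by some
  \<open>w0\<close> whose image is killed by \<open>s\<close>, and the difference is absorbed into
  the other translates.\<close>

lemma induced_flat:
  assumes m: "m \<in> I \<rightarrow> free_module HM J"
  shows "syzygies S (free_act S) I m = induced S (carrier S) (syzygies HM (free_act S) I m)"
proof (intro equalityI subsetI)
  let ?K = "syzygies HM (free_act S) I m"
  have m': "m \<in> I \<rightarrow> free_module S J" using m free_HM_subset by blast
  have KF: "?K \<subseteq> free_module HM I" by (auto simp: syzygies_def)
  have lin_dot: "lin (free_act S) m (smul S s w) = smul S s (lin (free_act S) m w)"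
    if "s \<in> carrier S" "w \<in> free_module S I" for s w
    by (rule ghomD(2)[OF ghom_lin[OF gmodule_free m'] that])
  { fix x assume "x \<in> induced S (carrier S) ?K"
    then show "x \<in> syzygies S (free_act S) I m"
    proof induction
      case (gen s l)
      then have "l \<in> free_module S I" "lin (free_act S) m l = 0"
        using free_HM_subset by (auto simp: syzygies_def)
      then show ?case using lin_dot gen(1) free_act_closed by (auto simp: syzygies_def)
    qed (auto simp: syzygies_def lin_diff intro: free_moduleD) }
  have lin_HM: "lin (free_act S) m w \<in> free_module HM J" if "w \<in> free_module HM I" for w
    using sub.lin_closed[OF sub.gmodule_free m that] by simp
  have lin_ann: "lin (free_act S) m (annihilate S fs w) = annihilate S fs (lin (free_act S) m w)"
    if "set fs \<subseteq> carrier S" "w \<in> free_module S I" for fs w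
    using that(1)
  proof (induction fs)
    case (Cons f fs)
    then have "annihilate S fs w \<in> free_module S I"
      using annihilate_closed[OF gmodule_free _ that(2), of fs] by simp
    then show ?case using Cons lin_dot by (simp add: lin_diff)
  qed simp
  have main: "u \<in> induced S (carrier S) ?K"
    if "finite B" "B \<subseteq> carrier S" "u \<in> induced S B (free_module HM I)" "lin (free_act S) m u = 0"
        for B u
    using that
  proof (induction B arbitrary: u rule: finite_induct)
    case empty
    from empty(2) have "u = 0" by induction auto
    then show ?case by (simp add: induced.zero)
  next
    case (insert s A)
    have s: "s \<in> carrier S" and A: "A \<subseteq> carrier S" using insert.prems by auto
    note F = gmoduleD(1,2)[OF sub.gmodule_free]
    obtain w y where wy: "w \<in> free_module HM I" "y \<in> induced S A (free_module HM I)"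
      "u = smul S s w + y"
      using induced_insert[OF insert.prems(2) F] by metis
    have wG: "w \<in> free_module S I" using wy(1) free_HM_subset by blast
    have "lin (free_act S) m y \<in> induced S A (free_module HM J)"
      using wy(2)
    proof induction
      case (gen t l)
      then have "lin (free_act S) m (smul S t l) = smul S t (lin (free_act S) m l)"
        using A free_HM_subset by (intro lin_dot) auto
      then show ?case using gen lin_HM by (simp add: induced.gen)
    qed (auto simp: lin_diff intro: induced.intros)
    then have "keys (lin (free_act S) m y) \<subseteq> UNIV \<times> translates A"
      by (rule induced_support[OF _ subset_refl])
    moreover have "smul S s (lin (free_act S) m w) = - lin (free_act S) m y"
      using insert.prems(3) unfolding wy(3) lin_add lin_dot[OF s wG] by (simp add:
          eq_neg_iff_add_eq_0)
    ultimately obtain fs where fs: "set fs \<subseteq> idempotents S" "\<forall>f\<in>set fs. \<exists>a\<in>A. \<exists>k\<in>H. s \<otimes> f = a \<otimes> k"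
      "smul S s (annihilate S fs (lin (free_act S) m w)) = 0"
      using ex_annihilating_idempotents[OF s A lin_HM[OF wy(1)]] by (auto simp: keys_minus)
    define w0 where "w0 = annihilate S fs w"
    have fsH: "set fs \<subseteq> H" "set fs \<subseteq> carrier S" using fs(1) H_idem H_carrier by auto
    have w0: "w0 \<in> free_module HM I" "w0 \<in> free_module S I"
      unfolding w0_def using sub.annihilate_closed[OF sub.gmodule_free _ wy(1), of fs] fsH
          free_HM_subset
      by (auto simp: annihilate_HM)
    have s0: "smul S s (lin (free_act S) m w0) = 0"
      unfolding w0_def lin_ann[OF fsH(2) wG] by (rule fs(3))
    \<comment> \<open>The image of \<open>w0\<close> is killed by \<open>s\<close> but need not be
      zero. Multiplying by \<open>s^{-1} s\<close>, which lies in \<open>H\<close>, makes it zero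
      and leaves \<open>s w0\<close> unchanged, so \<open>w1\<close> is a syzygy over
      \<open>H\<close>.\<close>
    define w1 where "w1 = smul S (sg_inv S s \<otimes> s) w0"
    have s's: "sg_inv S s \<otimes> s \<in> H" "sg_inv S s \<otimes> s \<in> carrier S" "sg_inv S s \<in> carrier S"
      using idem_sg_inv(2)[OF s] H_idem H_carrier sg_inv(1)[OF s] by auto
    have w1H: "w1 \<in> free_module HM I"
      unfolding w1_def using sub.free_act_closed[of "sg_inv S s \<otimes> s" w0 I] s's w0 by simp
    have "lin (free_act S) m w1 = smul S (sg_inv S s) (smul S s (lin (free_act S) m w0))"
      unfolding w1_def lin_dot[OF s's(2) w0(2)]
      by (rule free_act_mult[OF s's(3) s lin_closed[OF gmodule_free m' w0(2)]])
    then have w1: "w1 \<in> ?K" using s0 w1H by (simp add: syzygies_def)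
    have sw1: "smul S s w1 = smul S s w0"
      unfolding w1_def free_act_mult[OF s s's(2) w0(2), symmetric]
      using sg_inv(2)[OF s] s s's by (simp add: m_assoc)
    define u' where "u' = (smul S s w - smul S s w0) + y"
    have "u' \<in> induced S A (free_module HM I)"
      unfolding u'_def w0_def using sub.gmodule_free[of I]
      by (intro induced_add[OF annihilate_remainder[OF _ free_HM_subset s A fs(1,2) wy(1)] wy(2)])
          simp
    moreover have u: "u = smul S s w1 + u'" unfolding sw1 u'_def wy(3) by simp
    moreover have "lin (free_act S) m (smul S s w1) = 0"
      unfolding sw1 lin_dot[OF s w0(2)] by (rule s0)
    ultimately have "u' \<in> induced S (carrier S) ?K"
      using insert.IH[OF A, of u'] insert.prems(3) by (simp add: lin_add)
    then show ?case unfolding u by (intro induced_add[OF induced.gen[OF s w1]])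
  qed
  fix u assume "u \<in> syzygies S (free_act S) I m"
  then have u: "u \<in> free_module S I" "lin (free_act S) m u = 0" by (auto simp: syzygies_def)
  from u(1) have "u \<in> induced S (carrier S) (free_module HM I)"
  proof (induction u rule: free_module_induct)
    case (one i t)
    have "smul S t (frag_of (i, \<one>)) \<in> induced S (carrier S) (free_module HM I)"
      using one H_one by (intro induced.gen) auto
    then show ?case using one by simp
  qed (auto intro: induced.intros)
  then obtain B where B: "finite B" "B \<subseteq> carrier S" "u \<in> induced S B (free_module HM I)"
    using induced_finite_support by metis
  show "u \<in> induced S (carrier S) ?K" by (rule main[OF B u(2)])
qed

end

section \<open>Descent to the full inverse submonoid\<close>

text \<open>Passing to syzygies lowers the index by one, so only the conditions for all
  \<open>n\<close> together are equivalent. By Schanuel's lemma any finite generating family may be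
  used.\<close>

lemma (in monoid) FP_all_iff_FP_syzygies:
  assumes "gmodule G act M" "generates G act M {..<k::nat} m"
  shows "(\<forall>n. FP G act n M) \<longleftrightarrow> (\<forall>n. FP G (free_act G) n (syzygies G act {..<k} m))"
proof (intro iffI allI)
  fix n assume "\<forall>n. FP G act n M"
  then show "FP G (free_act G) n (syzygies G act {..<k} m)" using FP_syzygies[OF assms(1) _
      assms(2)] by blast
next
  fix n assume "\<forall>n. FP G (free_act G) n (syzygies G act {..<k} m)"
  then show "FP G act n M" using assms(2) by (cases n) (auto simp: FP_0 FP_Suc)
qed

lemma (in monoid) generates_trivial:
  "generates G trivial_act UNIV {..<1::nat} (\<lambda>_. frag_of ())"
proof (rule generatesI)
  fix w :: "unit \<Rightarrow>\<^sub>0 int"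
  have "w \<in> frags_on UNIV" by (simp add: frags_on_def)
  then show "\<exists>u\<in>Free 1. w = lin trivial_act (\<lambda>_. frag_of ()) u"
  proof (induction w rule: frags_on_induct)
    case zero
    show ?case by (rule bexI[of _ 0]) auto
  next
    case (one z)
    show ?case by (rule bexI[of _ "frag_of (0, \<one>)"]) auto
  next
    case (diff u v)
    then show ?case using free_moduleD(1) lin_diff by metis
  qed
qed auto

lemma (in monoid) gmodule_trivial: "gmodule G trivial_act UNIV"
  unfolding gmodule_def by (auto simp: frag_map_frag_map intro: frag_map_ident)

lemma induced_finite_generators:
  assumes "x \<in> induced G A L"
  shows "\<exists>U. finite U \<and> U \<subseteq> L \<and> x \<in> induced G A U"
  using assms
proof induction
  case zero
  then show ?case by (intro exI[of _ "{}"]) (auto intro: induced.zero)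
next
  case (gen s l)
  then show ?case by (intro exI[of _ "{l}"]) (auto intro: induced.gen)
next
  case (diff x y)
  then obtain B C where "finite B" "B \<subseteq> L" "x \<in> induced G A B" "finite C" "C \<subseteq> L" "y \<in> induced G A
      C"
    by blast
  then show ?case
    using induced_mono[of A A B "B \<union> C" G] induced_mono[of A A C "B \<union> C" G]
    by (intro exI[of _ "B \<union> C"]) (auto intro: induced.diff)
qed

section \<open>Type FP of induced modules\<close>

context full_inverse_submonoid
begin

lemma free_HM_UNIV: "free_module HM I \<subseteq> free_module HM UNIV"
  by (rule free_module_mono) simp

lemma subset_induced:
  assumes "gmodule HM (free_act S) K"
  shows "K \<subseteq> induced S (carrier S) K"
proof
  fix x assume x: "x \<in> K"
  have "smul S \<one> x = x" using gmoduleD(4)[OF assms x] by simp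
  then show "x \<in> induced S (carrier S) K" using induced.gen[OF one_closed x, of S] by simp
qed

lemma generates_induced:
  assumes K: "gmodule HM (free_act S) K" "K \<subseteq> free_module HM UNIV" and gen: "generates HM
      (free_act S) K I m"
  shows "generates S (free_act S) (induced S (carrier S) K) I m"
proof (rule generatesI)
  have m: "m \<in> I \<rightarrow> free_module S UNIV"
    using generatesD(1)[OF gen] K(2) free_HM_subset by blast
  fix x assume "x \<in> induced S (carrier S) K"
  then show "\<exists>u\<in>free_module S I. x = lin (free_act S) m u"
  proof induction
    case zero
    show ?case by (rule bexI[of _ 0]) auto
  next
    case (gen s l)
    then obtain v where v: "v \<in> free_module HM I" "lin (free_act S) m v = l"
      using generates_surj[OF assms(3)] by blast
    then have "v \<in> free_module S I" using free_HM_subset by blast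
    then show ?case
      using ghomD(2)[OF ghom_lin[OF gmodule_free m] gen(1)] v(2) free_act_closed[OF gen(1)]
      by (intro bexI[of _ "smul S s v"]) auto
  next
    case (diff x y)
    then show ?case using free_moduleD(1) lin_diff by metis
  qed
qed (use generatesD(1)[OF gen] subset_induced[OF K(1)] in blast)

lemma syzygies_HM:
  assumes "gmodule HM (free_act S) K" "generates HM (free_act S) K I m"
  shows "gmodule HM (free_act S) (syzygies HM (free_act S) I m)"
    and "syzygies HM (free_act S) I m \<subseteq> free_module HM UNIV"
proof -
  have "m \<in> I \<rightarrow> K" using generatesD(1)[OF assms(2)] by blast
  from sub.gmodule_syzygies[OF assms(1) this]
  show "gmodule HM (free_act S) (syzygies HM (free_act S) I m)" by simp
  show "syzygies HM (free_act S) I m \<subseteq> free_module HM UNIV"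
    using free_HM_UNIV by (auto simp: syzygies_def)
qed

lemma syzygies_induced:
  assumes "K \<subseteq> free_module HM UNIV" "generates HM (free_act S) K I m"
  shows "syzygies S (free_act S) I m = induced S (carrier S) (syzygies HM (free_act S) I m)"
  using generatesD(1)[OF assms(2)] assms(1) by (intro induced_flat[of _ _ UNIV]) blast

text \<open>Generators remain generators after induction, and by flatness their syzygies are the
  induced ones, which feeds the induction on \<open>n\<close>.\<close>

lemma FP_induced:
  fixes K :: "(nat \<times> 'a \<Rightarrow>\<^sub>0 int) set"
  assumes "gmodule HM (free_act S) K" "K \<subseteq> free_module HM UNIV" "FP HM (free_act S) n K"
  shows "FP S (free_act S) n (induced S (carrier S) K)"
  using assms
proof (induction n arbitrary: K)
  case 0
  then show ?case using generates_induced unfolding FP_0 by blast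
next
  case (Suc n)
  then obtain k m where km: "generates HM (free_act S) K {..<k::nat} m"
    "FP HM (free_act S) n (syzygies HM (free_act S) {..<k} m)" unfolding FP_Suc by auto
  from Suc.IH[OF syzygies_HM[OF Suc.prems(1) km(1)] km(2)]
  show ?case
    unfolding FP_Suc using generates_induced[OF Suc.prems(1,2) km(1)]
      syzygies_induced[OF Suc.prems(2) km(1)] by metis
qed

text \<open>Finitely many generators of the induced module involve only finitely many elements of
  \<open>K\<close>. The submodule \<open>L\<close> over \<open>H\<close> generated by these has an
  induced module containing \<open>K\<close>, and faithfulness gives
  \<open>K \<subseteq> L\<close>.\<close>

lemma FP_descent_0:
  fixes K :: "(nat \<times> 'a \<Rightarrow>\<^sub>0 int) set"
  assumes K: "gmodule HM (free_act S) K" "K \<subseteq> free_module HM UNIV"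
    and "FP S (free_act S) 0 (induced S (carrier S) K)"
  shows "FP HM (free_act S) 0 K"
proof -
  obtain k v where gen: "generates S (free_act S) (induced S (carrier S) K) {..<k::nat} v"
    using assms(3) unfolding FP_0 by blast
  have "\<forall>i\<in>{..<k}. \<exists>U. finite U \<and> U \<subseteq> K \<and> v i \<in> induced S (carrier S) U"
    using generatesD(1)[OF gen] induced_finite_generators by metis
  then obtain U where U: "\<And>i. i < k \<Longrightarrow> finite (U i) \<and> U i \<subseteq> K \<and> v i \<in> induced S (carrier S) (U i)"
    by (metis lessThan_iff)
  define I where "I = (\<Union>i<k. U i)"
  have I: "finite I" "I \<subseteq> K" using U by (auto simp: I_def)
  \<comment> \<open>The finitely many elements of \<open>I\<close> serve as their own
    indices.\<close>
  have idI: "(\<lambda>u. u) \<in> I \<rightarrow> K" using I by auto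
  define L where "L = lin (free_act S) (\<lambda>u. u) ` free_module HM I"
  have "gmodule HM (free_act S) L"
    unfolding L_def using sub.ghom_lin[OF K(1) idI] gmodule_image[OF sub.monoid_axioms
        sub.gmodule_free] by metis
  moreover have LK: "L \<subseteq> K" unfolding L_def using sub.lin_closed[OF K(1) idI] by blast
  moreover have IL: "I \<subseteq> L"
  proof
    fix u assume u: "u \<in> I"
    have "lin (free_act S) (\<lambda>u. u) (frag_of (u, \<one>)) = u" using gmoduleD(4)[OF K(1), of u] u I by
        auto
    moreover have "frag_of (u, \<one>) \<in> free_module HM I" using u H_one by simp
    ultimately show "u \<in> L" unfolding L_def by (metis imageI)
  qed
  moreover have "K \<subseteq> induced S (carrier S) L"
  proof
    fix x assume "x \<in> K"
    then obtain u where u: "u \<in> Free k" "lin (free_act S) v u = x"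
      using generates_surj[OF gen] subset_induced[OF K(1)] by blast
    have LS: "L \<subseteq> free_module S UNIV" using LK K(2) free_HM_subset by blast
    have "v i \<in> induced S (carrier S) L" if "i < k" for i
    proof -
      have "U i \<subseteq> L" using IL that by (auto simp: I_def)
      then show ?thesis using U[OF that] induced_mono[of "carrier S" "carrier S" "U i" L S] by blast
    qed
    then have "v \<in> {..<k} \<rightarrow> induced S (carrier S) L" by auto
    from lin_closed[OF gmodule_induced[OF LS] this u(1)] u(2)
    show "x \<in> induced S (carrier S) L" by simp
  qed
  ultimately have "K \<subseteq> L" using induced_faithful[of L UNIV] K(2) by blast
  then have "generates HM (free_act S) K I (\<lambda>u. u)"
    unfolding generates_def L_def using idI by blast
  from sub.FP_finite_generators[OF I(1) K(1) this, of 0] show ?thesis by simp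
qed

text \<open>Generators have to come from \<open>K\<close> itself for flatness to apply to their
  syzygies, so they are first obtained over \<open>H\<close>. Schanuel's lemma over \<open>S\<close>
  then accepts them in place of the generators that witness the hypothesis.\<close>

lemma FP_descent:
  fixes K :: "(nat \<times> 'a \<Rightarrow>\<^sub>0 int) set"
  assumes "gmodule HM (free_act S) K" "K \<subseteq> free_module HM UNIV"
    and "FP S (free_act S) n (induced S (carrier S) K)"
  shows "FP HM (free_act S) n K"
  using assms
proof (induction n arbitrary: K)
  case 0
  then show ?case using FP_descent_0 by blast
next
  case (Suc n)
  have "FP HM (free_act S) 0 K"
    using FP_descent_0[OF Suc.prems(1,2) FP_imp_finitely_generated[OF Suc.prems(3)]] .
  then obtain k m where km: "generates HM (free_act S) K {..<k::nat} m" unfolding FP_0 by blast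
  have KS: "K \<subseteq> free_module S UNIV" using Suc.prems(2) free_HM_subset by blast
  have "FP S (free_act S) n (induced S (carrier S) (syzygies HM (free_act S) {..<k} m))"
    using FP_syzygies[OF gmodule_induced[OF KS] Suc.prems(3) generates_induced[OF Suc.prems(1,2)
        km]]
    unfolding syzygies_induced[OF Suc.prems(2) km] .
  from Suc.IH[OF syzygies_HM[OF Suc.prems(1) km] this] show ?case
    unfolding FP_Suc using km by auto
qed

lemma FP_induced_iff:
  fixes K :: "(nat \<times> 'a \<Rightarrow>\<^sub>0 int) set"
  assumes "gmodule HM (free_act S) K" "K \<subseteq> free_module HM UNIV"
  shows "FP S (free_act S) n (induced S (carrier S) K) \<longleftrightarrow> FP HM (free_act S) n K"
  using FP_induced[OF assms] FP_descent[OF assms] by blast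

text \<open>The preimage in \<open>S\<close> of the maximum group image of \<open>H\<close>.\<close>

definition saturation :: "'a set" where
  "saturation = {s \<in> carrier S. \<exists>e\<in>idempotents S. s \<otimes> e \<in> H}"

lemma H_saturation: "h \<in> H \<Longrightarrow> h \<in> saturation"
  unfolding saturation_def using one_idem H_carrier by force

lemma saturation_mult:
  assumes "s \<in> saturation" "t \<in> saturation"
  shows "s \<otimes> t \<in> saturation"
proof -
  obtain e f where ef: "s \<in> carrier S" "e \<in> idempotents S" "s \<otimes> e \<in> H"
    "t \<in> carrier S" "f \<in> idempotents S" "t \<otimes> f \<in> H" using assms by (auto simp: saturation_def)
  note c = ef(1,4) idempotentsD(1)[OF ef(2)] idempotentsD(1)[OF ef(5)]
  define k where "k = t \<otimes> f"
  have k: "k \<in> carrier S" "sg_inv S k \<in> carrier S" using c sg_inv(1) by (auto simp: k_def)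
  \<comment> \<open>Chosen so that \<open>k g = e k\<close>: the idempotent \<open>e\<close>
    belonging to \<open>s\<close> is pulled through \<open>k = t f\<close>.\<close>
  define g where "g = sg_inv S k \<otimes> e \<otimes> k"
  have g: "g \<in> idempotents S" "g \<in> carrier S" unfolding g_def using idem_conj(2)[OF k(1) ef(2)]
      idempotentsD by auto
  have "s \<otimes> t \<otimes> (f \<otimes> g) = s \<otimes> (k \<otimes> g)" using c g by (simp add: m_assoc k_def)
  also have "\<dots> = (s \<otimes> e) \<otimes> k" unfolding g_def idem_mult[OF k(1) ef(2), symmetric] using c k by
      (simp add: m_assoc)
  finally have "s \<otimes> t \<otimes> (f \<otimes> g) \<in> H" using H_mult[OF ef(3,6)] by (simp add: k_def)
  then show ?thesis using idem_prod[OF ef(5) g(1)] c by (auto simp: saturation_def)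
qed

lemma saturation_inv:
  assumes "s \<in> saturation"
  shows "sg_inv S s \<in> saturation"
proof -
  obtain e where e: "s \<in> carrier S" "e \<in> idempotents S" "s \<otimes> e \<in> H" using assms by (auto simp:
      saturation_def)
  have s': "sg_inv S s \<in> carrier S" using sg_inv(1) e by blast
  have "e \<otimes> sg_inv S s \<in> H"
    using H_inv[OF e(3)] sg_inv_mult[OF e(1) idempotentsD(1)[OF e(2)]] sg_inv_idem[OF e(2)] by simp
  then have "sg_inv S s \<otimes> (s \<otimes> e \<otimes> sg_inv S s) \<in> H"
    using idem_mult[OF s' e(2)] sg_inv_sg_inv[OF e(1)] by simp
  then show ?thesis using idem_conj(1)[OF e(1,2)] s' by (auto simp: saturation_def)
qed

lemma saturation_mult_idem:
  assumes "s \<in> carrier S" "g \<in> idempotents S"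
  shows "s \<otimes> g \<in> saturation \<longleftrightarrow> s \<in> saturation"
proof
  note c = assms(1) idempotentsD(1)[OF assms(2)]
  { assume "s \<otimes> g \<in> saturation"
    then obtain e where e: "e \<in> idempotents S" "s \<otimes> g \<otimes> e \<in> H" by (auto simp: saturation_def)
    then show "s \<in> saturation"
      using idem_prod[OF assms(2) e(1)] c idempotentsD(1)[OF e(1)] by (auto simp: saturation_def
          m_assoc) }
  assume "s \<in> saturation"
  then show "s \<otimes> g \<in> saturation" using saturation_mult H_saturation H_idem assms(2) by blast
qed

text \<open>Idempotents become trivial in the maximum group image. In the coset computations,
  factors such as \<open>t t^{-1}\<close> inside a product may therefore be dropped as in a
  group.\<close>

lemma saturation_idem_middle:
  assumes "a \<in> carrier S" "b \<in> carrier S" "e \<in> idempotents S"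
  shows "a \<otimes> (e \<otimes> b) \<in> saturation \<longleftrightarrow> a \<otimes> b \<in> saturation"
proof -
  have "sg_inv S b \<otimes> e \<otimes> b \<in> idempotents S" by (rule idem_conj(2)[OF assms(2,3)])
  moreover have "a \<otimes> (e \<otimes> b) = a \<otimes> b \<otimes> (sg_inv S b \<otimes> e \<otimes> b)"
    unfolding idem_mult[OF assms(2,3)]
    using assms idempotentsD(1)[OF assms(3)] sg_inv(1)[OF assms(2)] by (simp add: m_assoc)
  ultimately show ?thesis using saturation_mult_idem[of "a \<otimes> b"] assms by simp
qed

text \<open>The preimage in \<open>S\<close> of a left coset of the image of \<open>H\<close> in the
  maximum group image.\<close>

definition coset :: "'a \<Rightarrow> 'a set" where
  "coset t = {s \<in> carrier S. sg_inv S t \<otimes> s \<in> saturation}"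

lemma saturation_trans:
  assumes "s \<in> carrier S" "t \<in> carrier S" "u \<in> carrier S"
    "sg_inv S s \<otimes> t \<in> saturation" "sg_inv S t \<otimes> u \<in> saturation"
  shows "sg_inv S s \<otimes> u \<in> saturation"
proof -
  note c = assms(1-3) sg_inv(1)[OF assms(1)] sg_inv(1)[OF assms(2)]
  have "sg_inv S s \<otimes> t \<otimes> (sg_inv S t \<otimes> u) = sg_inv S s \<otimes> ((t \<otimes> sg_inv S t) \<otimes> u)"
    using c by (simp add: m_assoc)
  then show ?thesis
    using saturation_mult[OF assms(4,5)] saturation_idem_middle[OF c(4,3) idem_sg_inv(1)[OF c(2)]]
        by simp
qed

lemma saturation_sym:
  assumes "s \<in> carrier S" "t \<in> carrier S" "sg_inv S s \<otimes> t \<in> saturation"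
  shows "sg_inv S t \<otimes> s \<in> saturation"
  using saturation_inv[OF assms(3)] sg_inv_mult[of "sg_inv S s" t] sg_inv(1)[OF assms(1)]
      sg_inv_sg_inv[OF assms(1)]
    assms(2) by simp

lemma coset_self: "t \<in> carrier S \<Longrightarrow> t \<in> coset t"
  unfolding coset_def using H_saturation[OF H_idem[OF idem_sg_inv(2)]] by simp

lemma coset_eq_iff:
  assumes "s \<in> carrier S" "t \<in> carrier S"
  shows "coset s = coset t \<longleftrightarrow> sg_inv S s \<otimes> t \<in> saturation"
proof
  assume "coset s = coset t"
  then show "sg_inv S s \<otimes> t \<in> saturation" using coset_self[OF assms(2)] by (auto simp: coset_def)
next
  assume st: "sg_inv S s \<otimes> t \<in> saturation"
  show "coset s = coset t"
    using saturation_trans[OF assms(2,1) _ saturation_sym[OF assms st]] saturation_trans[OF assms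
        _ st]
    by (auto simp: coset_def)
qed

text \<open>One direction makes left multiplication well defined on cosets, the other makes it
  injective there.\<close>

lemma coset_mult_eq_iff:
  assumes "u \<in> carrier S" "s \<in> carrier S" "t \<in> carrier S"
  shows "coset (u \<otimes> s) = coset (u \<otimes> t) \<longleftrightarrow> coset s = coset t"
proof -
  note c = assms sg_inv(1)[OF assms(1)] sg_inv(1)[OF assms(2)]
  have "sg_inv S (u \<otimes> s) \<otimes> (u \<otimes> t) = sg_inv S s \<otimes> ((sg_inv S u \<otimes> u) \<otimes> t)"
    using c by (simp add: sg_inv_mult m_assoc)
  then show ?thesis
    using coset_eq_iff[of "u \<otimes> s" "u \<otimes> t"] coset_eq_iff[of s t]
      saturation_idem_middle[OF c(5,3) idem_sg_inv(2)[OF c(1)]] c by simp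
qed

definition coset_act :: "'a \<Rightarrow> 'a set \<Rightarrow> 'a set" where
  "coset_act s C = (\<Union>t\<in>C. coset (s \<otimes> t))"

lemma coset_act_coset:
  assumes "s \<in> carrier S" "t \<in> carrier S"
  shows "coset_act s (coset t) = coset (s \<otimes> t)"
proof -
  have "coset (s \<otimes> u) = coset (s \<otimes> t)" if "u \<in> coset t" for u
    using that assms coset_mult_eq_iff[of s u t] coset_eq_iff[of t u] by (auto simp: coset_def)
  then show ?thesis unfolding coset_act_def using coset_self[OF assms(2)] by blast
qed

section \<open>Comparison with the maximum group image\<close>

lemma sigma_refl: "a \<in> carrier S \<Longrightarrow> (a, a) \<in> sigma S"
  unfolding sigma_def using one_idem by auto

lemma sigma_sym: "(a, b) \<in> sigma S \<Longrightarrow> (b, a) \<in> sigma S"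
  unfolding sigma_def by (auto intro: sym)

lemma sigma_trans:
  assumes "(a, b) \<in> sigma S" "(b, c) \<in> sigma S"
  shows "(a, c) \<in> sigma S"
proof -
  obtain e f where ef: "a \<in> carrier S" "b \<in> carrier S" "c \<in> carrier S" "e \<in> idempotents S" "f \<in>
      idempotents S"
    "a \<otimes> e = b \<otimes> e" "b \<otimes> f = c \<otimes> f" using assms by (auto simp: sigma_def)
  note i = idempotentsD(1)[OF ef(4)] idempotentsD(1)[OF ef(5)]
  have "a \<otimes> (e \<otimes> f) = b \<otimes> e \<otimes> f" using ef i by (simp add: m_assoc[symmetric])
  also have "\<dots> = b \<otimes> f \<otimes> e" using ef(1-3) i idem_commute[OF ef(4,5)] by (simp add: m_assoc)
  also have "\<dots> = c \<otimes> (e \<otimes> f)" using ef(1-3) i idem_commute[OF ef(4,5)] unfolding ef(7) by (simp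
      add: m_assoc)
  finally show ?thesis using ef idem_prod[OF ef(4,5)] by (auto simp: sigma_def)
qed

text \<open>With \<open>g = d^{-1} e d\<close> one has \<open>d g = e d\<close>, so the idempotent
  \<open>f g\<close> equalizes \<open>a c\<close> and \<open>b d\<close>.\<close>

lemma sigma_mult:
  assumes "(a, b) \<in> sigma S" "(c, d) \<in> sigma S"
  shows "(a \<otimes> c, b \<otimes> d) \<in> sigma S"
proof -
  obtain e f where ef: "a \<in> carrier S" "b \<in> carrier S" "c \<in> carrier S" "d \<in> carrier S"
    "e \<in> idempotents S" "f \<in> idempotents S"
    "a \<otimes> e = b \<otimes> e" "c \<otimes> f = d \<otimes> f" using assms by (auto simp: sigma_def)
  note i = idempotentsD(1)[OF ef(5)] idempotentsD(1)[OF ef(6)]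
  define g where "g = sg_inv S d \<otimes> e \<otimes> d"
  have g: "g \<in> idempotents S" "g \<in> carrier S" unfolding g_def using idem_conj(2)[OF ef(4,5)]
      idempotentsD by auto
  have dg: "d \<otimes> g = e \<otimes> d" unfolding g_def using idem_mult[OF ef(4,5)] by simp
  have fg: "f \<otimes> g = g \<otimes> f" by (rule idem_commute[OF ef(6) g(1)])
  have "a \<otimes> c \<otimes> (f \<otimes> g) = a \<otimes> (c \<otimes> f) \<otimes> g" using ef(1-4) i g by (simp add: m_assoc)
  also have "\<dots> = a \<otimes> (d \<otimes> g) \<otimes> f" unfolding ef(8) using ef(1-4) i g fg by (simp add: m_assoc)
  also have "\<dots> = (a \<otimes> e) \<otimes> d \<otimes> f" unfolding dg using ef(1-4) i by (simp add: m_assoc)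
  also have "\<dots> = b \<otimes> (e \<otimes> d) \<otimes> f" unfolding ef(7) using ef(1-4) i by (simp add: m_assoc)
  also have "\<dots> = b \<otimes> d \<otimes> (f \<otimes> g)" unfolding dg[symmetric] using ef(1-4) i g fg by (simp add:
      m_assoc)
  finally show ?thesis using ef idem_prod[OF ef(6) g(1)] by (auto simp: sigma_def)
qed

lemma sigma_class_eq: "(a, b) \<in> sigma S \<Longrightarrow> sigma S `` {a} = sigma S `` {b}"
  using sigma_trans sigma_sym by blast

lemma max_group_image_mult:
  assumes "a \<in> carrier S" "b \<in> carrier S"
  shows "sigma S `` {a} \<otimes>\<^bsub>max_group_image S\<^esub> sigma S `` {b} = sigma S `` {a \<otimes> b}"
proof -
  have "sigma S `` {a' \<otimes> b'} = sigma S `` {a \<otimes> b}" if "(a, a') \<in> sigma S" "(b, b') \<in> sigma S" for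
      a' b'
    using sigma_class_eq[OF sigma_mult[OF that]] by simp
  then have "(\<Union>a'\<in>sigma S `` {a}. \<Union>b'\<in>sigma S `` {b}. sigma S `` {a' \<otimes> b'})
      = (\<Union>a'\<in>sigma S `` {a}. \<Union>b'\<in>sigma S `` {b}. sigma S `` {a \<otimes> b})"
    by (intro SUP_cong refl) auto
  also have "\<dots> = sigma S `` {a \<otimes> b}"
    using sigma_refl[OF assms(1)] sigma_refl[OF assms(2)] by blast
  finally show ?thesis by (simp add: max_group_image_def)
qed

lemma induced_group_hom_image:
  "induced_group_hom S ` carrier (max_group_image HM) = (\<lambda>h. sigma S `` {h}) ` H"
proof -
  have sub: "sigma HM \<subseteq> sigma S"
    using H_carrier unfolding sigma_def idempotents_def by auto
  have "sigma S `` (sigma HM `` {h}) = sigma S `` {h}" if h: "h \<in> H" for h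
  proof -
    have "(h, h) \<in> sigma HM"
      unfolding sigma_def idempotents_def using h H_one H_carrier by force
    then show ?thesis using sub sigma_trans by blast
  qed
  moreover have "carrier (max_group_image HM) = (\<lambda>h. sigma HM `` {h}) ` H"
    unfolding max_group_image_def by (auto simp: quotient_def)
  ultimately show ?thesis by (simp add: induced_group_hom_def image_image)
qed

text \<open>\<open>finite_index\<close> counts right cosets, while \<open>coset\<close> describes
  left ones. Inversion interchanges them, which is why \<open>F\<close> uses the class of
  \<open>t^{-1}\<close>; it suffices that \<open>F t\<close> determines the coset of
  \<open>t\<close>.\<close>

lemma finite_cosets:
  assumes "finite_index H S"
  shows "finite (coset ` carrier S)"
proof -
  define N where "N = (\<lambda>h. sigma S `` {h}) ` H"
  define F where "F = (\<lambda>t. N #>\<^bsub>max_group_image S\<^esub> (sigma S `` {sg_inv S t}))"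
  have "finite (rcosets\<^bsub>max_group_image S\<^esub> N)"
    using assms unfolding finite_index_def induced_group_hom_image N_def .
  moreover have "F ` carrier S \<subseteq> rcosets\<^bsub>max_group_image S\<^esub> N"
    unfolding F_def RCOSETS_def max_group_image_def using sg_inv(1) by (auto intro: quotientI)
  ultimately have fin: "finite (F ` carrier S)" by (rule rev_finite_subset)
  have inj: "coset s = coset t" if st: "s \<in> carrier S" "t \<in> carrier S" "F s = F t" for s t
  proof -
    have c: "sg_inv S s \<in> carrier S" "sg_inv S t \<in> carrier S" using st sg_inv(1) by auto
    have "sigma S `` {\<one>} \<in> N" using H_one by (auto simp: N_def)
    then have "sigma S `` {sg_inv S s} \<in> F s"
      unfolding F_def r_coset_def using max_group_image_mult[OF one_closed c(1)] c(1) by force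
    then obtain h where h: "h \<in> H" "sigma S `` {sg_inv S s} = sigma S `` {h} \<otimes>\<^bsub>max_group_image S\<^esub>
        sigma S `` {sg_inv S t}"
      unfolding st(3) unfolding F_def r_coset_def N_def by auto
    then have "sigma S `` {sg_inv S s} = sigma S `` {h \<otimes> sg_inv S t}"
      using max_group_image_mult c(2) H_carrier by simp
    then have "(h \<otimes> sg_inv S t, sg_inv S s) \<in> sigma S" using sigma_refl[OF c(1)] by blast
    then obtain e where e: "e \<in> idempotents S" "h \<otimes> sg_inv S t \<otimes> e = sg_inv S s \<otimes> e"
      by (auto simp: sigma_def)
    note ee = idempotentsD(1)[OF e(1)]
    \<comment> \<open>The relation \<open>s^{-1} e = h t^{-1} e\<close>, multiplied by
      \<open>t\<close>, has the idempotent \<open>t^{-1} e t\<close> as last factor on the right, so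
      the product stays in \<open>H\<close>.\<close>
    have "sg_inv S s \<otimes> (e \<otimes> t) = h \<otimes> (sg_inv S t \<otimes> e \<otimes> t)"
      using e(2) c ee st(2) H_carrier[OF h(1)] by (metis m_assoc m_closed)
    also have "\<dots> \<in> H" using H_mult[OF h(1) H_idem[OF idem_conj(2)[OF st(2) e(1)]]] .
    finally have "sg_inv S s \<otimes> t \<in> saturation"
      using saturation_idem_middle[OF c(1) st(2) e(1)] H_saturation by blast
    then show ?thesis using coset_eq_iff st by blast
  qed
  have "coset ` carrier S = (\<lambda>C. coset (inv_into (carrier S) F C)) ` F ` carrier S"
  proof -
    have "coset (inv_into (carrier S) F (F t)) = coset t" if "t \<in> carrier S" for t
      using that by (intro inj) (auto simp: inv_into_into f_inv_into_f)
    then show ?thesis by (simp add: image_image)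
  qed
  then show ?thesis using fin by simp
qed

lemma finite_permutation_action_cosets:
  assumes "finite_index H S"
  shows "finite_permutation_action S (coset ` carrier S) coset_act"
proof (unfold_locales)
  show "finite (coset ` carrier S)" by (rule finite_cosets[OF assms])
qed (auto simp: coset_act_coset coset_mult_eq_iff m_assoc)

section \<open>The permutation module as an induced trivial module\<close>

abbreviation augmentation_ideal :: "(nat \<times> 'a \<Rightarrow>\<^sub>0 int) set" where
  "augmentation_ideal \<equiv> syzygies HM trivial_act {..<1} (\<lambda>_. frag_of ())"

lemma diff_in_augmentation_ideal:
  assumes "h \<in> H" "k \<in> H"
  shows "frag_of (0, h) - frag_of (0, k) \<in> augmentation_ideal"
  using assms sub.free_moduleD(1)[of "frag_of (0, h)" "{..<1::nat}" "frag_of (0, k)"]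
  by (simp add: syzygies_def lin_diff)

text \<open>If \<open>t g = s h\<close> with \<open>g\<close> and \<open>h\<close> in
  \<open>H\<close>, then \<open>s - t = s (1 - h) - t (1 - g)\<close>. Such \<open>g\<close> and
  \<open>h\<close> exist for elements of one coset.\<close>

lemma same_coset_diff:
  assumes "s \<in> carrier S" "t \<in> carrier S" "coset s = coset t"
  shows "frag_of (0, s) - frag_of (0, t) \<in> induced S (carrier S) augmentation_ideal"
proof -
  obtain e where e: "e \<in> idempotents S" "sg_inv S s \<otimes> t \<otimes> e \<in> H"
    using coset_eq_iff[OF assms(1,2)] assms(3) by (auto simp: saturation_def)
  note c = assms(1,2) sg_inv(1)[OF assms(1)] sg_inv(1)[OF assms(2)] idempotentsD(1)[OF e(1)]
  define h where "h = sg_inv S s \<otimes> t \<otimes> e"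
  \<comment> \<open>Taken so that \<open>t f = s s^{-1} t\<close>; then \<open>t f e = s h\<close>
    with \<open>h = s^{-1} t e\<close>.\<close>
  define f where "f = sg_inv S t \<otimes> (s \<otimes> sg_inv S s) \<otimes> t"
  have f: "f \<in> idempotents S" unfolding f_def by (rule idem_conj(2)[OF c(2) idem_sg_inv(1)[OF
      c(1)]])
  define g where "g = f \<otimes> e"
  have gH: "g \<in> H" unfolding g_def using H_idem[OF idem_prod[OF f e(1)]] .
  have "t \<otimes> g = (t \<otimes> f) \<otimes> e" unfolding g_def using c idempotentsD(1)[OF f] by (simp add: m_assoc)
  also have "t \<otimes> f = (s \<otimes> sg_inv S s) \<otimes> t"
    unfolding f_def using idem_mult[OF c(2) idem_sg_inv(1)[OF c(1)]] by simp
  also have "(s \<otimes> sg_inv S s) \<otimes> t \<otimes> e = s \<otimes> h" unfolding h_def using c by (simp add: m_assoc)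
  finally have eq: "t \<otimes> g = s \<otimes> h" .
  have "smul S s (frag_of (0, \<one>) - frag_of (0, h)) - smul S t (frag_of (0, \<one>) - frag_of (0, g))
      \<in> induced S (carrier S) augmentation_ideal"
    using diff_in_augmentation_ideal H_one gH e(2) c(1,2) unfolding h_def
    by (intro induced.diff induced.gen) auto
  then show ?thesis using c(1,2) by (simp add: frag_map_diff eq)
qed

text \<open>This is the isomorphism of the induced trivial module with \<int>X, stated for the
  kernels of the two surjections from \<int>S. Modulo the induced augmentation ideal, every basis
  element equals the chosen representative of its coset; conversely \<open>H\<close> fixes the coset
  of the identity.\<close>

lemma syzygies_cosets:
  assumes "finite_index H S"
  shows "syzygies S coset_act {..<1::nat} (\<lambda>_. frag_of (coset \<one>)) = induced S (carrier S)
      augmentation_ideal"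
proof (intro equalityI subsetI)
  interpret P: finite_permutation_action S "coset ` carrier S" coset_act
    by (rule finite_permutation_action_cosets[OF assms])
  let ?m = "\<lambda>_ :: nat. frag_of (coset \<one>)"
  have m: "?m \<in> {..<1} \<rightarrow> frags_on (coset ` carrier S)" by simp
  { fix u assume "u \<in> syzygies S coset_act {..<1} ?m"
    then have u: "u \<in> Free 1" "lin coset_act ?m u = 0" by (auto simp: syzygies_def)
    define r where "r = (\<lambda>C. (0 :: nat, inv_into (carrier S) coset C))"
    \<comment> \<open>Stated for all \<open>u\<close> rather than for the kernel, so that induction
      over \<open>u\<close> applies. The subtracted term disappears once
      \<open>lin coset_act ?m u = 0\<close>.\<close>
    from u(1) have "u - frag_map r (lin coset_act ?m u) \<in> induced S (carrier S) augmentation_ideal"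
    proof (induction u rule: free_module_induct)
      case zero
      show ?case by (simp add: induced.zero)
    next
      case (one i t)
      then have t: "coset t \<in> coset ` carrier S" by simp
      then have "frag_of (0, t) - frag_of (r (coset t)) \<in> induced S (carrier S) augmentation_ideal"
        using one unfolding r_def
        by (intro same_coset_diff) (auto intro: inv_into_into simp: f_inv_into_f[OF t])
      then show ?case using one coset_act_coset[OF one(2) one_closed] by simp
    next
      case (diff u v)
      have "(u - frag_map r (lin coset_act ?m u)) - (v - frag_map r (lin coset_act ?m v))
          \<in> induced S (carrier S) augmentation_ideal" by (rule induced.diff[OF diff(3,4)])
      then show ?case by (simp add: lin_diff frag_map_diff algebra_simps)
    qed
    then show "u \<in> induced S (carrier S) augmentation_ideal" using u(2) by simp }
  fix u assume "u \<in> induced S (carrier S) augmentation_ideal"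
  then show "u \<in> syzygies S coset_act {..<1} ?m"
  proof induction
    case (gen s w)
    then have w: "w \<in> free_module HM {..<1}" "lin trivial_act (\<lambda>_. frag_of ()) w = 0"
      by (auto simp: syzygies_def)
    have wS: "w \<in> Free 1" using w(1) free_HM_subset by blast
    have "coset h = coset \<one>" if "h \<in> H" for h
      using coset_eq_iff[OF one_closed H_carrier[OF that]] sg_inv_idem[OF one_idem]
          H_saturation[OF that] H_carrier[OF that]
      by simp
    \<comment> \<open>On elements supported on \<open>H\<close> the map to \<int>X is the
      augmentation followed by the inclusion of the coset of the identity.\<close>
    with w(1) have "lin coset_act ?m w = frag_map (\<lambda>_. coset \<one>) (lin trivial_act (\<lambda>_. frag_of ())
        w)"
      by (induction w rule: free_module_induct)
        (auto simp: lin_diff frag_map_diff coset_act_coset[OF _ one_closed] H_carrier)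
    then have "lin coset_act ?m w = 0" using w(2) by simp
    then show ?case
      using ghomD(2)[OF ghom_lin[OF P.gmodule_points m] gen(1) wS] free_act_closed[OF gen(1) wS]
      by (simp add: syzygies_def)
  qed (auto simp: syzygies_def lin_diff intro: free_moduleD)
qed

text \<open>Both \<int>X over \<open>S\<close> and \<int> over \<open>H\<close> are exchanged for
  their first syzygies, because \<open>FP_induced_iff\<close> speaks of submodules of free modules.
  Both exchanges shift the index, hence the quantifier over \<open>n\<close> on each side.\<close>

lemma FP_trivial_iff:
  assumes "finite_index H S"
  shows "(\<forall>n. FP S trivial_act n UNIV) \<longleftrightarrow> (\<forall>n. FP HM trivial_act n UNIV)"
proof -
  interpret P: finite_permutation_action S "coset ` carrier S" coset_act
    by (rule finite_permutation_action_cosets[OF assms])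
  let ?m = "\<lambda>_ :: nat. frag_of (coset \<one>)"
  have gen: "generates S coset_act (frags_on (coset ` carrier S)) {..<1::nat} ?m"
  proof (rule generatesI)
    fix w assume "w \<in> frags_on (coset ` carrier S)"
    then show "\<exists>u\<in>Free 1. w = lin coset_act ?m u"
    proof (induction w rule: frags_on_induct)
      case zero
      show ?case by (rule bexI[of _ 0]) auto
    next
      case (one C)
      then obtain t where "t \<in> carrier S" "C = coset t" by blast
      then show ?case using coset_act_coset[OF _ one_closed] by (intro bexI[of _ "frag_of (0,
          t)"]) auto
    next
      case (diff u v)
      then show ?case using free_moduleD(1) lin_diff by metis
    qed
  qed simp
  have K: "gmodule HM (free_act S) augmentation_ideal" "augmentation_ideal \<subseteq> free_module HM UNIV"
    using sub.gmodule_syzygies[OF sub.gmodule_trivial, of "\<lambda>_. frag_of ()" "{..<1::nat}"]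
        free_HM_UNIV
    by (auto simp: syzygies_def)
  have "(\<forall>n. FP S trivial_act n UNIV) \<longleftrightarrow> (\<forall>n. FP S coset_act n (frags_on (coset ` carrier S)))"
    using P.FP_trivial_iff_FP_permutation one_closed by blast
  also have "\<dots> \<longleftrightarrow> (\<forall>n. FP S (free_act S) n (induced S (carrier S) augmentation_ideal))"
    unfolding FP_all_iff_FP_syzygies[OF P.gmodule_points gen] syzygies_cosets[OF assms] ..
  also have "\<dots> \<longleftrightarrow> (\<forall>n. FP HM (free_act S) n augmentation_ideal)"
    using FP_induced_iff[OF K] by blast
  also have "\<dots> \<longleftrightarrow> (\<forall>n. FP HM trivial_act n UNIV)"
    using sub.FP_all_iff_FP_syzygies[OF sub.gmodule_trivial sub.generates_trivial] by simp
  finally show ?thesis .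
qed

end

section \<open>The monoid ring and its free modules\<close>

lemma lookup_frag_map:
  "lookup (frag_map f u) z
    = (\<Sum>y\<in>keys u. if f y = z then lookup u y else 0)"
  unfolding frag_map_def frag_extend_def lookup_sum by (intro sum.cong) auto

lemma sum_coefficients:
  "(\<Sum>x | lookup a x \<noteq> 0. lookup a x) = lookup (frag_map (\<lambda>_. ()) a) ()"
  unfolding lookup_frag_map by (rule sum.cong) (auto simp: in_keys_iff)

text \<open>The extension of the action to the integral monoid ring. For the action by left
  multiplication it is the ring product, so associativity in the ring and the module law are the
  same lemma.\<close>

definition ring_act ::
  "('a \<Rightarrow> 'm \<Rightarrow> 'm) \<Rightarrow> ('a \<Rightarrow>\<^sub>0 int) \<Rightarrow> ('m \<Rightarrow>\<^sub>0 int) \<Rightarrow> 'm \<Rightarrow>\<^sub>0 int" where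
  "ring_act act a u = frag_extend (\<lambda>s. frag_map (act s) u) a"

lemma ring_act_of [simp]: "ring_act act (frag_of s) u = frag_map (act s) u"
  and ring_act_0 [simp]: "ring_act act 0 u = 0"
  and ring_act_diff: "ring_act act (a - b) u = ring_act act a u - ring_act act b u"
  and ring_act_add: "ring_act act (a + b) u = ring_act act a u + ring_act act b u"
  by (simp_all add: ring_act_def frag_extend_diff frag_extend_add)

lemma ring_act_add_right: "ring_act act a (u + v) = ring_act act a u + ring_act act a v"
proof -
  have "a \<in> frags_on UNIV" by (simp add: frags_on_def)
  then show ?thesis
    by (induction a rule: frags_on_induct) (auto simp: ring_act_diff frag_map_add)
qed

lemma ring_act_frags_on:
  assumes "w \<in> frags_on Z" "a \<in> frags_on A" "\<And>s z. s \<in> A \<Longrightarrow> z \<in> Z \<Longrightarrow> act s z \<in> Z"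
  shows "ring_act act a w \<in> frags_on Z"
  using assms(2)
  by (induction a rule: frags_on_induct)
    (use assms(1,3) in \<open>auto simp: ring_act_diff intro: frags_on_diff frag_map_in_frags_on\<close>)

lemma ghom_ring_act:
  assumes "gmodule T act M" "ghom T act act' M \<phi>" "u \<in> M" "a \<in> frags_on (carrier T)"
  shows "ring_act act a u \<in> M" "\<phi> (ring_act act a u) = ring_act act' a (\<phi> u)"
proof -
  have "ring_act act a u \<in> M \<and> \<phi> (ring_act act a u) = ring_act act' a (\<phi> u)"
    using assms(4)
    by (induction a rule: frags_on_induct)
      (use gmoduleD(1-3)[OF assms(1)] ghom_zero[OF assms(2,1)] ghomD[OF assms(2)] assms(3) in
        \<open>auto simp: ring_act_diff\<close>)
  then show "ring_act act a u \<in> M" "\<phi> (ring_act act a u) = ring_act act' a (\<phi> u)" by auto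
qed

context monoid
begin

abbreviation ZG where "ZG \<equiv> monoid_ring G"

lemma gmodule_regular: "gmodule G (\<lambda>s. (\<otimes>) s) (frags_on (carrier G))"
  by (rule gmodule_frags_on) (auto simp: m_assoc)

lemma ring_act_mult:
  assumes M: "gmodule G act M" "u \<in> M" and a: "a \<in> frags_on (carrier G)" and b: "b \<in> frags_on
      (carrier G)"
  shows "ring_act act (ring_act (\<otimes>) a b) u = ring_act act a (ring_act act b u)"
proof -
  have 1: "ring_act act (frag_map ((\<otimes>) s) b) u = frag_map (act s) (ring_act act b u)" if s: "s \<in>
      carrier G" for s
    using b
  proof (induction b rule: frags_on_induct)
    case (one t)
    then show ?case using gmoduleD(5)[OF M(1) s _ M(2)] by simp
  qed (auto simp: ring_act_diff frag_map_diff)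
  from a show ?thesis
    by (induction a rule: frags_on_induct) (auto simp: ring_act_diff 1)
qed

lemma ring_act_one: "gmodule G act M \<Longrightarrow> u \<in> M \<Longrightarrow> ring_act act (frag_of \<one>) u = u"
  using gmoduleD(4) by simp

text \<open>Bridge between the plain functions of \<open>monoid_ring\<close> and finitely supported
  maps, on which linear induction is available.\<close>

lemma ZG_carrier: "carrier ZG = lookup ` frags_on (carrier G)"
proof (intro equalityI subsetI)
  fix f assume "f \<in> carrier ZG"
  then have f: "finite {x. f x \<noteq> 0}" "{x. f x \<noteq> 0} \<subseteq> carrier G" by (auto simp: monoid_ring_def)
  have "f = lookup (Abs_poly_mapping f)" using f(1) by simp
  moreover have "Abs_poly_mapping f \<in> frags_on (carrier G)"
    using f by (auto simp: frags_on_def in_keys_iff)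
  ultimately show "f \<in> lookup ` frags_on (carrier G)" by blast
next
  fix f assume "f \<in> lookup ` frags_on (carrier G)"
  then show "f \<in> carrier ZG" by (auto simp: monoid_ring_def frags_on_def in_keys_iff subset_iff)
qed

lemma frag_in_ZG: "a \<in> frags_on (carrier G) \<Longrightarrow> lookup a \<in> carrier ZG"
  unfolding ZG_carrier by blast

lemma ZG_zero: "\<zero>\<^bsub>ZG\<^esub> = lookup 0"
  and ZG_one: "\<one>\<^bsub>ZG\<^esub> = lookup (frag_of \<one>)"
  and ZG_add: "lookup a \<oplus>\<^bsub>ZG\<^esub> lookup b = lookup (a + b)"
  by (simp_all add: monoid_ring_def lookup_add fun_eq_iff)

lemma ZG_mult:
  "lookup a \<otimes>\<^bsub>ZG\<^esub> lookup b = lookup (ring_act (\<otimes>) a b)"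
proof
  fix z
  have k: "{x. lookup c x \<noteq> 0} = keys c" for c :: "'a \<Rightarrow>\<^sub>0 int"
    by (auto simp: in_keys_iff)
  show "(lookup a \<otimes>\<^bsub>ZG\<^esub> lookup b) z = lookup (ring_act (\<otimes>) a b) z"
    unfolding ring_act_def frag_extend_def lookup_sum lookup_frag_cmul lookup_frag_map
        sum_distrib_left
    by (simp add: monoid_ring_def k) (intro sum.cong refl, simp)
qed

lemma ring_ZG: "ring ZG"
proof (rule ringI)
  show "abelian_group ZG"
  proof (rule abelian_groupI)
    fix x assume "x \<in> carrier ZG"
    then obtain a where a: "x = lookup a" "a \<in> frags_on (carrier G)"
      unfolding ZG_carrier by blast
    have "0 - a \<in> frags_on (carrier G)" using a(2) by (intro frags_on_diff) auto
    then show "\<exists>y\<in>carrier ZG. y \<oplus>\<^bsub>ZG\<^esub> x = \<zero>\<^bsub>ZG\<^esub>"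
      unfolding ZG_carrier a(1) by (intro bexI[of _ "lookup (0 - a)"] imageI) (simp_all add:
          ZG_add ZG_zero)
  next
    fix x y assume "x \<in> carrier ZG" "y \<in> carrier ZG"
    then obtain a b where ab: "x = lookup a" "a \<in> frags_on (carrier G)"
      "y = lookup b" "b \<in> frags_on (carrier G)"
      unfolding ZG_carrier by blast
    have "a + b \<in> frags_on (carrier G)" by (rule gmodule_add[OF gmodule_regular ab(2,4)])
    then show "x \<oplus>\<^bsub>ZG\<^esub> y \<in> carrier ZG" unfolding ab ZG_add ZG_carrier by blast
  qed (auto simp: ZG_carrier ZG_zero ZG_add algebra_simps)
  show "Group.monoid ZG"
  proof (rule monoidI)
    fix x y assume "x \<in> carrier ZG" "y \<in> carrier ZG"
    then obtain a b where ab: "x = lookup a" "a \<in> frags_on (carrier G)"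
      "y = lookup b" "b \<in> frags_on (carrier G)"
      unfolding ZG_carrier by blast
    have "ring_act (\<otimes>) a b \<in> frags_on (carrier G)" using ab by (intro ring_act_frags_on) auto
    then show "x \<otimes>\<^bsub>ZG\<^esub> y \<in> carrier ZG" unfolding ab ZG_mult ZG_carrier by blast
  next
    fix x assume "x \<in> carrier ZG"
    then obtain a where a: "x = lookup a" "a \<in> frags_on (carrier G)"
      unfolding ZG_carrier by blast
    show "\<one>\<^bsub>ZG\<^esub> \<otimes>\<^bsub>ZG\<^esub> x = x" unfolding a ZG_mult ZG_one ring_act_one[OF gmodule_regular a(2)] ..
    have "ring_act (\<otimes>) a (frag_of \<one>) = a"
      using a(2) by (induction a rule: frags_on_induct) (auto simp: ring_act_diff)
    then show "x \<otimes>\<^bsub>ZG\<^esub> \<one>\<^bsub>ZG\<^esub> = x" unfolding a ZG_mult ZG_one by simp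
  next
    fix x y z assume "x \<in> carrier ZG" "y \<in> carrier ZG" "z \<in> carrier ZG"
    then obtain a b c where abc: "x = lookup a" "a \<in> frags_on (carrier G)"
      "y = lookup b" "b \<in> frags_on (carrier G)"
      "z = lookup c" "c \<in> frags_on (carrier G)"
      unfolding ZG_carrier by blast
    then show "x \<otimes>\<^bsub>ZG\<^esub> y \<otimes>\<^bsub>ZG\<^esub> z = x \<otimes>\<^bsub>ZG\<^esub> (y \<otimes>\<^bsub>ZG\<^esub> z)"
      using ring_act_mult[OF gmodule_regular abc(6,2,4)] by (simp add: ZG_mult)
  next
    show "\<one>\<^bsub>ZG\<^esub> \<in> carrier ZG" unfolding ZG_one by (rule frag_in_ZG) simp
  qed
next
  fix x y z assume "x \<in> carrier ZG" "y \<in> carrier ZG" "z \<in> carrier ZG"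
  then obtain a b c where abc: "x = lookup a" "y = lookup b" "z = lookup c"
    unfolding ZG_carrier by blast
  show "(x \<oplus>\<^bsub>ZG\<^esub> y) \<otimes>\<^bsub>ZG\<^esub> z = x \<otimes>\<^bsub>ZG\<^esub> z \<oplus>\<^bsub>ZG\<^esub> y \<otimes>\<^bsub>ZG\<^esub> z"
    unfolding abc ZG_add ZG_mult ring_act_add ..
  show "z \<otimes>\<^bsub>ZG\<^esub> (x \<oplus>\<^bsub>ZG\<^esub> y) = z \<otimes>\<^bsub>ZG\<^esub> x \<oplus>\<^bsub>ZG\<^esub> z \<otimes>\<^bsub>ZG\<^esub> y"
    unfolding abc ZG_add ZG_mult ring_act_add_right ..
qed

end

section \<open>Free modules over the monoid ring as modules of tuples\<close>

definition tuple :: "(nat \<times> 'a \<Rightarrow>\<^sub>0 int) \<Rightarrow> nat \<Rightarrow> 'a \<Rightarrow> int" where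
  "tuple u = (\<lambda>i t. lookup u (i, t))"

lemma tuple_inject [simp]: "tuple u = tuple v \<longleftrightarrow> u = v"
proof
  assume "tuple u = tuple v"
  then have "lookup u p = lookup v p" for p
    by (cases p) (simp add: tuple_def fun_eq_iff)
  then show "u = v" by (simp add: poly_mapping_eqI)
qed simp

text \<open>Exhibits the i-th coordinate as an element of the monoid ring that depends additively on
  \<open>u\<close>.\<close>

lemma tuple_component: "tuple u i = lookup (frag_extend (\<lambda>(j, t). if j = i then frag_of t else 0)
    u)"
proof -
  have "u \<in> frags_on UNIV" by (simp add: frags_on_def)
  then show ?thesis
  proof (induction u rule: frags_on_induct)
    case (one p)
    then show ?case by (cases p) (auto simp: tuple_def)
  qed (auto simp: tuple_def frag_extend_diff lookup_minus fun_eq_iff)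
qed

definition untuple :: "(nat \<Rightarrow> 'a \<Rightarrow> int) \<Rightarrow> nat \<times> 'a \<Rightarrow>\<^sub>0 int" where
  "untuple = inv_into UNIV tuple"

lemma untuple_tuple [simp]: "untuple (tuple u) = u"
  unfolding untuple_def by (rule inv_into_f_f) (simp_all add: inj_def)

text \<open>The standard free module of rank \<open>k\<close>, transported along
  \<open>tuple\<close> to the element type that \<open>type_FP_infinity\<close> prescribes.\<close>

definition tuple_module ::
  "('a, 'z) monoid_scheme \<Rightarrow> nat \<Rightarrow> ('a \<Rightarrow> int, nat \<Rightarrow> 'a \<Rightarrow> int) module" where
  "tuple_module T k =
     \<lparr>carrier = tuple ` free_module T {..<k}, monoid.mult = (\<lambda>u v. u), one = tuple 0,
      ring.zero = tuple 0, ring.add = (\<lambda>u v. tuple (untuple u + untuple v)),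
      smult = (\<lambda>f u. tuple (ring_act (free_act T) (Abs_poly_mapping f) (untuple u)))\<rparr>"

definition combination ::
  "('a \<Rightarrow> int, 'm, 'z) module_scheme \<Rightarrow> nat \<Rightarrow> (nat \<Rightarrow> 'm) \<Rightarrow> (nat \<times> 'a \<Rightarrow>\<^sub>0 int) \<Rightarrow> 'm" where
  "combination M k b u = (\<Oplus>\<^bsub>M\<^esub>i\<in>{..<k}. tuple u i \<odot>\<^bsub>M\<^esub> b i)"

lemma left_module_hom_diff:
  assumes "abelian_group M" "abelian_group N" "f \<in> left_module_hom R M N" "x \<in> carrier M" "y \<in>
      carrier M"
  shows "f (x \<ominus>\<^bsub>M\<^esub> y) = f x \<ominus>\<^bsub>N\<^esub> f y"
proof -
  interpret M: abelian_group M by fact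
  interpret N: abelian_group N by fact
  have add: "\<And>x y. x \<in> carrier M \<Longrightarrow> y \<in> carrier M \<Longrightarrow> f (x \<oplus>\<^bsub>M\<^esub> y) = f x \<oplus>\<^bsub>N\<^esub> f y"
    and closed: "\<And>x. x \<in> carrier M \<Longrightarrow> f x \<in> carrier N"
    using assms(3) by (auto simp: left_module_hom_def)
  have d: "x \<ominus>\<^bsub>M\<^esub> y \<in> carrier M" using assms by simp
  have "x \<ominus>\<^bsub>M\<^esub> y \<oplus>\<^bsub>M\<^esub> y = x" using assms by (simp add: M.minus_eq M.a_assoc M.l_neg)
  then have "f x = f (x \<ominus>\<^bsub>M\<^esub> y) \<oplus>\<^bsub>N\<^esub> f y" using add[OF d assms(5)] by simp
  then show ?thesis using closed[OF d] closed[OF assms(5)] by (simp add: N.minus_eq N.a_assoc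
      N.r_neg)
qed

context monoid
begin

lemma tuple_closed: "u \<in> Free k \<Longrightarrow> tuple u i \<in> carrier ZG"
  unfolding tuple_component ZG_carrier
proof (intro imageI)
  assume "u \<in> Free k"
  then show "frag_extend (\<lambda>(j, t). if j = i then frag_of t else 0) u \<in> frags_on (carrier G)"
    by (induction u rule: free_module_induct) (auto simp: frag_extend_diff intro: frags_on_diff)
qed

lemma tuple_add: "tuple (u + v) i = tuple u i \<oplus>\<^bsub>ZG\<^esub> tuple v i"
  unfolding tuple_component frag_extend_add ZG_add ..

lemma ex_tuple:
  assumes "\<And>i. i < k \<Longrightarrow> c i \<in> carrier ZG"
  shows "\<exists>u\<in>Free k. \<forall>i<k. tuple u i = c i"
proof -
  have "\<forall>i\<in>{..<k}. \<exists>a. a \<in> frags_on (carrier G) \<and> lookup a = c i"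
    using assms unfolding ZG_carrier by fastforce
  then obtain a where a: "\<And>i. i < k \<Longrightarrow> a i \<in> frags_on (carrier G) \<and> lookup (a i) = c i"
    by (metis lessThan_iff)
  obtain w where w: "w \<in> tensor (frags_on (carrier G)) {..<k}" "\<forall>i\<in>{..<k}. slice i w = a i"
    using ex_tensor_slices[of "{..<k}" a "frags_on (carrier G)"] a by auto
  define u where "u = frag_map (\<lambda>(t, i). (i, t)) w"
  have "w \<in> frags_on (carrier G \<times> {..<k})" using w(1) by (simp add: tensor_frags_on)
  then have "u \<in> frags_on ({..<k} \<times> carrier G)"
    unfolding u_def by (rule frag_map_in_frags_on) auto
  then have "u \<in> Free k" by (simp add: frags_on_def free_module_def)
  moreover have "tuple u i = c i" if "i < k" for i
  proof -
    have "tuple u i = lookup (slice i w)"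
      unfolding tuple_component u_def frag_extend_frag_map slice_def
      by (intro arg_cong[of _ _ lookup] frag_extend_eq) auto
    then show ?thesis using w(2) a that by simp
  qed
  ultimately show ?thesis by blast
qed

lemma tuple_eqI:
  assumes "u \<in> Free k" "v \<in> Free k" "\<And>i. i < k \<Longrightarrow> tuple u i = tuple v i"
  shows "u = v"
proof (rule poly_mapping_eqI)
  fix p :: "nat \<times> 'a"
  obtain i t where p: "p = (i, t)" by (cases p)
  show "lookup u p = lookup v p"
  proof (cases "i < k")
    case True
    then show ?thesis using assms(3)[OF True] by (simp add: tuple_def p fun_eq_iff)
  next
    case False
    then have "p \<notin> keys u" "p \<notin> keys v"
      using assms(1,2) by (auto simp: free_module_def p)
    then show ?thesis by (simp add: in_keys_iff)
  qed
qed

lemma combination: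
  assumes M: "left_module ZG M" and b: "b \<in> {..<k} \<rightarrow> carrier M"
  shows "u \<in> Free k \<Longrightarrow> combination M k b u \<in> carrier M"
    and "u \<in> Free k \<Longrightarrow> v \<in> Free k \<Longrightarrow>
      combination M k b (u + v) = combination M k b u \<oplus>\<^bsub>M\<^esub> combination M k b v"
    and "u \<in> Free k \<Longrightarrow> v \<in> Free k \<Longrightarrow>
      combination M k b (u - v) = combination M k b u \<ominus>\<^bsub>M\<^esub> combination M k b v"
    and "combination M k b 0 = \<zero>\<^bsub>M\<^esub>"
    and "i < k \<Longrightarrow> t \<in> carrier G \<Longrightarrow>
      combination M k b (frag_of (i, t)) = lookup (frag_of t) \<odot>\<^bsub>M\<^esub> b i"
proof -
  interpret LM: left_module ZG M by fact
  have closed: "tuple u i \<odot>\<^bsub>M\<^esub> b i \<in> carrier M" if "u \<in> Free k" "i < k" for u i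
    using LM.lsmult_closed tuple_closed[OF that(1)] b that(2) by blast
  show cl: "combination M k b u \<in> carrier M" if "u \<in> Free k" for u
    unfolding combination_def using closed[OF that] by (intro LM.M.finsum_closed) auto
  show add: "combination M k b (u + v) = combination M k b u \<oplus>\<^bsub>M\<^esub> combination M k b v"
    if uv: "u \<in> Free k" "v \<in> Free k" for u v
  proof -
    have "combination M k b (u + v) = (\<Oplus>\<^bsub>M\<^esub>i\<in>{..<k}. tuple u i \<odot>\<^bsub>M\<^esub> b i \<oplus>\<^bsub>M\<^esub> tuple v i \<odot>\<^bsub>M\<^esub> b i)"
      unfolding combination_def using closed uv tuple_closed b
      by (intro LM.M.finsum_cong') (auto simp: tuple_add LM.lsmult_l_distr Pi_iff)
    also have "\<dots> = combination M k b u \<oplus>\<^bsub>M\<^esub> combination M k b v"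
      unfolding combination_def using closed uv by (intro LM.M.finsum_addf) auto
    finally show ?thesis .
  qed
  have zero: "\<zero>\<^bsub>ZG\<^esub> \<odot>\<^bsub>M\<^esub> x = \<zero>\<^bsub>M\<^esub>" if "x \<in> carrier M" for x
    using LM.lsmult_l_distr[of "\<zero>\<^bsub>ZG\<^esub>" "\<zero>\<^bsub>ZG\<^esub>" x] LM.lsmult_closed[of "\<zero>\<^bsub>ZG\<^esub>" x] that by simp
  show z: "combination M k b 0 = \<zero>\<^bsub>M\<^esub>"
  proof -
    have "tuple 0 i = \<zero>\<^bsub>ZG\<^esub>" for i by (simp add: tuple_def ZG_zero fun_eq_iff)
    then have "combination M k b 0 = (\<Oplus>\<^bsub>M\<^esub>i\<in>{..<k}. \<zero>\<^bsub>M\<^esub>)"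
      unfolding combination_def using zero b by (intro LM.M.finsum_cong') auto
    then show ?thesis by simp
  qed
  show "combination M k b (u - v) = combination M k b u \<ominus>\<^bsub>M\<^esub> combination M k b v"
    if uv: "u \<in> Free k" "v \<in> Free k" for u v
  proof -
    have d: "u - v \<in> Free k" by (rule free_moduleD(1)[OF uv])
    have "combination M k b u = combination M k b (u - v) \<oplus>\<^bsub>M\<^esub> combination M k b v"
      using add[OF d uv(2)] by simp
    then show ?thesis using cl[OF d] cl[OF uv(2)] by (simp add: LM.M.minus_eq LM.M.a_assoc
        LM.M.r_neg)
  qed
  show "combination M k b (frag_of (i, t)) = lookup (frag_of t) \<odot>\<^bsub>M\<^esub> b i"
    if it: "i < k" "t \<in> carrier G" for i t
  proof -
    have t: "lookup (frag_of t) \<in> carrier ZG" using it by (intro frag_in_ZG) simp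
    have tup: "tuple (frag_of (i, t)) j = (if i = j then lookup (frag_of t) else \<zero>\<^bsub>ZG\<^esub>)" for j
      by (auto simp: tuple_def ZG_zero)
    have "combination M k b (frag_of (i, t))
        = (\<Oplus>\<^bsub>M\<^esub>j\<in>{..<k}. if i = j then lookup (frag_of t) \<odot>\<^bsub>M\<^esub> b j else \<zero>\<^bsub>M\<^esub>)"
      unfolding combination_def tup using t b zero LM.lsmult_closed
      by (intro LM.M.finsum_cong') (auto simp: Pi_iff)
    also have "\<dots> = lookup (frag_of t) \<odot>\<^bsub>M\<^esub> b i"
      using it t b LM.lsmult_closed by (intro LM.M.finsum_singleton) auto
    finally show ?thesis .
  qed
qed

lemma combination_act:
  assumes M: "left_module ZG M" and b: "b \<in> {..<k} \<rightarrow> carrier M" and s: "s \<in> carrier G"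
    and u: "u \<in> Free k"
  shows "combination M k b (smul G s u) = lookup (frag_of s) \<odot>\<^bsub>M\<^esub> combination M k b u"
proof -
  interpret LM: left_module ZG M by fact
  let ?s = "lookup (frag_of s)"
  have sZ: "?s \<in> carrier ZG" using s by (intro frag_in_ZG) simp
  have s_diff: "?s \<odot>\<^bsub>M\<^esub> (x \<ominus>\<^bsub>M\<^esub> y) = ?s \<odot>\<^bsub>M\<^esub> x \<ominus>\<^bsub>M\<^esub> ?s \<odot>\<^bsub>M\<^esub> y" if "x \<in> carrier M" "y \<in> carrier M"
      for x y
  proof -
    have "?s \<odot>\<^bsub>M\<^esub> x = ?s \<odot>\<^bsub>M\<^esub> (x \<ominus>\<^bsub>M\<^esub> y) \<oplus>\<^bsub>M\<^esub> ?s \<odot>\<^bsub>M\<^esub> y"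
      using LM.lsmult_r_distr[OF sZ, of "x \<ominus>\<^bsub>M\<^esub> y" y] that by (simp add: LM.M.minus_eq
          LM.M.a_assoc LM.M.l_neg)
    then show ?thesis using LM.lsmult_closed[OF sZ] that by (simp add: LM.M.minus_eq LM.M.a_assoc
        LM.M.r_neg)
  qed
  note C = combination[OF M b]
  from u show ?thesis
  proof (induction u rule: free_module_induct)
    case zero
    have "?s \<odot>\<^bsub>M\<^esub> \<zero>\<^bsub>M\<^esub> = \<zero>\<^bsub>M\<^esub>"
      using LM.lsmult_r_distr[OF sZ, of "\<zero>\<^bsub>M\<^esub>" "\<zero>\<^bsub>M\<^esub>"] LM.lsmult_closed[OF sZ, of "\<zero>\<^bsub>M\<^esub>"] by simp
    then show ?case by (simp add: C(4))
  next
    case (one i t)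
    have tZ: "lookup (frag_of t) \<in> carrier ZG" using one by (intro frag_in_ZG) simp
    have "?s \<otimes>\<^bsub>ZG\<^esub> lookup (frag_of t) = lookup (frag_of (s \<otimes> t))"
      unfolding ZG_mult by simp
    then show ?case using one s C(5) LM.lsmult_assoc[OF sZ tZ funcset_mem[OF b, of i]] by simp
  next
    case (diff u v)
    have f: "smul G s u \<in> Free k" "smul G s v \<in> Free k"
      using diff(1,2) s free_act_closed by auto
    have c: "combination M k b u \<in> carrier M" "combination M k b v \<in> carrier M" using C(1)
        diff(1,2) by auto
    have "combination M k b (smul G s (u - v))
        = ?s \<odot>\<^bsub>M\<^esub> combination M k b u \<ominus>\<^bsub>M\<^esub> ?s \<odot>\<^bsub>M\<^esub> combination M k b v"
      unfolding frag_map_diff C(3)[OF f] diff(3,4) ..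
    also have "\<dots> = ?s \<odot>\<^bsub>M\<^esub> combination M k b (u - v)"
      unfolding C(3)[OF diff(1,2)] by (rule s_diff[OF c, symmetric])
    finally show ?case .
  qed
qed

text \<open>Translates a basis given as a finite set with unique coefficients into a finite family
  whose combination map from \<open>Free k\<close> is bijective.\<close>

lemma fg_free_iff:
  fixes M :: "('a \<Rightarrow> int, 'm, 'z) module_scheme"
  assumes M: "left_module ZG M"
  shows "fg_free_left_module ZG M \<longleftrightarrow>
    (\<exists>k b. (\<forall>i<k. b i \<in> carrier M) \<and> bij_betw (combination M k b) (Free k) (carrier M))"
proof
  interpret LM: left_module ZG M by fact
  assume "fg_free_left_module ZG M"
  from this[unfolded fg_free_left_module_def, THEN conjunct2]
  obtain B where "finite B \<and> B \<subseteq> carrier M \<and>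
      (\<forall>m\<in>carrier M. \<exists>!c. c \<in> B \<rightarrow>\<^sub>E carrier ZG \<and> m = (\<Oplus>\<^bsub>M\<^esub>x\<in>B. c x \<odot>\<^bsub>M\<^esub> x))"
    by (rule exE)
  then have B: "finite B" "B \<subseteq> carrier M"
    and uniq: "\<And>m. m \<in> carrier M \<Longrightarrow> \<exists>!c. c \<in> B \<rightarrow>\<^sub>E carrier ZG \<and> m = (\<Oplus>\<^bsub>M\<^esub>x\<in>B. c x \<odot>\<^bsub>M\<^esub> x)"
    by simp_all
  obtain b where b: "bij_betw b {..<card B} B"
    using ex_bij_betw_nat_finite[OF B(1)] by (auto simp: atLeast0LessThan)
  define k where "k = card B"
  have bM: "b i \<in> carrier M" if "i < k" for i using b B(2) that by (auto simp: bij_betw_def k_def)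
  have bP: "b \<in> {..<k} \<rightarrow> carrier M" using bM by auto
  note C = combination[OF M bP]
  have inj: "inj_on b {..<k}" and im: "b ` {..<k} = B" using b by (auto simp: bij_betw_def k_def)
  \<comment> \<open>Coordinates are transported from indices to elements of \<open>B\<close>. The
    restriction makes the function extensional, as uniqueness of coefficients is stated among such
    functions.\<close>
  define cf where "cf = (\<lambda>u :: nat \<times> 'a \<Rightarrow>\<^sub>0 int. restrict (\<lambda>x. tuple u (inv_into {..<k} b x)) B)"
  have cfb: "cf u (b i) = tuple u i" if "i < k" for u i
    using inv_into_f_f[OF inj, of i] that im by (auto simp: cf_def)
  have cfE: "cf u \<in> B \<rightarrow>\<^sub>E carrier ZG" if "u \<in> Free k" for u
    using tuple_closed[OF that] by (auto simp: cf_def)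
  have sum: "(\<Oplus>\<^bsub>M\<^esub>x\<in>B. cf u x \<odot>\<^bsub>M\<^esub> x) = combination M k b u" if u: "u \<in> Free k" for u
  proof -
    have "(\<Oplus>\<^bsub>M\<^esub>x\<in>b ` {..<k}. cf u x \<odot>\<^bsub>M\<^esub> x) = (\<Oplus>\<^bsub>M\<^esub>i\<in>{..<k}. cf u (b i) \<odot>\<^bsub>M\<^esub> b i)"
      using cfE[OF u] LM.lsmult_closed B(2) im by (intro LM.M.finsum_reindex[OF _ inj]) (auto
          simp: PiE_iff)
    also have "\<dots> = combination M k b u"
      unfolding combination_def using cfb tuple_closed[OF u] bM LM.lsmult_closed by (intro
          LM.M.finsum_cong') auto
    finally show ?thesis unfolding im .
  qed
  have "bij_betw (combination M k b) (Free k) (carrier M)"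
  proof (intro bij_betwI' )
    fix u v assume uv: "u \<in> Free k" "v \<in> Free k"
    show "combination M k b u = combination M k b v \<longleftrightarrow> u = v"
    proof
      assume eq: "combination M k b u = combination M k b v"
      from uniq[OF C(1)[OF uv(1)]] obtain c where
        c: "\<forall>c'. c' \<in> B \<rightarrow>\<^sub>E carrier ZG \<and> combination M k b u = (\<Oplus>\<^bsub>M\<^esub>x\<in>B. c' x \<odot>\<^bsub>M\<^esub> x) \<longrightarrow> c' = c"
        by (elim ex1E) simp
      have "cf u = c" using c[rule_format, of "cf u"] cfE[OF uv(1)] sum[OF uv(1)] by simp
      moreover have "cf v = c" using c[rule_format, of "cf v"] cfE[OF uv(2)] sum[OF uv(2)] eq by
          simp
      ultimately have "cf u = cf v" by simp
      then have "tuple u i = tuple v i" if "i < k" for i using cfb[OF that] by metis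
      then show "u = v" by (rule tuple_eqI[OF uv])
    qed simp
  next
    fix m assume m: "m \<in> carrier M"
    from uniq[OF m] obtain c where c: "c \<in> B \<rightarrow>\<^sub>E carrier ZG" "m = (\<Oplus>\<^bsub>M\<^esub>x\<in>B. c x \<odot>\<^bsub>M\<^esub> x)"
      by (elim ex1E conjE)
    have "c (b i) \<in> carrier ZG" if "i < k" for i using c(1) im that by (auto simp: PiE_iff)
    then obtain u where u: "u \<in> Free k" "\<forall>i<k. tuple u i = c (b i)"
      using ex_tuple[of k "\<lambda>i. c (b i)"] by blast
    have "cf u = c"
    proof (rule PiE_ext[OF cfE[OF u(1)] c(1)])
      fix x assume "x \<in> B"
      then obtain i where "i < k" "x = b i" using im by blast
      then show "cf u x = c x" using cfb u(2) by simp
    qed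
    then show "\<exists>u\<in>Free k. m = combination M k b u" using sum[OF u(1)] c(2) u(1) by metis
  qed (rule C(1))
  then show "\<exists>k b. (\<forall>i<k. b i \<in> carrier M) \<and> bij_betw (combination M k b) (Free k) (carrier M)"
    using bM by blast
next
  interpret LM: left_module ZG M by fact
  assume "\<exists>k b. (\<forall>i<k. b i \<in> carrier M) \<and> bij_betw (combination M k b) (Free k) (carrier M)"
  then obtain k :: nat and b where bM: "\<And>i. i < k \<Longrightarrow> b i \<in> carrier M"
    and bij: "bij_betw (combination M k b) (Free k) (carrier M)" by blast
  have bP: "b \<in> {..<k} \<rightarrow> carrier M" using bM by auto
  note C = combination[OF M bP]
  have cinj: "inj_on (combination M k b) (Free k)"
    and cim: "combination M k b ` Free k = carrier M" using bij by (auto simp: bij_betw_def)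
  have unit: "combination M k b (frag_of (i, \<one>)) = b i" if "i < k" for i
    using C(5)[OF that one_closed] LM.lsmult_one[OF bM[OF that]] by (simp add: ZG_one)
  \<comment> \<open>Passing from a family to the set of its members must not merge basis elements.
    Equal members would have distinct unit vectors with the same combination.\<close>
  have inj: "inj_on b {..<k}"
  proof (rule inj_onI)
    fix i j assume ij: "i \<in> {..<k}" "j \<in> {..<k}" "b i = b j"
    then have "frag_of (i, \<one>) = (frag_of (j, \<one>) :: nat \<times> 'a \<Rightarrow>\<^sub>0 int)"
      using unit by (intro inj_onD[OF cinj]) auto
    then show "i = j" by (simp add: frag_of_eq)
  qed
  define B where "B = b ` {..<k}"
  have sum: "(\<Oplus>\<^bsub>M\<^esub>x\<in>B. c x \<odot>\<^bsub>M\<^esub> x) = combination M k b u"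
    if c: "c \<in> B \<rightarrow>\<^sub>E carrier ZG" and u: "u \<in> Free k" "\<And>i. i < k \<Longrightarrow> tuple u i = c (b i)" for c u
  proof -
    have "(\<Oplus>\<^bsub>M\<^esub>x\<in>b ` {..<k}. c x \<odot>\<^bsub>M\<^esub> x) = (\<Oplus>\<^bsub>M\<^esub>i\<in>{..<k}. c (b i) \<odot>\<^bsub>M\<^esub> b i)"
      using c LM.lsmult_closed bM by (intro LM.M.finsum_reindex[OF _ inj]) (auto simp: PiE_iff
          B_def)
    also have "\<dots> = combination M k b u"
      unfolding combination_def using u(2)[symmetric] tuple_closed[OF u(1)] bM LM.lsmult_closed by
          (intro LM.M.finsum_cong') auto
    finally show ?thesis unfolding B_def .
  qed
  have tup: "\<exists>u\<in>Free k. \<forall>i<k. tuple u i = c (b i)" if "c \<in> B \<rightarrow>\<^sub>E carrier ZG" for c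
    using that by (intro ex_tuple) (auto simp: PiE_iff B_def)
  have "\<exists>!c. c \<in> B \<rightarrow>\<^sub>E carrier ZG \<and> m = (\<Oplus>\<^bsub>M\<^esub>x\<in>B. c x \<odot>\<^bsub>M\<^esub> x)" if m: "m \<in> carrier M" for m
  proof -
    obtain u where u: "u \<in> Free k" "m = combination M k b u" using cim m by blast
    define c where "c = restrict (\<lambda>x. tuple u (inv_into {..<k} b x)) B"
    have c: "c \<in> B \<rightarrow>\<^sub>E carrier ZG" using tuple_closed[OF u(1)] by (auto simp: c_def)
    have cb: "tuple u i = c (b i)" if "i < k" for i
      using inv_into_f_f[OF inj, of i] that by (auto simp: c_def B_def)
    show ?thesis
    proof (rule ex1I[of _ c])
      show "c \<in> B \<rightarrow>\<^sub>E carrier ZG \<and> m = (\<Oplus>\<^bsub>M\<^esub>x\<in>B. c x \<odot>\<^bsub>M\<^esub> x)" using c sum[OF c u(1) cb] u(2) by simp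
      fix c' assume c': "c' \<in> B \<rightarrow>\<^sub>E carrier ZG \<and> m = (\<Oplus>\<^bsub>M\<^esub>x\<in>B. c' x \<odot>\<^bsub>M\<^esub> x)"
      then obtain v where v: "v \<in> Free k" "\<And>i. i < k \<Longrightarrow> tuple v i = c' (b i)" using tup by blast
      have "combination M k b v = combination M k b u" using sum[OF conjunct1[OF c'] v] c' u(2) by
          simp
      then have "v = u" using inj_onD[OF cinj] u(1) v(1) by blast
      show "c' = c"
      proof (rule PiE_ext[OF conjunct1[OF c'] c])
        fix x assume "x \<in> B"
        then obtain i where "i < k" "x = b i" by (auto simp: B_def)
        then show "c' x = c x" using v(2) cb \<open>v = u\<close> by metis
      qed
    qed
  qed
  moreover have "finite B" "B \<subseteq> carrier M" using bM by (auto simp: B_def)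
  ultimately show "fg_free_left_module ZG M"
    unfolding fg_free_left_module_def by (intro conjI M exI[of _ B] ballI)
qed

end

section \<open>Resolutions\<close>

context monoid
begin

lemma tuple_module_carrier: "carrier (tuple_module G k) = tuple ` Free k"
  and tuple_module_zero: "\<zero>\<^bsub>tuple_module G k\<^esub> = tuple 0"
  and tuple_module_add: "tuple u \<oplus>\<^bsub>tuple_module G k\<^esub> tuple v = tuple (u + v)"
  and tuple_module_smult:
    "lookup a \<odot>\<^bsub>tuple_module G k\<^esub> tuple u = tuple (ring_act (free_act G) a u)"
  by (simp_all add: tuple_module_def)

lemma ring_act_free:
  "a \<in> frags_on (carrier G) \<Longrightarrow> u \<in> free_module G I \<Longrightarrow> ring_act (free_act G) a u \<in> free_module G I"
  by (induction a rule: frags_on_induct) (auto simp: ring_act_diff intro: free_moduleD)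

lemma left_module_tuple_module: "left_module ZG (tuple_module G k)"
proof -
  interpret R: ring ZG by (rule ring_ZG)
  interpret A: abelian_group "tuple_module G k"
  proof (rule abelian_groupI)
    fix x y assume "x \<in> carrier (tuple_module G k)" "y \<in> carrier (tuple_module G k)"
    then show "x \<oplus>\<^bsub>tuple_module G k\<^esub> y \<in> carrier (tuple_module G k)"
      by (auto simp: tuple_module_carrier tuple_module_add intro!: free_moduleD)
  next
    fix x assume "x \<in> carrier (tuple_module G k)"
    then obtain u where u: "u \<in> Free k" "x = tuple u" by (auto simp: tuple_module_carrier)
    have "0 - u \<in> Free k" using u(1) by (intro free_moduleD) auto
    then show "\<exists>y\<in>carrier (tuple_module G k). y \<oplus>\<^bsub>tuple_module G k\<^esub> x = \<zero>\<^bsub>tuple_module G k\<^esub>"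
      by (intro bexI[of _ "tuple (0 - u)"]) (auto simp: u(2) tuple_module_add tuple_module_zero
          tuple_module_carrier)
  qed (auto simp: tuple_module_carrier tuple_module_zero tuple_module_add add_ac)
  note defs = ZG_carrier tuple_module_carrier tuple_module_smult tuple_module_add
  show ?thesis
  proof (unfold_locales)
    fix f x assume "f \<in> carrier ZG" "x \<in> carrier (tuple_module G k)"
    then show "f \<odot>\<^bsub>tuple_module G k\<^esub> x \<in> carrier (tuple_module G k)"
      by (auto simp: defs intro!: ring_act_free)
  next
    fix f g x assume "f \<in> carrier ZG" "g \<in> carrier ZG" "x \<in> carrier (tuple_module G k)"
    then obtain a b u where *: "f = lookup a" "g = lookup b" "x = tuple u"
      "a \<in> frags_on (carrier G)" "b \<in> frags_on (carrier G)" "u \<in> Free k"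
      unfolding defs by blast
    show "(f \<oplus>\<^bsub>ZG\<^esub> g) \<odot>\<^bsub>tuple_module G k\<^esub> x
        = f \<odot>\<^bsub>tuple_module G k\<^esub> x \<oplus>\<^bsub>tuple_module G k\<^esub> g \<odot>\<^bsub>tuple_module G k\<^esub> x"
      unfolding *(1-3) ZG_add tuple_module_smult tuple_module_add ring_act_add ..
    show "(f \<otimes>\<^bsub>ZG\<^esub> g) \<odot>\<^bsub>tuple_module G k\<^esub> x = f \<odot>\<^bsub>tuple_module G k\<^esub> (g \<odot>\<^bsub>tuple_module G k\<^esub> x)"
      unfolding *(1-3) ZG_mult tuple_module_smult ring_act_mult[OF gmodule_free *(6,4,5)] ..
  next
    fix f x y assume "f \<in> carrier ZG" "x \<in> carrier (tuple_module G k)" "y \<in> carrier (tuple_module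
        G k)"
    then obtain a u v where *: "f = lookup a" "x = tuple u" "y = tuple v"
      unfolding defs by blast
    show "f \<odot>\<^bsub>tuple_module G k\<^esub> (x \<oplus>\<^bsub>tuple_module G k\<^esub> y)
        = f \<odot>\<^bsub>tuple_module G k\<^esub> x \<oplus>\<^bsub>tuple_module G k\<^esub> f \<odot>\<^bsub>tuple_module G k\<^esub> y"
      unfolding * tuple_module_smult tuple_module_add ring_act_add_right ..
  next
    fix x assume "x \<in> carrier (tuple_module G k)"
    then obtain u where u: "u \<in> Free k" "x = tuple u" by (auto simp: tuple_module_carrier)
    show "\<one>\<^bsub>ZG\<^esub> \<odot>\<^bsub>tuple_module G k\<^esub> x = x"
      unfolding u(2) ZG_one tuple_module_smult ring_act_one[OF gmodule_free u(1)] ..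
  qed
qed

lemma fg_free_tuple_module: "fg_free_left_module ZG (tuple_module G k)"
proof -
  define b where "b = (\<lambda>i. tuple (frag_of (i, \<one>)) :: nat \<Rightarrow> 'a \<Rightarrow> int)"
  have b: "b \<in> {..<k} \<rightarrow> carrier (tuple_module G k)"
    by (auto simp: b_def tuple_module_carrier)
  note C = combination[OF left_module_tuple_module b]
  interpret L: left_module ZG "tuple_module G k" by (rule left_module_tuple_module)
  have minus: "tuple u \<ominus>\<^bsub>tuple_module G k\<^esub> tuple v = tuple (u - v)"
    if uv: "u \<in> Free k" "v \<in> Free k" for u v
  proof -
    have c: "tuple u \<in> carrier (tuple_module G k)" "tuple v \<in> carrier (tuple_module G k)"
      "tuple (u - v) \<in> carrier (tuple_module G k)"
      using uv free_moduleD(1)[OF uv] by (auto simp: tuple_module_carrier)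
    have "tuple u = tuple (u - v) \<oplus>\<^bsub>tuple_module G k\<^esub> tuple v" by (simp add: tuple_module_add)
    then show ?thesis using c by (simp add: L.M.minus_eq L.M.a_assoc L.M.r_neg)
  qed
  have "combination (tuple_module G k) k b u = tuple u" if "u \<in> Free k" for u
    using that
  proof (induction u rule: free_module_induct)
    case zero
    show ?case by (simp add: C(4) tuple_module_zero)
  next
    case (one i t)
    then show ?case using C(5)[of i t] by (simp add: b_def tuple_module_smult del: lookup_frag_of)
  next
    case (diff u v)
    then show ?case by (simp add: C(3) minus)
  qed
  then have "bij_betw (combination (tuple_module G k) k b) (Free k) (carrier (tuple_module G k))"
    unfolding tuple_module_carrier bij_betw_def by (auto intro!: inj_onI image_cong)
  then show ?thesis unfolding fg_free_iff[OF left_module_tuple_module] using b by blast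
qed

lemma tuple_hom:
  assumes "ghom G (free_act G) (free_act G) (Free k) \<phi>"
    and "\<And>u. u \<in> Free k \<Longrightarrow> \<phi> u \<in> Free l"
  shows "(\<lambda>v. tuple (\<phi> (untuple v))) \<in> left_module_hom ZG (tuple_module G k) (tuple_module G l)"
proof -
  have "\<phi> (u + v) = \<phi> u + \<phi> v" if "u \<in> Free k" "v \<in> Free k" for u v
    by (rule ghom_add[OF assms(1) gmodule_free that])
  moreover have "\<phi> (ring_act (free_act G) a u) = ring_act (free_act G) a (\<phi> u)"
    if "u \<in> Free k" "a \<in> frags_on (carrier G)" for a u
    by (rule ghom_ring_act(2)[OF gmodule_free assms(1) that])
  ultimately show ?thesis
    using assms(2) unfolding left_module_hom_def ZG_carrier tuple_module_carrier
    by (auto simp: tuple_module_add tuple_module_smult)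
qed

text \<open>A resolution by the modules \<open>Free (k n)\<close>, recorded by the images of basis
  elements: \<open>m\<close> gives the augmentation and \<open>d n\<close> the map from degree
  \<open>Suc n\<close> to degree \<open>n\<close>. Exactness says that these images generate the
  preceding syzygies.\<close>

definition resolution ::
  "(nat \<Rightarrow> nat) \<Rightarrow> (nat \<Rightarrow> unit \<Rightarrow>\<^sub>0 int) \<Rightarrow> (nat \<Rightarrow> nat \<Rightarrow> nat \<times> 'a \<Rightarrow>\<^sub>0 int) \<Rightarrow> bool" where
  "resolution k m d \<longleftrightarrow>
     generates G trivial_act UNIV {..<k 0} m \<and>
     generates G (free_act G) (syzygies G trivial_act {..<k 0} m) {..<k 1} (d 0) \<and>
     (\<forall>n. generates G (free_act G) (syzygies G (free_act G) {..<k (Suc n)} (d n))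
            {..<k (Suc (Suc n))} (d (Suc n)))"

lemma resolution_imp_FP:
  assumes "resolution k m d"
  shows "FP G trivial_act n UNIV"
proof -
  have syz: "FP G (free_act G) n (syzygies G (free_act G) {..<k (Suc j)} (d j))" for n j
  proof (induction n arbitrary: j)
    case 0
    show ?case using assms unfolding resolution_def FP_0 by blast
  next
    case (Suc n)
    show ?case using assms Suc unfolding resolution_def FP_Suc by blast
  qed
  have g: "generates G (free_act G) (syzygies G trivial_act {..<k 0} m) {..<k 1} (d 0)"
    "generates G trivial_act UNIV {..<k 0} m"
    using assms by (auto simp: resolution_def)
  have "FP G (free_act G) n (syzygies G trivial_act {..<k 0} m)" for n
  proof (cases n)
    case 0
    show ?thesis unfolding 0 FP_0 using g(1) by blast
  next
    case (Suc n')
    have "FP G (free_act G) n' (syzygies G (free_act G) {..<k 1} (d 0))" using syz[of n' 0] by simp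
    then show ?thesis using g(1) unfolding Suc FP_Suc by blast
  qed
  then show ?thesis using FP_all_iff_FP_syzygies[OF gmodule_trivial g(2)] by blast
qed

text \<open>The hypotheses for different \<open>n\<close> may be witnessed by unrelated generators.
  Fix one choice for every syzygy module; by Schanuel's lemma the next syzygy module is again of
  type FP_n for all n, so the choice can be iterated forever.\<close>

lemma FP_imp_resolution:
  assumes "\<And>n. FP G trivial_act n UNIV"
  shows "\<exists>k m d. resolution k m d"
proof -
  define P where "P K p \<longleftrightarrow> generates G (free_act G) K {..<fst p} (snd p)"
    for K and p :: "nat \<times> (nat \<Rightarrow> nat \<times> 'a \<Rightarrow>\<^sub>0 int)"
  define step where "step K = (SOME p. P K p)" for K
  define next_syz where "next_syz K = syzygies G (free_act G) {..<fst (step K)} (snd (step K))"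
      for K
  define K0 where "K0 = syzygies G trivial_act {..<1::nat} (\<lambda>_. frag_of ())"
  define K where "K j = (next_syz ^^ j) K0" for j
  have step: "P L (step L)" if "FP G (free_act G) 0 L" for L
  proof -
    obtain k m where "generates G (free_act G) L {..<k::nat} m" using \<open>FP G (free_act G) 0 L\<close>
        unfolding FP_0 by blast
    then have "P L (k, m)" by (simp add: P_def)
    then show ?thesis unfolding step_def by (rule someI)
  qed
  have K: "gmodule G (free_act G) (K j) \<and> (\<forall>n. FP G (free_act G) n (K j))" for j
  proof (induction j)
    case 0
    have "K 0 = K0" by (simp add: K_def)
    then show ?case
      using gmodule_syzygies[OF gmodule_trivial, of "\<lambda>_. frag_of ()" "{..<1::nat}"]
        FP_all_iff_FP_syzygies[OF gmodule_trivial generates_trivial] assms by (auto simp: K0_def)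
  next
    case (Suc j)
    have KS: "K (Suc j) = syzygies G (free_act G) {..<fst (step (K j))} (snd (step (K j)))"
      by (simp add: K_def next_syz_def)
    have g: "generates G (free_act G) (K j) {..<fst (step (K j))} (snd (step (K j)))"
      using step Suc unfolding P_def by blast
    have "snd (step (K j)) \<in> {..<fst (step (K j))} \<rightarrow> K j" using generatesD(1)[OF g] by blast
    then show ?case
      unfolding KS using gmodule_syzygies Suc FP_syzygies[OF _ _ g] by blast
  qed
  \<comment> \<open>Degree 0 has the single generator of the trivial module; degree
    \<open>Suc j\<close> has the generators chosen for the j-th syzygy module \<open>K j\<close>,
    hence the offset.\<close>
  define k where "k n = (case n of 0 \<Rightarrow> 1 | Suc j \<Rightarrow> fst (step (K j)))" for n
  define d where "d n = snd (step (K n))" for n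
  have gen: "generates G (free_act G) (K n) {..<k (Suc n)} (d n)" for n
    using step K unfolding P_def k_def d_def by simp
  have "K (Suc n) = syzygies G (free_act G) {..<k (Suc n)} (d n)" for n
    by (simp add: K_def next_syz_def k_def d_def)
  then have "resolution k (\<lambda>_. frag_of ()) d"
    unfolding resolution_def using gen[of 0] gen generates_trivial
    by (metis K0_def K_def One_nat_def funpow_0 k_def old.nat.simps(4))
  then show ?thesis by blast
qed

text \<open>Fixes the type of scalars, which would otherwise remain undetermined in statements about
  the trivial module.\<close>

abbreviation trivial_ZG_module :: "('a \<Rightarrow> int, int) module" where
  "trivial_ZG_module \<equiv> trivial_module"

lemma ring_act_trivial:
  "lookup (ring_act trivial_act a w) ()
    = (\<Sum>x | lookup a x \<noteq> 0. lookup a x) * lookup w ()"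
proof -
  have "a \<in> frags_on UNIV" by (simp add: frags_on_def)
  then show ?thesis
    unfolding sum_coefficients
  proof (induction a rule: frags_on_induct)
    case (one s)
    have "frag_map (\<lambda>x::unit. x) w = w" by (rule frag_map_ident) simp
    then show ?case by simp
  qed (auto simp: ring_act_diff frag_map_diff lookup_minus left_diff_distrib)
qed

lemma unit_frag_eqI: "lookup v () = lookup w () \<Longrightarrow> v = w"
  by (rule poly_mapping_eqI) simp

text \<open>All maps are conjugated by \<open>tuple\<close>. Generation of a syzygy module by
  \<open>d n\<close> means that it is the image of the corresponding homomorphism, which is
  exactness.\<close>

lemma resolution_imp_type_FP_infinity:
  assumes res: "resolution k m d"
  shows "type_FP_infinity G"
proof -
  define P where "P n = tuple_module G (k n)" for n
  define D where "D n = (\<lambda>v. tuple (lin (free_act G) (d n) (untuple v)))" for n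
  define \<epsilon> where "\<epsilon> = (\<lambda>v :: nat \<Rightarrow> 'a \<Rightarrow> int. lookup (lin trivial_act m (untuple v)) ())"
  have g0: "generates G trivial_act UNIV {..<k 0} m"
    and g1: "generates G (free_act G) (syzygies G trivial_act {..<k 0} m) {..<k 1} (d 0)"
    and g2: "\<And>n. generates G (free_act G) (syzygies G (free_act G) {..<k (Suc n)} (d n)) {..<k
        (Suc (Suc n))} (d (Suc n))"
    using res by (auto simp: resolution_def)
  have mU: "m \<in> {..<k 0} \<rightarrow> UNIV" by simp
  have dF: "d n \<in> {..<k (Suc n)} \<rightarrow> Free (k n)" for n
  proof (cases n)
    case 0
    then show ?thesis using generatesD(1)[OF g1] by (auto simp: syzygies_def)
  next
    case (Suc j)
    then show ?thesis using generatesD(1)[OF g2[of j]] by (auto simp: syzygies_def)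
  qed
  have image: "lin act m' ` free_module G I = M"
    if "gmodule G act M" "generates G act M I m'" for act :: "'a \<Rightarrow> 'q \<Rightarrow> 'q" and M and I :: "nat
        set" and m'
  proof -
    have "m' \<in> I \<rightarrow> M" using generatesD(1)[OF that(2)] by blast
    then show ?thesis using lin_closed[OF that(1)] generates_surj[OF that(2)] by blast
  qed
  have D_image: "D n ` carrier (P (Suc n)) = tuple ` L"
    if "generates G (free_act G) L {..<k (Suc n)} (d n)" "gmodule G (free_act G) L" for n L
  proof -
    have "D n ` carrier (P (Suc n)) = tuple ` lin (free_act G) (d n) ` Free (k (Suc n))"
      unfolding D_def P_def tuple_module_carrier by (simp add: image_image)
    also have "lin (free_act G) (d n) ` Free (k (Suc n)) = L" by (rule image[OF that(2,1)])
    finally show ?thesis .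
  qed
  have "fg_free_left_module ZG (P n)" for n unfolding P_def by (rule fg_free_tuple_module)
  moreover have "D n \<in> left_module_hom ZG (P (Suc n)) (P n)" for n
    unfolding P_def D_def by (rule tuple_hom[OF ghom_lin[OF gmodule_free dF] lin_closed[OF
        gmodule_free dF]])
  moreover have "\<epsilon> \<in> left_module_hom ZG (P 0) trivial_module"
  proof -
    have "lookup (lin trivial_act m (ring_act (free_act G) a u)) ()
        = (\<Sum>x | lookup a x \<noteq> 0. lookup a x) * lookup (lin trivial_act m u) ()"
      if "u \<in> Free (k 0)" "a \<in> frags_on (carrier G)" for a u
      unfolding ghom_ring_act(2)[OF gmodule_free ghom_lin[OF gmodule_trivial mU] that] by (rule
          ring_act_trivial)
    then show ?thesis
      unfolding left_module_hom_def ZG_carrier P_def tuple_module_carrier \<epsilon>_def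
      by (auto simp: tuple_module_add tuple_module_smult lin_add lookup_add trivial_module_def)
  qed
  moreover have "\<epsilon> ` carrier (P 0) = carrier trivial_ZG_module"
  proof -
    have "\<epsilon> ` carrier (P 0) = (\<lambda>w. lookup w ()) ` lin trivial_act m ` Free (k 0)"
      unfolding \<epsilon>_def P_def tuple_module_carrier by (simp add: image_image)
    also have "\<dots> = range (\<lambda>w. lookup w ())" unfolding image[OF gmodule_trivial g0] ..
    also have "\<dots> = UNIV"
      by (rule surjI[of _ "\<lambda>z. Poly_Mapping.single () z"]) simp
    finally show ?thesis by (simp add: trivial_module_def)
  qed
  moreover have "D 0 ` carrier (P 1) = a_kernel (P 0) trivial_ZG_module \<epsilon>"
  proof -
    have lin0: "lin trivial_act m u = 0 \<longleftrightarrow> lookup (lin trivial_act m u) () = 0" for u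
      using unit_frag_eqI[of "lin trivial_act m u" 0] by (metis lookup_zero)
    have "D 0 ` carrier (P 1) = tuple ` syzygies G trivial_act {..<k 0} m"
      using D_image[of _ 0] g1 gmodule_syzygies[OF gmodule_trivial mU] by simp
    also have "\<dots> = {x \<in> carrier (P 0). \<epsilon> x = 0}"
      unfolding syzygies_def P_def tuple_module_carrier \<epsilon>_def lin0 by auto
    finally show ?thesis by (simp add: a_kernel_def kernel_def trivial_module_def)
  qed
  moreover have "D (Suc n) ` carrier (P (Suc (Suc n))) = a_kernel (P (Suc n)) (P n) (D n)" for n
  proof -
    have "D (Suc n) ` carrier (P (Suc (Suc n))) = tuple ` syzygies G (free_act G) {..<k (Suc n)}
        (d n)"
      by (rule D_image[OF g2 gmodule_syzygies[OF gmodule_free dF]])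
    also have "\<dots> = {x \<in> carrier (P (Suc n)). D n x = \<zero>\<^bsub>P n\<^esub>}"
      unfolding syzygies_def P_def tuple_module_carrier D_def tuple_module_zero by auto
    finally show ?thesis by (simp add: a_kernel_def kernel_def)
  qed
  ultimately show ?thesis unfolding type_FP_infinity_def by blast
qed

text \<open>Bases identify each \<open>P n\<close> with a standard free module through
  \<open>\<theta> n\<close>. The family \<open>d n\<close> consists of the preimages of the
  differentials of basis elements, so \<open>lin\<close> of it is \<open>D n\<close> conjugated by
  these identifications.\<close>

lemma type_FP_infinity_imp_resolution:
  assumes "type_FP_infinity G"
  shows "\<exists>k m d. resolution k m d"
proof -
  obtain P :: "nat \<Rightarrow> ('a \<Rightarrow> int, nat \<Rightarrow> 'a \<Rightarrow> int) module" and D \<epsilon> where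
    free: "\<forall>n. fg_free_left_module ZG (P n)"
    and \<epsilon>: "\<epsilon> \<in> left_module_hom ZG (P 0) trivial_module"
    and D: "\<forall>n. D n \<in> left_module_hom ZG (P (Suc n)) (P n)"
    and surj: "\<epsilon> ` carrier (P 0) = carrier trivial_ZG_module"
    and ex0: "D 0 ` carrier (P 1) = a_kernel (P 0) trivial_ZG_module \<epsilon>"
    and ex: "\<forall>n. D (Suc n) ` carrier (P (Suc (Suc n))) = a_kernel (P (Suc n)) (P n) (D n)"
    using assms unfolding type_FP_infinity_def by (elim exE conjE) (rule that)
  have LM: "left_module ZG (P n)" for n using free unfolding fg_free_left_module_def by blast
  have "\<forall>n. \<exists>k b. (\<forall>i<k. b i \<in> carrier (P n)) \<and>
      bij_betw (combination (P n) k b) (Free k) (carrier (P n))"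
    using free fg_free_iff[OF LM] by blast
  then obtain k b where kb: "\<And>n i. i < k n \<Longrightarrow> b n i \<in> carrier (P n)"
    and bij: "\<And>n. bij_betw (combination (P n) (k n) (b n)) (Free (k n)) (carrier (P n))"
    by metis
  define \<theta> where "\<theta> n = combination (P n) (k n) (b n)" for n
  have bP: "b n \<in> {..<k n} \<rightarrow> carrier (P n)" for n using kb by auto
  note C = combination[OF LM bP, folded \<theta>_def]
  have \<theta>im: "\<theta> n ` Free (k n) = carrier (P n)"
    and \<theta>inj: "inj_on (\<theta> n) (Free (k n))" for n
    using bij by (auto simp: bij_betw_def \<theta>_def)
  have AG: "abelian_group (P n)" for n using LM[of n] by (simp add: left_module_def)
  have \<epsilon>_add: "\<epsilon> (x \<oplus>\<^bsub>P 0\<^esub> y) = \<epsilon> x + \<epsilon> y" if "x \<in> carrier (P 0)" "y \<in> carrier (P 0)" for x y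
    using \<epsilon> that by (simp add: left_module_hom_def trivial_module_def)
  have Dclosed: "D n x \<in> carrier (P n)" if "x \<in> carrier (P (Suc n))" for n x
    using D that by (auto simp: left_module_hom_def)
  have delta: "lookup (frag_of t) \<in> carrier ZG" if "t \<in> carrier G" for t
    using that by (intro frag_in_ZG) simp
  define m where "m i = Poly_Mapping.single () (\<epsilon> (b 0 i))" for i
  define d where "d n i = inv_into (Free (k n)) (\<theta> n) (D n (b (Suc n) i))" for n i
  have d: "d n i \<in> Free (k n)" "\<theta> n (d n i) = D n (b (Suc n) i)" if "i < k (Suc n)" for n i
    using inv_into_into[of "D n (b (Suc n) i)" "\<theta> n"] f_inv_into_f[of "D n (b (Suc n) i)" "\<theta> n"]
      Dclosed[OF kb[OF that]] \<theta>im[of n] by (auto simp: d_def)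
  have dF: "d n \<in> {..<k (Suc n)} \<rightarrow> Free (k n)" for n using d(1) by auto
  have lin_m: "lin trivial_act m u = Poly_Mapping.single () (\<epsilon> (\<theta> 0 u))"
    if "u \<in> Free (k 0)" for u
    using that
  proof (induction u rule: free_module_induct)
    case zero
    interpret M: abelian_group "P 0" by (rule AG)
    have "\<epsilon> \<zero>\<^bsub>P 0\<^esub> = 0"
      using \<epsilon>_add[OF M.zero_closed M.zero_closed] by simp
    then show ?case by (simp add: C(4))
  next
    case (one i t)
    then have i: "i < k 0" by simp
    have "\<epsilon> (lookup (frag_of t) \<odot>\<^bsub>P 0\<^esub> b 0 i) = lookup (frag_of t) \<odot>\<^bsub>trivial_module\<^esub> \<epsilon> (b 0 i)"
      using \<epsilon> delta[OF one(2)] kb[OF i] unfolding left_module_hom_def by blast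
    also have "\<dots> = \<epsilon> (b 0 i)"
      unfolding trivial_module_def using sum_coefficients[of "frag_of t"] by (simp del:
          lookup_frag_of)
    finally show ?case using C(5)[OF i one(2)] by (simp add: m_def frag_map_ident)
  next
    case (diff u v)
    interpret M: abelian_group "P 0" by (rule AG)
    have c: "\<theta> 0 u \<in> carrier (P 0)" "\<theta> 0 v \<in> carrier (P 0)" "\<theta> 0 u \<ominus>\<^bsub>P 0\<^esub> \<theta> 0 v \<in> carrier (P 0)"
      using C(1) diff(1,2) by auto
    have "\<epsilon> ((\<theta> 0 u \<ominus>\<^bsub>P 0\<^esub> \<theta> 0 v) \<oplus>\<^bsub>P 0\<^esub> \<theta> 0 v) = \<epsilon> (\<theta> 0 u \<ominus>\<^bsub>P 0\<^esub> \<theta> 0 v) + \<epsilon> (\<theta> 0 v)"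
      by (rule \<epsilon>_add[OF c(3,2)])
    moreover have "(\<theta> 0 u \<ominus>\<^bsub>P 0\<^esub> \<theta> 0 v) \<oplus>\<^bsub>P 0\<^esub> \<theta> 0 v = \<theta> 0 u"
      using c by (simp add: M.minus_eq M.a_assoc M.l_neg)
    ultimately have "\<epsilon> (\<theta> 0 (u - v)) = \<epsilon> (\<theta> 0 u) - \<epsilon> (\<theta> 0 v)" using C(3)[OF diff(1,2)] by simp
    then show ?case using diff(3,4) by (simp add: lin_diff single_diff)
  qed
  have lin_d: "\<theta> n (lin (free_act G) (d n) u) = D n (\<theta> (Suc n) u)"
    if "u \<in> Free (k (Suc n))" for n u
    using that
  proof (induction u rule: free_module_induct)
    case zero
    interpret M: abelian_group "P (Suc n)" by (rule AG)
    interpret N: abelian_group "P n" by (rule AG)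
    have "D n (\<zero>\<^bsub>P (Suc n)\<^esub> \<ominus>\<^bsub>P (Suc n)\<^esub> \<zero>\<^bsub>P (Suc n)\<^esub>) = D n \<zero>\<^bsub>P (Suc n)\<^esub> \<ominus>\<^bsub>P n\<^esub> D n \<zero>\<^bsub>P (Suc n)\<^esub>"
      using left_module_hom_diff[OF AG AG D[rule_format]] by simp
    moreover have "\<zero>\<^bsub>P (Suc n)\<^esub> \<ominus>\<^bsub>P (Suc n)\<^esub> \<zero>\<^bsub>P (Suc n)\<^esub> = \<zero>\<^bsub>P (Suc n)\<^esub>"
      unfolding M.minus_eq by (rule M.r_neg[OF M.zero_closed])
    ultimately show ?case using Dclosed[of "\<zero>\<^bsub>P (Suc n)\<^esub>" n] by (simp add: C(4) N.minus_eq N.r_neg)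
  next
    case (one i t)
    then have i: "i < k (Suc n)" by simp
    have "\<theta> n (smul G t (d n i)) = lookup (frag_of t) \<odot>\<^bsub>P n\<^esub> \<theta> n (d n i)"
      unfolding \<theta>_def by (rule combination_act[OF LM bP one(2) d(1)[OF i]])
    also have "\<dots> = D n (lookup (frag_of t) \<odot>\<^bsub>P (Suc n)\<^esub> b (Suc n) i)"
      using D delta[OF one(2)] kb[OF i] unfolding left_module_hom_def d(2)[OF i] by auto
    finally show ?case using C(5)[OF i one(2)] by simp
  next
    case (diff u v)
    show ?case
      unfolding lin_diff C(3)[OF lin_closed[OF gmodule_free dF diff(1)] lin_closed[OF gmodule_free
          dF diff(2)]]
        diff(3,4) C(3)[OF diff(1,2)]
      using left_module_hom_diff[OF AG AG D[rule_format]] C(1) diff(1,2) by simp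
  qed
  \<comment> \<open>Exactness at \<open>P n\<close>, with \<open>L\<close> in the role of the
    kernel, pulled back along \<open>\<theta> n\<close>; injectivity turns an equation in
    \<open>P n\<close> into one in the free module.\<close>
  have gen: "generates G (free_act G) {u \<in> Free (k n). \<theta> n u \<in> L} {..<k (Suc n)} (d n)"
    if L: "D n ` carrier (P (Suc n)) = L" for n L
  proof (rule generatesI)
    fix i assume "i \<in> {..<k (Suc n)}"
    then show "d n i \<in> {u \<in> Free (k n). \<theta> n u \<in> L}" using d[of i n] kb[of i "Suc n"] L by auto
  next
    fix x assume x: "x \<in> {u \<in> Free (k n). \<theta> n u \<in> L}"
    then obtain y where y: "y \<in> carrier (P (Suc n))" "\<theta> n x = D n y" unfolding L[symmetric] by blast
    then obtain u where u: "u \<in> Free (k (Suc n))" "y = \<theta> (Suc n) u" using \<theta>im by blast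
    have "\<theta> n x = \<theta> n (lin (free_act G) (d n) u)" using lin_d[OF u(1)] y u by simp
    then have "x = lin (free_act G) (d n) u"
      using inj_onD[OF \<theta>inj] x lin_closed[OF gmodule_free dF u(1)] by blast
    then show "\<exists>u\<in>Free (k (Suc n)). x = lin (free_act G) (d n) u" using u(1) by blast
  qed
  have "generates G trivial_act UNIV {..<k 0} m"
  proof (rule generatesI)
    fix w :: "unit \<Rightarrow>\<^sub>0 int"
    have "lookup w () \<in> \<epsilon> ` carrier (P 0)" using surj by (simp add: trivial_module_def)
    then obtain x where x: "x \<in> carrier (P 0)" "\<epsilon> x = lookup w ()" by (metis imageE)
    then obtain u where u: "u \<in> Free (k 0)" "x = \<theta> 0 u" using \<theta>im by blast
    have "w = lin trivial_act m u" unfolding lin_m[OF u(1)] by (rule unit_frag_eqI) (use x u in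
        simp)
    then show "\<exists>u\<in>Free (k 0). w = lin trivial_act m u" using u(1) by blast
  qed simp
  moreover have "syzygies G trivial_act {..<k 0} m
      = {u \<in> Free (k 0). \<theta> 0 u \<in> a_kernel (P 0) trivial_ZG_module \<epsilon>}"
  proof -
    have "Poly_Mapping.single () z = 0 \<longleftrightarrow> z = 0" for z :: int by (metis lookup_single_eq
        lookup_zero single_zero)
    then show ?thesis
      using lin_m C(1) by (auto simp: syzygies_def a_kernel_def kernel_def trivial_module_def)
  qed
  moreover have "syzygies G (free_act G) {..<k (Suc n)} (d n)
      = {u \<in> Free (k (Suc n)). \<theta> (Suc n) u \<in> a_kernel (P (Suc n)) (P n) (D n)}" for n
  proof -
    have "lin (free_act G) (d n) u = 0 \<longleftrightarrow> D n (\<theta> (Suc n) u) = \<zero>\<^bsub>P n\<^esub>"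
      if u: "u \<in> Free (k (Suc n))" for u
      using lin_d[OF u] C(4)[of n] inj_onD[OF \<theta>inj _ lin_closed[OF gmodule_free dF u]
          zero_in_free] by metis
    then show ?thesis using C(1) by (auto simp: syzygies_def a_kernel_def kernel_def)
  qed
  ultimately have "resolution k m d"
    unfolding resolution_def using gen[of 0, OF ex0[unfolded One_nat_def]] gen[OF ex[rule_format]]
        by simp
  then show ?thesis by blast
qed

theorem type_FP_infinity_iff: "type_FP_infinity G \<longleftrightarrow> (\<forall>n. FP G trivial_act n UNIV)"
  using type_FP_infinity_imp_resolution resolution_imp_FP FP_imp_resolution
      resolution_imp_type_FP_infinity
  by metis

end

theorem proposition2p2:
  fixes S :: "('a, 'b) monoid_scheme" and H :: "'a set"
  assumes "inverse_monoid S"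
    and "full_inverse_subsemigroup H S"
    and "finite_index H S"
  shows "type_FP_infinity S \<longleftrightarrow> type_FP_infinity (S\<lparr>carrier := H\<rparr>)"
proof -
  interpret full_inverse_submonoid S H
    using assms(1,2) by (simp add: full_inverse_submonoid_def full_inverse_submonoid_axioms_def)
  show ?thesis
    unfolding type_FP_infinity_iff sub.type_FP_infinity_iff by (rule FP_trivial_iff[OF assms(3)])
qed

end
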